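(* Let $(X,\mu)$ and $(Y,\nu)$ be standard $\sigma$-finite measure spaces and let $\varphi : X\times Y\to\mathbb{C}$ be a measurable function. The following are equivalent: (i) $\varphi$ is a local Schur multiplier; (ii) $\varphi\in\mathcal{V}(X,Y)$.
   Context: Functions on $X\times Y$ are considered with respect to the product measure $\mu\times\nu$. Write $H_1=L^2(X,\mu)$, $H_2=L^2(Y,\nu)$; for $k\in L^2(X\times Y)$ let $I_k : H_1\to H_2$ be the Hilbert–Schmidt operator $(I_k\xi)(y)=\int_X k(x,y)\xi(x)\,d\mu(x)$. A (measurable) rectangle is a set $\alpha\times\beta$ with $\alpha\subseteq X$, $\beta\subseteq Y$ measurable. A set $E\subseteq X\times Y$ is marginally null if $E\subseteq (X_0\times Y)\cup(X\times Y_0)$ with $\mu(X_0)=\nu(Y_0)=0$; two sets are marginally equivalent if their symmetric difference is marginally null. A countable family of rectangles is a covering family if its union is marginally equivalent to $X\times Y$. A function $\varphi\in L^\infty(X\times Y)$ is a Schur multiplier if there is $C>0$ such that $\|I_{\varphi k}\|_{\mathrm{op}}\le C\|I_k\|_{\mathrm{op}}$ for all $k\in L^2(X\times Y)$; the same definition applies on any rectangle $\alpha\times\beta$ with the restricted measures, and $\mathfrak{S}(\alpha\times\beta)$ denotes the set of Schur multipliers on $\alpha\times\beta$. A measurable function $\varphi:X\times Y\to\mathbb{C}$ is a local Schur multiplier if there is a covering family $\{\kappa_m\}_{m=1}^\infty$ of rectangles in $X\times Y$ with $\varphi|_{\kappa_m}\in\mathfrak{S}(\kappa_m)$ for every $m$.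 $\mathcal{V}(X,Y)$ is the set of all measurable functions $\varphi:X\times Y\to\mathbb{C}$ for which there are measurable functions $a_i:X\to\mathbb{C}$ and $b_i:Y\to\mathbb{C}$, $i\in\mathbb{N}$, such that $\sum_i|a_i(x)|^2<\infty$ for almost all $x\in X$, $\sum_i|b_i(y)|^2<\infty$ for almost all $y\in Y$, and $\varphi(x,y)=\sum_{i=1}^\infty a_i(x)b_i(y)$ for almost all $(x,y)\in X\times Y$. *)

theory Defs
  imports "HOL-Analysis.Analysis"
begin

definition standard_borel :: "'a measure \<Rightarrow> bool" where
  "standard_borel M \<longleftrightarrow>
     (\<exists>T. topspace T = space M \<and> completely_metrizable_space T \<and> second_countable T \<and>
          sets M = sigma_sets (space M) {U. openin T U})"

definition standard_sigma_finite :: "'a measure \<Rightarrow> bool" where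
  "standard_sigma_finite M \<longleftrightarrow> standard_borel M \<and> sigma_finite_measure M"

text \<open>
  Elements of \<open>L\<^sup>2\<close> and \<open>L\<^sup>\<infinity>\<close> are represented by functions rather than by their almost-everywhere
  classes. A function on a subspace is a total function of which only the values on
  the space of the measure matter.
\<close>

definition L2_functions :: "'a measure \<Rightarrow> ('a \<Rightarrow> complex) set" where
  "L2_functions M =
     {f. f \<in> borel_measurable M \<and> integrable M (\<lambda>x. (cmod (f x))\<^sup>2)}"

definition L2_norm :: "'a measure \<Rightarrow> ('a \<Rightarrow> complex) \<Rightarrow> real" where
  "L2_norm M f = sqrt (\<integral>x. (cmod (f x))\<^sup>2 \<partial>M)"

definition Linf_functions :: "'a measure \<Rightarrow> ('a \<Rightarrow> complex) set" where
  "Linf_functions M =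
     {f. f \<in> borel_measurable M \<and> (\<exists>B. AE x in M. cmod (f x) \<le> B)}"

definition op_norm ::
  "'a measure \<Rightarrow> 'b measure \<Rightarrow> (('a \<Rightarrow> complex) \<Rightarrow> ('b \<Rightarrow> complex)) \<Rightarrow> real" where
  "op_norm M N T = (SUP \<xi>\<in>{\<xi> \<in> L2_functions M. L2_norm M \<xi> \<le> 1}. L2_norm N (T \<xi>))"

text \<open>
  The kernel \<open>k\<close> is meant to lie in \<open>L\<^sup>2\<close> of the product. Then the integral exists for almost
  every \<open>y\<close>, the image is square integrable, and \<open>L2_norm N (integral_op M k \<xi>)\<close> is at most
  \<open>L2_norm (M \<Otimes>\<^sub>M N) k * L2_norm M \<xi>\<close>, so that the supremum in
  \<open>op_norm\<close> is over a nonempty bounded set.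
\<close>

definition integral_op ::
  "'a measure \<Rightarrow> ('a \<times> 'b \<Rightarrow> complex) \<Rightarrow> ('a \<Rightarrow> complex) \<Rightarrow> ('b \<Rightarrow> complex)" where
  "integral_op M k \<xi> = (\<lambda>y. \<integral>x. k (x, y) * \<xi> x \<partial>M)"

definition schur_multiplier ::
  "'a measure \<Rightarrow> 'b measure \<Rightarrow> ('a \<times> 'b \<Rightarrow> complex) \<Rightarrow> bool" where
  "schur_multiplier M N \<phi> \<longleftrightarrow>
     \<phi> \<in> Linf_functions (M \<Otimes>\<^sub>M N) \<and>
     (\<exists>C>0. \<forall>k\<in>L2_functions (M \<Otimes>\<^sub>M N).
        op_norm M N (integral_op M (\<lambda>z. \<phi> z * k z)) \<le> C * op_norm M N (integral_op M k))"

definition marginally_null :: "'a measure \<Rightarrow> 'b measure \<Rightarrow> ('a \<times> 'b) set \<Rightarrow> bool" where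
  "marginally_null M N E \<longleftrightarrow>
     (\<exists>X\<^sub>0\<in>null_sets M. \<exists>Y\<^sub>0\<in>null_sets N. E \<subseteq> (X\<^sub>0 \<times> space N) \<union> (space M \<times> Y\<^sub>0))"

definition marginally_equivalent ::
  "'a measure \<Rightarrow> 'b measure \<Rightarrow> ('a \<times> 'b) set \<Rightarrow> ('a \<times> 'b) set \<Rightarrow> bool" where
  "marginally_equivalent M N E F \<longleftrightarrow> marginally_null M N (sym_diff E F)"

text \<open>A family of rectangles is given by its two sequences of sides.\<close>

definition covering_family ::
  "'a measure \<Rightarrow> 'b measure \<Rightarrow> (nat \<Rightarrow> 'a set) \<Rightarrow> (nat \<Rightarrow> 'b set) \<Rightarrow> bool" where
  "covering_family M N \<alpha> \<beta> \<longleftrightarrow>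
     (\<forall>m. \<alpha> m \<in> sets M \<and> \<beta> m \<in> sets N) \<and>
     marginally_equivalent M N (\<Union>m. \<alpha> m \<times> \<beta> m) (space M \<times> space N)"

definition local_schur_multiplier ::
  "'a measure \<Rightarrow> 'b measure \<Rightarrow> ('a \<times> 'b \<Rightarrow> complex) \<Rightarrow> bool" where
  "local_schur_multiplier M N \<phi> \<longleftrightarrow>
     \<phi> \<in> borel_measurable (M \<Otimes>\<^sub>M N) \<and>
     (\<exists>\<alpha> \<beta>. covering_family M N \<alpha> \<beta> \<and>
        (\<forall>m. schur_multiplier (restrict_space M (\<alpha> m)) (restrict_space N (\<beta> m)) \<phi>))"

definition V_functions ::
  "'a measure \<Rightarrow> 'b measure \<Rightarrow> ('a \<times> 'b \<Rightarrow> complex) set" where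
  "V_functions M N =
     {\<phi>. \<phi> \<in> borel_measurable (M \<Otimes>\<^sub>M N) \<and>
        (\<exists>(a :: nat \<Rightarrow> 'a \<Rightarrow> complex) (b :: nat \<Rightarrow> 'b \<Rightarrow> complex).
           (\<forall>i. a i \<in> borel_measurable M) \<and> (\<forall>i. b i \<in> borel_measurable N) \<and>
           (AE x in M. summable (\<lambda>i. (cmod (a i x))\<^sup>2)) \<and>
           (AE y in N. summable (\<lambda>i. (cmod (b i y))\<^sup>2)) \<and>
           (AE (x, y) in M \<Otimes>\<^sub>M N. (\<lambda>i. a i x * b i y) sums \<phi> (x, y)))}"

end

theory Submission
  imports Defs "HOL-Library.Diagonal_Subsequence"
begin

text \<open>
  Call \<open>\<phi>(x, y) = \<Sum>k. a\<^sub>k(x) b\<^sub>k(y)\<close> a bounded factorization if the square sums of the \<open>a\<^sub>k\<close> and of the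
  \<open>b\<^sub>k\<close> are bounded by a constant \<open>C\<close>. Schur multipliers are exactly the functions with a bounded
  factorization (a theorem of Grothendieck, Haagerup and Peller), and the theorem is the local version
  of this fact.

  A bounded factorization gives a Schur multiplier because the pairing of \<open>I\<^bsub>\<phi>k\<^esub> \<xi>\<close> with \<open>\<eta>\<close> is the sum
  of the pairings of \<open>I\<^sub>k (a\<^sub>j \<xi>)\<close> with \<open>b\<^sub>j \<eta>\<close>, to which the Cauchy-Schwarz inequality applies
  (\<open>schur_multiplier_of_factorization\<close>). If \<open>\<phi>\<close> lies in \<open>\<V>(X, Y)\<close>, the sets on which the two square
  sums are at most \<open>m\<close> increase to conull sets, and their products form the covering family.

  Conversely, let \<open>\<phi>\<close> be a Schur multiplier with constant \<open>C\<close>. Its averages over the cells of a finite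
  partition form a matrix that satisfies a dual inequality (\<open>schur_multiplier_averages\<close>). Separation of
  convex cones turns this inequality into a factorization of the matrix through vectors of squared norm
  at most \<open>C + \<epsilon>\<close> (\<open>finite_matrix_factorization\<close>). To pass to the limit along refining partitions,
  one does not follow the vectors, which are determined up to rotation only, but the inner products of
  their integrals over cells. These converge along a subsequence, and the limits are again
  the inner products of square summable vectors (\<open>gram_subsequence\<close>). The limit vectors depend additively on the
  cell and are bounded by the measure of the cell, so they are the integrals of densities
  (\<open>ell2_density\<close>); the densities are the functions \<open>a\<^sub>k\<close> and \<open>b\<^sub>k\<close>. Hence Schur multipliers have bounded
  factorizations (\<open>schur_multiplier_factorization\<close>).

  It remains to assemble the factorizations that a local Schur multiplier has on the rectangles of a
  covering family. Regularity and tightness of finite measures on Polish spaces provide disjoint sets \<open>D i\<close>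
  and \<open>E j\<close>, each family of conull union, such that every block \<open>D i \<times> E j\<close> is covered by finitely many of the
  rectangles (\<open>covering_family_finite_blocks\<close>). Inclusion and exclusion yields a bounded factorization on each block. Blocks in
  the same row share their first variable and blocks in the same column the second one, so the factorizations cannot
  simply be added. They are rescaled such that at every point all but finitely many of the square
  sums are dominated by a geometric series (\<open>glue_block_factorizations\<close>).
\<close>

section \<open>Approximate factorization of finite matrices\<close>

text \<open>
  A sequence in the cone that minimizes the distance to \<open>z\<close> is Cauchy by the parallelogram law. The
  residual at its limit is orthogonal to the limit and makes no acute angle with the cone, so its negative
  separates. Vectors are functions on a finite index set rather than elements of a Euclidean space type because
  the lemma is applied in arbitrarily large dimensions.
\<close>

lemma finite_cone_separation:
  fixes E :: "'e set" and K :: "('e \<Rightarrow> real) set" and z :: "'e \<Rightarrow> real"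
  assumes E: "finite E" and ne: "K \<noteq> {}"
    and add: "\<And>u v. u \<in> K \<Longrightarrow> v \<in> K \<Longrightarrow> (\<lambda>e. u e + v e) \<in> K"
    and scale: "\<And>c u. 0 \<le> c \<Longrightarrow> u \<in> K \<Longrightarrow> (\<lambda>e. c * u e) \<in> K"
    and eps: "0 < \<epsilon>" and far: "\<And>u. u \<in> K \<Longrightarrow> \<epsilon> \<le> (\<Sum>e\<in>E. (z e - u e)\<^sup>2)"
  obtains l where "\<And>u. u \<in> K \<Longrightarrow> 0 \<le> (\<Sum>e\<in>E. l e * u e)" and "(\<Sum>e\<in>E. l e * z e) < 0"
proof -
  define Q where "Q v = (\<Sum>e\<in>E. (v e)\<^sup>2)" for v :: "'e \<Rightarrow> real"
  define dd where "dd u = Q (\<lambda>e. z e - u e)" for u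
  define \<delta> where "\<delta> = Inf (dd ` K)"
  have bdd: "bdd_below (dd ` K)"
    by (rule bdd_belowI[of _ \<epsilon>]) (auto simp: dd_def Q_def intro: far)
  have \<delta>_le: "\<delta> \<le> dd u" if "u \<in> K" for u
    unfolding \<delta>_def using bdd that by (intro cInf_lower) auto
  have \<delta>_pos: "\<epsilon> \<le> \<delta>"
    unfolding \<delta>_def using ne by (intro cInf_greatest) (auto simp: dd_def Q_def intro: far)
  have "\<exists>u\<in>K. dd u < \<delta> + 1 / real (Suc n)" for n
  proof -
    have "\<delta> < \<delta> + 1 / real (Suc n)" by simp
    from cInf_lessD[OF _ this[unfolded \<delta>_def], folded \<delta>_def] ne show ?thesis by auto
  qed
  then obtain k where kK: "\<And>n. k n \<in> K" and k: "\<And>n. dd (k n) < \<delta> + 1 / real (Suc n)"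
    by metis
  have Qge: "(v e)\<^sup>2 \<le> Q v" if "e \<in> E" for v e
    unfolding Q_def using E that by (intro member_le_sum) auto
  have par: "Q (\<lambda>e. k m e - k n e) \<le> 2 / real (Suc m) + 2 / real (Suc n)" for m n
  proof -
    have "(\<lambda>e. (1/2) * (k m e + k n e)) \<in> K"
      by (intro scale add kK) auto
    from \<delta>_le[OF this] have 1: "\<delta> \<le> dd (\<lambda>e. (1/2) * (k m e + k n e))" .
    have "Q (\<lambda>e. k m e - k n e) + 4 * dd (\<lambda>e. (1/2) * (k m e + k n e)) = 2 * dd (k m) + 2 * dd (k n)"
      unfolding dd_def Q_def sum_distrib_left sum.distrib[symmetric]
      by (intro sum.cong refl) (simp add: power2_eq_square field_simps)
    with 1 k[of m] k[of n] show ?thesis by simp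
  qed
  have cau: "convergent (\<lambda>n. k n e)" if "e \<in> E" for e
  proof -
    have "Cauchy (\<lambda>n. k n e)"
    proof (rule CauchyI)
      fix r :: real assume r: "0 < r"
      obtain N where N: "4 / r\<^sup>2 < real N" using reals_Archimedean2 by blast
      have "norm (k m e - k n e) < r" if "N \<le> m" "N \<le> n" for m n
      proof -
        have sN: "4 / real (Suc N) < r\<^sup>2"
        proof -
          have "4 / r\<^sup>2 < real (Suc N)" using N by simp
          then show ?thesis using r by (simp add: field_simps)
        qed
        have "(k m e - k n e)\<^sup>2 \<le> 2 / real (Suc m) + 2 / real (Suc n)"
          using par[of m n] Qge[OF \<open>e \<in> E\<close>, of "\<lambda>e. k m e - k n e"] by simp
        also have "\<dots> \<le> 2 / real (Suc N) + 2 / real (Suc N)"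
          using that by (intro add_mono divide_left_mono) auto
        also have "\<dots> < r\<^sup>2" using sN by simp
        finally show ?thesis using r by (metis abs_le_square_iff abs_of_pos not_less real_norm_def)
      qed
      then show "\<exists>M. \<forall>m\<ge>M. \<forall>n\<ge>M. norm (k m e - k n e) < r" by blast
    qed
    then show ?thesis by (simp add: Cauchy_convergent_iff)
  qed
  define k0 where "k0 e = lim (\<lambda>n. k n e)" for e
  have lim: "(\<lambda>n. k n e) \<longlonglongrightarrow> k0 e" if "e \<in> E" for e
    using cau[OF that] by (simp add: k0_def convergent_LIMSEQ_iff)
  define v where "v e = z e - k0 e" for e
  have Qv: "Q v = \<delta>"
  proof (rule antisym)
    have 1: "(\<lambda>n. dd (k n)) \<longlonglongrightarrow> Q v"
      unfolding dd_def Q_def v_def by (intro tendsto_intros lim)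
    have 2: "(\<lambda>n. \<delta> + 1 / real (Suc n)) \<longlonglongrightarrow> \<delta>"
      using tendsto_add[OF tendsto_const[of \<delta>] LIMSEQ_inverse_real_of_nat]
      by (simp add: inverse_eq_divide)
    show "Q v \<le> \<delta>" by (rule LIMSEQ_le[OF 1 2]) (use k in \<open>auto intro: less_imp_le\<close>)
    show "\<delta> \<le> Q v" by (rule LIMSEQ_le_const[OF 1]) (use \<delta>_le kK in auto)
  qed
  \<comment> \<open>The limit need not lie in the cone, so every direction is tested along the minimizing sequence.\<close>
  have dir: "0 \<le> t\<^sup>2 * Q u - 2 * t * (\<Sum>e\<in>E. v e * u e)"
    if "\<And>n. (\<lambda>e. k n e + t * w n e) \<in> K" and "\<And>e. e \<in> E \<Longrightarrow> (\<lambda>n. w n e) \<longlonglongrightarrow> u e" for t u w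
  proof -
    have 1: "(\<lambda>n. dd (\<lambda>e. k n e + t * w n e)) \<longlonglongrightarrow> Q (\<lambda>e. z e - (k0 e + t * u e))"
      unfolding dd_def Q_def by (intro tendsto_intros lim that)
    have "\<delta> \<le> Q (\<lambda>e. z e - (k0 e + t * u e))"
      by (rule LIMSEQ_le_const[OF 1]) (use \<delta>_le that in auto)
    also have "\<dots> = Q v + (t\<^sup>2 * Q u - 2 * t * (\<Sum>e\<in>E. v e * u e))"
      unfolding Q_def v_def sum_distrib_left sum.distrib[symmetric] sum_subtractf[symmetric]
      by (intro sum.cong refl) (simp add: power2_eq_square algebra_simps)
    finally show ?thesis using Qv by simp
  qed
  have quad: "p \<le> 0" if "\<And>t. 0 < t \<Longrightarrow> t \<le> 1 \<Longrightarrow> 0 \<le> t\<^sup>2 * q - 2 * t * p" for p q :: real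
  proof (rule ccontr)
    assume "\<not> p \<le> 0"
    then have p: "0 < p" by simp
    define t where "t = min 1 (p / (\<bar>q\<bar> + 1))"
    have t: "0 < t" "t \<le> 1" using p by (auto simp: t_def)
    have "t \<le> p / (\<bar>q\<bar> + 1)" by (simp add: t_def)
    then have t3: "t * \<bar>q\<bar> + t \<le> p" by (subst (asm) pos_le_divide_eq) (auto simp: algebra_simps)
    have "0 \<le> t * (t * q - 2 * p)" using that[OF t(1,2)] by (simp add: power2_eq_square algebra_simps)
    then have "2 * p \<le> t * q" using t by (simp add: zero_le_mult_iff)
    also have "\<dots> \<le> t * \<bar>q\<bar>" using t by (intro mult_left_mono) auto
    finally show False using p t t3 by linarith
  qed
  have le: "(\<Sum>e\<in>E. v e * u e) \<le> 0" if "u \<in> K" for u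
  proof (rule quad)
    fix t :: real assume "0 < t"
    then show "0 \<le> t\<^sup>2 * Q u - 2 * t * (\<Sum>e\<in>E. v e * u e)"
      by (intro dir[where w="\<lambda>n. u"] add kK scale that) auto
  qed
  \<comment> \<open>Shrinking the sequence by the factor \<open>1 - t\<close> stays in the cone; this tests the direction \<open>- k0\<close>.\<close>
  have ge: "(\<Sum>e\<in>E. v e * (- k0 e)) \<le> 0"
  proof (rule quad)
    fix t :: real assume t: "0 < t" "t \<le> 1"
    show "0 \<le> t\<^sup>2 * Q (\<lambda>e. - k0 e) - 2 * t * (\<Sum>e\<in>E. v e * (- k0 e))"
    proof (rule dir[where w="\<lambda>n e. - k n e"])
      show "(\<lambda>e. k n e + t * - k n e) \<in> K" for n
        using scale[OF _ kK[of n], of "1 - t"] t by (simp add: algebra_simps)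
    qed (auto intro!: tendsto_intros lim)
  qed
  have k0v: "0 \<le> (\<Sum>e\<in>E. v e * k0 e)" using ge by (simp add: sum_negf)
  show ?thesis
  proof (rule that[of "\<lambda>e. - v e"])
    show "0 \<le> (\<Sum>e\<in>E. - v e * u e)" if "u \<in> K" for u using le[OF that] by (simp add: sum_negf)
    have "(\<Sum>e\<in>E. v e * z e) = Q v + (\<Sum>e\<in>E. v e * k0 e)"
      unfolding Q_def sum.distrib[symmetric] v_def
      by (intro sum.cong refl) (simp add: power2_eq_square algebra_simps)
    then show "(\<Sum>e\<in>E. - v e * z e) < 0" using Qv \<delta>_pos eps k0v by (simp add: sum_negf)
  qed
qed

lemma sum_lessThan_append:
  fixes f g :: "nat \<Rightarrow> 'a::comm_monoid_add"
  shows "(\<Sum>k<r + s. if k < r then f k else g (k - r)) = (\<Sum>k<r. f k) + (\<Sum>k<s. g k)"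
  by (induction s) (auto simp: add.assoc)

text \<open>
  Consider the convex cone of all pairs of a matrix \<open>\<Sum>k. p k i * q k j\<close> and a vector that dominates the
  square sums of the rows of \<open>p\<close> and of \<open>q\<close>. If the claim fails, then the pair of \<open>m\<close> and the constant vector
  \<open>C\<close> has positive distance from the cone. A separating functional consists of weights \<open>w\<close>, \<open>v\<close> and a
  matrix \<open>u\<close>. That it is nonnegative on the elements of rank one is the hypothesis of \<open>test\<close>, and
  that it is negative at \<open>m\<close> contradicts the conclusion of \<open>test\<close>.
\<close>

lemma finite_matrix_factorization:
  fixes I :: "'i set" and J :: "'j set" and m :: "'i \<Rightarrow> 'j \<Rightarrow> complex"
  assumes I: "finite I" and J: "finite J" and C: "0 \<le> C" and eps: "0 < \<epsilon>"
    and test: "\<And>u w v. (\<And>i. i \<in> I \<Longrightarrow> 0 < w i) \<Longrightarrow> (\<And>j. j \<in> J \<Longrightarrow> 0 < v j) \<Longrightarrow>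
       (\<And>f g. Re (\<Sum>i\<in>I. \<Sum>j\<in>J. u i j * (f i * g j))
          \<le> (\<Sum>i\<in>I. w i * (cmod (f i))\<^sup>2) + (\<Sum>j\<in>J. v j * (cmod (g j))\<^sup>2)) \<Longrightarrow>
       Re (\<Sum>i\<in>I. \<Sum>j\<in>J. u i j * m i j) \<le> C * ((\<Sum>i\<in>I. w i) + (\<Sum>j\<in>J. v j))"
  obtains r :: nat and p q where
    "\<And>i. i \<in> I \<Longrightarrow> (\<Sum>k<r. (cmod (p k i))\<^sup>2) \<le> C + \<epsilon>"
    "\<And>j. j \<in> J \<Longrightarrow> (\<Sum>k<r. (cmod (q k j))\<^sup>2) \<le> C + \<epsilon>"
    "\<And>i j. i \<in> I \<Longrightarrow> j \<in> J \<Longrightarrow> cmod (m i j - (\<Sum>k<r. p k i * q k j)) \<le> \<epsilon>"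
proof (rule ccontr)
  assume neg: "\<not> thesis"
  note factorizationI = that
  define E where "E = (I <+> J) <+> ((I \<times> J) <+> (I \<times> J))"
  have EI: "i \<in> I \<Longrightarrow> Inl (Inl i) \<in> E" "j \<in> J \<Longrightarrow> Inl (Inr j) \<in> E"
     "i \<in> I \<Longrightarrow> j \<in> J \<Longrightarrow> Inr (Inl (i, j)) \<in> E" "i \<in> I \<Longrightarrow> j \<in> J \<Longrightarrow> Inr (Inr (i, j)) \<in> E" for i j
    by (auto simp: E_def intro!: InlI InrI)
  have finE: "finite E" using I J by (simp add: E_def)
  have sumE: "(\<Sum>e\<in>E. h e) =
      ((\<Sum>i\<in>I. h (Inl (Inl i))) + (\<Sum>j\<in>J. h (Inl (Inr j)))) +
      ((\<Sum>i\<in>I. \<Sum>j\<in>J. h (Inr (Inl (i, j)))) + (\<Sum>i\<in>I. \<Sum>j\<in>J. h (Inr (Inr (i, j)))))"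
    for h :: "_ \<Rightarrow> real"
    using I J unfolding E_def by (simp add: sum.Plus sum.cartesian_product case_prod_beta')
  \<comment> \<open>The coordinates are the row bounds, the column bounds, and the real and imaginary parts of the entries.\<close>
  define K :: "(('i + 'j) + (('i \<times> 'j) + ('i \<times> 'j)) \<Rightarrow> real) set" where "K = {\<kappa>. \<exists>(r::nat) p q.
      (\<forall>i\<in>I. (\<Sum>k<r. (cmod (p k i))\<^sup>2) \<le> \<kappa> (Inl (Inl i))) \<and>
      (\<forall>j\<in>J. (\<Sum>k<r. (cmod (q k j))\<^sup>2) \<le> \<kappa> (Inl (Inr j))) \<and>
      (\<forall>i\<in>I. \<forall>j\<in>J. Complex (\<kappa> (Inr (Inl (i, j)))) (\<kappa> (Inr (Inr (i, j)))) = (\<Sum>k<r. p k i * q k j))}"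
  have KI: "\<kappa> \<in> K" if "\<And>i. i \<in> I \<Longrightarrow> (\<Sum>k<r. (cmod (p k i))\<^sup>2) \<le> \<kappa> (Inl (Inl i))"
     "\<And>j. j \<in> J \<Longrightarrow> (\<Sum>k<r. (cmod (q k j))\<^sup>2) \<le> \<kappa> (Inl (Inr j))"
     "\<And>i j. i \<in> I \<Longrightarrow> j \<in> J \<Longrightarrow> Complex (\<kappa> (Inr (Inl (i, j)))) (\<kappa> (Inr (Inr (i, j)))) = (\<Sum>k<r. p k i * q k j)"
    for \<kappa> p q and r :: nat
    unfolding K_def mem_Collect_eq
    by (rule exI[of _ r], rule exI[of _ p], rule exI[of _ q]) (use that in auto)
  define z :: "('i + 'j) + (('i \<times> 'j) + ('i \<times> 'j)) \<Rightarrow> real" where "z e = (case e of Inl _ \<Rightarrow> C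
      | Inr (Inl (i, j)) \<Rightarrow> Re (m i j) | Inr (Inr (i, j)) \<Rightarrow> Im (m i j))" for e
  have far: "\<epsilon>\<^sup>2 \<le> (\<Sum>e\<in>E. (z e - \<kappa> e)\<^sup>2)" if "\<kappa> \<in> K" for \<kappa>
  proof (rule ccontr)
    assume "\<not> ?thesis"
    then have lt: "(\<Sum>e\<in>E. (z e - \<kappa> e)\<^sup>2) < \<epsilon>\<^sup>2" by simp
    have one: "(z e - \<kappa> e)\<^sup>2 < \<epsilon>\<^sup>2" if "e \<in> E" for e
      using member_le_sum[of e E "\<lambda>e. (z e - \<kappa> e)\<^sup>2"] that finE lt by simp
    have close: "\<kappa> e \<le> z e + \<epsilon>" if "e \<in> E" for e
      using power2_less_imp_less[of "\<bar>z e - \<kappa> e\<bar>" \<epsilon>] one[OF that] eps by auto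
    from \<open>\<kappa> \<in> K\<close> obtain r :: nat and p q where
      p[rule_format]: "\<forall>i\<in>I. (\<Sum>k<r. (cmod (p k i))\<^sup>2) \<le> \<kappa> (Inl (Inl i))" and
      q[rule_format]: "\<forall>j\<in>J. (\<Sum>k<r. (cmod (q k j))\<^sup>2) \<le> \<kappa> (Inl (Inr j))" and
      pq[rule_format]: "\<forall>i\<in>I. \<forall>j\<in>J.
         Complex (\<kappa> (Inr (Inl (i, j)))) (\<kappa> (Inr (Inr (i, j)))) = (\<Sum>k<r. p k i * q k j)"
      unfolding K_def mem_Collect_eq by (elim exE conjE) (rule that, assumption+)
    have "thesis"
    proof (rule factorizationI[where r=r and p=p and q=q])
      show "(\<Sum>k<r. (cmod (p k i))\<^sup>2) \<le> C + \<epsilon>" if "i \<in> I" for i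
        using p[OF that] close[OF EI(1)[OF that]] by (auto simp: z_def)
      show "(\<Sum>k<r. (cmod (q k j))\<^sup>2) \<le> C + \<epsilon>" if "j \<in> J" for j
        using q[OF that] close[OF EI(2)[OF that]] by (auto simp: z_def)
      show "cmod (m i j - (\<Sum>k<r. p k i * q k j)) \<le> \<epsilon>" if ij: "i \<in> I" "j \<in> J" for i j
      proof -
        have "(z (Inr (Inl (i, j))) - \<kappa> (Inr (Inl (i, j))))\<^sup>2 + (z (Inr (Inr (i, j))) - \<kappa> (Inr (Inr (i, j))))\<^sup>2
            = (\<Sum>e\<in>{Inr (Inl (i, j)), Inr (Inr (i, j))}. (z e - \<kappa> e)\<^sup>2)"
          by simp
        also have "\<dots> \<le> (\<Sum>e\<in>E. (z e - \<kappa> e)\<^sup>2)"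
          using finE ij EI by (intro sum_mono2) auto
        finally have "(cmod (m i j - (\<Sum>k<r. p k i * q k j)))\<^sup>2 < \<epsilon>\<^sup>2"
          using lt unfolding pq[OF ij, symmetric] cmod_power2 by (simp add: z_def)
        then show ?thesis using eps by (meson less_imp_le power2_less_imp_less)
      qed
    qed
    with neg show False ..
  qed
  have Kne: "K \<noteq> {}"
    using KI[where r=0 and p="\<lambda>_ _. 0" and q="\<lambda>_ _. 0" and \<kappa>="\<lambda>_. 0"]
    by (auto simp: zero_complex.code)
  have Kadd: "(\<lambda>e. \<kappa> e + \<kappa>' e) \<in> K" if "\<kappa> \<in> K" "\<kappa>' \<in> K" for \<kappa> \<kappa>'
  proof -
    from \<open>\<kappa> \<in> K\<close> obtain r :: nat and p q where
      p[rule_format]: "\<forall>i\<in>I. (\<Sum>k<r. (cmod (p k i))\<^sup>2) \<le> \<kappa> (Inl (Inl i))" and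
      q[rule_format]: "\<forall>j\<in>J. (\<Sum>k<r. (cmod (q k j))\<^sup>2) \<le> \<kappa> (Inl (Inr j))" and
      pq[rule_format]: "\<forall>i\<in>I. \<forall>j\<in>J.
         Complex (\<kappa> (Inr (Inl (i, j)))) (\<kappa> (Inr (Inr (i, j)))) = (\<Sum>k<r. p k i * q k j)"
      unfolding K_def mem_Collect_eq by (elim exE conjE) (rule that, assumption+)
    from \<open>\<kappa>' \<in> K\<close> obtain r' :: nat and p' q' where
      p'[rule_format]: "\<forall>i\<in>I. (\<Sum>k<r'. (cmod (p' k i))\<^sup>2) \<le> \<kappa>' (Inl (Inl i))" and
      q'[rule_format]: "\<forall>j\<in>J. (\<Sum>k<r'. (cmod (q' k j))\<^sup>2) \<le> \<kappa>' (Inl (Inr j))" and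
      pq'[rule_format]: "\<forall>i\<in>I. \<forall>j\<in>J.
         Complex (\<kappa>' (Inr (Inl (i, j)))) (\<kappa>' (Inr (Inr (i, j)))) = (\<Sum>k<r'. p' k i * q' k j)"
      unfolding K_def mem_Collect_eq by (elim exE conjE) (rule that, assumption+)
    have if1: "(cmod (if k < r then x k i else y (k - r) i))\<^sup>2 =
      (if k < r then (cmod (x k i))\<^sup>2 else (cmod (y (k - r) i))\<^sup>2)" for k i and x y :: "nat \<Rightarrow> 'z \<Rightarrow> complex"
      by simp
    have if2: "(if k < r then p k i else p' (k - r) i) * (if k < r then q k j else q' (k - r) j) =
      (if k < r then p k i * q k j else p' (k - r) i * q' (k - r) j)" for k i j
      by simp
    show ?thesis
    proof (rule KI[where r="r + r'" and p="\<lambda>k i. if k < r then p k i else p' (k - r) i"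
            and q="\<lambda>k i. if k < r then q k i else q' (k - r) i"])
      show "(\<Sum>k<r + r'. (cmod (if k < r then p k i else p' (k - r) i))\<^sup>2) \<le> \<kappa> (Inl (Inl i)) + \<kappa>' (Inl (Inl i))"
        if "i \<in> I" for i
        unfolding if1 sum_lessThan_append[of r "\<lambda>k. (cmod (p k i))\<^sup>2" "\<lambda>k. (cmod (p' k i))\<^sup>2"]
        using p[OF that] p'[OF that] by simp
      show "(\<Sum>k<r + r'. (cmod (if k < r then q k j else q' (k - r) j))\<^sup>2) \<le> \<kappa> (Inl (Inr j)) + \<kappa>' (Inl (Inr j))"
        if "j \<in> J" for j
        unfolding if1 sum_lessThan_append[of r "\<lambda>k. (cmod (q k j))\<^sup>2" "\<lambda>k. (cmod (q' k j))\<^sup>2"]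
        using q[OF that] q'[OF that] by simp
      show "Complex (\<kappa> (Inr (Inl (i, j))) + \<kappa>' (Inr (Inl (i, j)))) (\<kappa> (Inr (Inr (i, j))) + \<kappa>' (Inr (Inr (i, j)))) =
          (\<Sum>k<r + r'. (if k < r then p k i else p' (k - r) i) * (if k < r then q k j else q' (k - r) j))"
        if "i \<in> I" "j \<in> J" for i j
        unfolding if2 sum_lessThan_append[of r "\<lambda>k. p k i * q k j" "\<lambda>k. p' k i * q' k j"] pq[OF that, symmetric] pq'[OF that, symmetric] by (simp add: complex_eq_iff)
    qed
  qed
  have Kscale: "(\<lambda>e. c * \<kappa> e) \<in> K" if "0 \<le> c" "\<kappa> \<in> K" for c \<kappa>
  proof -
    from \<open>\<kappa> \<in> K\<close> obtain r :: nat and p q where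
      p[rule_format]: "\<forall>i\<in>I. (\<Sum>k<r. (cmod (p k i))\<^sup>2) \<le> \<kappa> (Inl (Inl i))" and
      q[rule_format]: "\<forall>j\<in>J. (\<Sum>k<r. (cmod (q k j))\<^sup>2) \<le> \<kappa> (Inl (Inr j))" and
      pq[rule_format]: "\<forall>i\<in>I. \<forall>j\<in>J.
         Complex (\<kappa> (Inr (Inl (i, j)))) (\<kappa> (Inr (Inr (i, j)))) = (\<Sum>k<r. p k i * q k j)"
      unfolding K_def mem_Collect_eq by (elim exE conjE) (rule that, assumption+)
    have sq: "(cmod (of_real (sqrt c) * x))\<^sup>2 = c * (cmod x)\<^sup>2" for x
      using that by (simp add: norm_mult power_mult_distrib)
    have sqq: "(of_real (sqrt c) * x) * (of_real (sqrt c) * y) = of_real c * (x * y)" for x y :: complex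
    proof -
      have "(of_real (sqrt c) * x) * (of_real (sqrt c) * y) = of_real (sqrt c * sqrt c) * (x * y)"
        by (simp only: of_real_mult mult_ac)
      then show ?thesis using that by simp
    qed
    show ?thesis
    proof (rule KI[where r=r and p="\<lambda>k i. of_real (sqrt c) * p k i" and q="\<lambda>k i. of_real (sqrt c) * q k i"])
      show "(\<Sum>k<r. (cmod (of_real (sqrt c) * p k i))\<^sup>2) \<le> c * \<kappa> (Inl (Inl i))" if "i \<in> I" for i
        unfolding sq sum_distrib_left[symmetric] using p[OF that] \<open>0 \<le> c\<close> by (rule mult_left_mono)
      show "(\<Sum>k<r. (cmod (of_real (sqrt c) * q k j))\<^sup>2) \<le> c * \<kappa> (Inl (Inr j))" if "j \<in> J" for j
        unfolding sq sum_distrib_left[symmetric] using q[OF that] \<open>0 \<le> c\<close> by (rule mult_left_mono)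
      show "Complex (c * \<kappa> (Inr (Inl (i, j)))) (c * \<kappa> (Inr (Inr (i, j)))) =
          (\<Sum>k<r. (of_real (sqrt c) * p k i) * (of_real (sqrt c) * q k j))" if "i \<in> I" "j \<in> J" for i j
        unfolding sqq sum_distrib_left[symmetric] pq[OF that, symmetric] by (simp add: complex_eq_iff)
    qed
  qed
  have e2: "0 < \<epsilon>\<^sup>2" using eps by simp
  obtain l where l: "\<And>\<kappa>. \<kappa> \<in> K \<Longrightarrow> 0 \<le> (\<Sum>e\<in>E. l e * \<kappa> e)" and lz: "(\<Sum>e\<in>E. l e * z e) < 0"
    by (rule finite_cone_separation[OF finE Kne _ _ e2, of z]) (rule Kadd Kscale far that; assumption)+
  define w0 where "w0 i = l (Inl (Inl i))" for i
  define v0 where "v0 j = l (Inl (Inr j))" for j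
  define u where "u i j = - Complex (l (Inr (Inl (i, j)))) (- l (Inr (Inr (i, j))))" for i j
  have Re_u: "l (Inr (Inl (i, j))) * Re x + l (Inr (Inr (i, j))) * Im x = - Re (u i j * x)" for i j x
    by (simp add: u_def)
  have key: "Re (\<Sum>i\<in>I. \<Sum>j\<in>J. u i j * (f i * g j)) \<le> (\<Sum>i\<in>I. w0 i * d i) + (\<Sum>j\<in>J. v0 j * d' j)"
    if d: "\<And>i. i \<in> I \<Longrightarrow> (cmod (f i))\<^sup>2 \<le> d i" "\<And>j. j \<in> J \<Longrightarrow> (cmod (g j))\<^sup>2 \<le> d' j" for f g d d'
  proof -
    define \<kappa> :: "('i + 'j) + (('i \<times> 'j) + ('i \<times> 'j)) \<Rightarrow> real" where "\<kappa> e = (case e of Inl (Inl i) \<Rightarrow> d i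
      | Inl (Inr j) \<Rightarrow> d' j
      | Inr (Inl (i, j)) \<Rightarrow> Re (f i * g j) | Inr (Inr (i, j)) \<Rightarrow> Im (f i * g j))" for e
    have "\<kappa> \<in> K"
      by (rule KI[where r=1 and p="\<lambda>_. f" and q="\<lambda>_. g"])
        (use d in \<open>auto simp: \<kappa>_def complex_eq_iff\<close>)
    from l[OF this] have pos: "0 \<le> (\<Sum>e\<in>E. l e * \<kappa> e)" .
    have \<kappa>: "\<kappa> (Inl (Inl i)) = d i" "\<kappa> (Inl (Inr j)) = d' j"
       "\<kappa> (Inr (Inl (i, j))) = Re (f i * g j)" "\<kappa> (Inr (Inr (i, j))) = Im (f i * g j)" for i j
      by (simp_all add: \<kappa>_def)
    have A: "(\<Sum>i\<in>I. \<Sum>j\<in>J. l (Inr (Inl (i, j))) * Re (f i * g j)) + (\<Sum>i\<in>I. \<Sum>j\<in>J. l (Inr (Inr (i, j))) * Im (f i * g j))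
      = - Re (\<Sum>i\<in>I. \<Sum>j\<in>J. u i j * (f i * g j))"
      by (simp only: sum.distrib[symmetric] Re_u sum_negf Re_sum)
    show ?thesis
      using pos unfolding sumE \<kappa> A w0_def v0_def by linarith
  qed
  have w0: "0 \<le> w0 i" if "i \<in> I" for i
    using key[where f="\<lambda>_. 0" and g="\<lambda>_. 0" and d="\<lambda>i'. if i' = i then 1 else 0" and d'="\<lambda>_. 0"] that I
    by (simp add: if_distrib[of "(*) _"] sum.delta cong: if_cong)
  have v0: "0 \<le> v0 j" if "j \<in> J" for j
    using key[where f="\<lambda>_. 0" and g="\<lambda>_. 0" and d="\<lambda>_. 0" and d'="\<lambda>j'. if j' = j then 1 else 0"] that J
    by (simp add: if_distrib[of "(*) _"] sum.delta cong: if_cong)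
  have lz': "C * ((\<Sum>i\<in>I. w0 i) + (\<Sum>j\<in>J. v0 j)) < Re (\<Sum>i\<in>I. \<Sum>j\<in>J. u i j * m i j)"
  proof -
    have "(\<Sum>i\<in>I. \<Sum>j\<in>J. l (Inr (Inl (i, j))) * Re (m i j)) + (\<Sum>i\<in>I. \<Sum>j\<in>J. l (Inr (Inr (i, j))) * Im (m i j))
      = - Re (\<Sum>i\<in>I. \<Sum>j\<in>J. u i j * m i j)"
      by (simp only: sum.distrib[symmetric] Re_u sum_negf Re_sum)
    with lz show ?thesis
      unfolding sumE by (simp add: z_def w0_def v0_def sum_distrib_left algebra_simps)
  qed
  \<comment> \<open>The weights are only nonnegative; adding a small \<open>\<delta>\<close> makes them positive and keeps the strict inequality.\<close>
  define \<eta> where "\<eta> = Re (\<Sum>i\<in>I. \<Sum>j\<in>J. u i j * m i j) - C * ((\<Sum>i\<in>I. w0 i) + (\<Sum>j\<in>J. v0 j))"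
  define N where "N = real (card I) + real (card J)"
  define \<delta> where "\<delta> = \<eta> / (C * N + 1)"
  have N: "0 \<le> N" by (simp add: N_def)
  have CN: "0 < C * N + 1" using C N by (simp add: add_nonneg_pos)
  have \<eta>: "0 < \<eta>" using lz' by (simp add: \<eta>_def)
  have \<delta>: "0 < \<delta>" using \<eta> CN by (simp add: \<delta>_def)
  have "Re (\<Sum>i\<in>I. \<Sum>j\<in>J. u i j * m i j) \<le> C * ((\<Sum>i\<in>I. w0 i + \<delta>) + (\<Sum>j\<in>J. v0 j + \<delta>))"
  proof (rule test)
    show "0 < w0 i + \<delta>" if "i \<in> I" for i using w0[OF that] \<delta> by simp
    show "0 < v0 i + \<delta>" if "i \<in> J" for i using v0[OF that] \<delta> by simp
    fix f g
    have "Re (\<Sum>i\<in>I. \<Sum>j\<in>J. u i j * (f i * g j)) \<le> (\<Sum>i\<in>I. w0 i * (cmod (f i))\<^sup>2) + (\<Sum>j\<in>J. v0 j * (cmod (g j))\<^sup>2)"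
      by (rule key) auto
    also have "\<dots> \<le> (\<Sum>i\<in>I. (w0 i + \<delta>) * (cmod (f i))\<^sup>2) + (\<Sum>j\<in>J. (v0 j + \<delta>) * (cmod (g j))\<^sup>2)"
      using \<delta> by (intro add_mono sum_mono mult_right_mono) auto
    finally show "Re (\<Sum>i\<in>I. \<Sum>j\<in>J. u i j * (f i * g j)) \<le> \<dots>" .
  qed
  also have "\<dots> = C * ((\<Sum>i\<in>I. w0 i) + (\<Sum>j\<in>J. v0 j)) + C * N * \<delta>"
    by (simp add: sum.distrib N_def algebra_simps)
  finally have "\<eta> \<le> C * N * \<delta>" by (simp add: \<eta>_def)
  also have "\<dots> < (C * N + 1) * \<delta>" using \<delta> by simp
  also have "\<dots> = \<eta>" using CN by (simp add: \<delta>_def)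
  finally show False by simp
qed

section \<open>Kernel operators and averages of a Schur multiplier\<close>

lemma L2_functionsI:
  "f \<in> borel_measurable M \<Longrightarrow> integrable M (\<lambda>x. (cmod (f x))\<^sup>2) \<Longrightarrow> f \<in> L2_functions M"
  by (simp add: L2_functions_def)

lemma L2_functionsD:
  assumes "f \<in> L2_functions M"
  shows L2_measurable: "f \<in> borel_measurable M" and L2_integrable: "integrable M (\<lambda>x. (cmod (f x))\<^sup>2)"
  using assms by (simp_all add: L2_functions_def)

lemma L2_norm_nonneg [simp]: "0 \<le> L2_norm M f"
  by (simp add: L2_norm_def)

lemma L2_norm_square: "(L2_norm M f)\<^sup>2 = (\<integral>x. (cmod (f x))\<^sup>2 \<partial>M)"
  by (simp add: L2_norm_def)

lemma L2_cnj:
  assumes "f \<in> L2_functions M"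
  shows "(\<lambda>x. cnj (f x)) \<in> L2_functions M"
proof -
  have "cnj \<in> borel_measurable borel" by (intro borel_measurable_continuous_onI continuous_intros)
  from measurable_compose[OF L2_measurable[OF assms] this]
  show ?thesis using L2_integrable[OF assms] by (simp add: L2_functions_def)
qed

lemma L2_norm_cnj [simp]: "L2_norm M (\<lambda>x. cnj (f x)) = L2_norm M f"
  by (simp add: L2_norm_def)

lemma L2_scale:
  assumes "f \<in> L2_functions M"
  shows "(\<lambda>x. c * f x) \<in> L2_functions M"
  using assms by (auto simp: L2_functions_def norm_mult power_mult_distrib)

lemma L2_norm_scale: "L2_norm M (\<lambda>x. c * f x) = cmod c * L2_norm M f"
  by (simp add: L2_norm_def norm_mult power_mult_distrib real_sqrt_mult)

lemma L2_zero [simp]: "(\<lambda>_. 0) \<in> L2_functions M"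
  by (simp add: L2_functions_def)

lemma L2_norm_zero [simp]: "L2_norm M (\<lambda>_. 0) = 0"
  by (simp add: L2_norm_def)

lemma L2_bounded_mult:
  assumes f: "f \<in> L2_functions M" and a[measurable]: "a \<in> borel_measurable M"
    and b: "AE x in M. cmod (a x) \<le> B"
  shows "(\<lambda>x. a x * f x) \<in> L2_functions M"
proof (rule L2_functionsI)
  note [measurable] = L2_measurable[OF f]
  show "(\<lambda>x. a x * f x) \<in> borel_measurable M" by measurable
  show "integrable M (\<lambda>x. (cmod (a x * f x))\<^sup>2)"
  proof (rule Bochner_Integration.integrable_bound[OF integrable_mult_right[OF L2_integrable[OF f]]])
    show "AE x in M. norm ((cmod (a x * f x))\<^sup>2) \<le> norm (B\<^sup>2 * (cmod (f x))\<^sup>2)"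
      using b
    proof eventually_elim
      case (elim x)
      then show ?case
        by (simp add: norm_mult power_mult_distrib mult_right_mono power_mono)
    qed
  qed simp
qed

lemma L2_product_integrable:
  assumes f: "f \<in> L2_functions M" and g: "g \<in> L2_functions M"
  shows "integrable M (\<lambda>x. f x * g x)"
proof (rule Bochner_Integration.integrable_bound)
  note [measurable] = L2_measurable[OF f] L2_measurable[OF g]
  show "integrable M (\<lambda>x. (cmod (f x))\<^sup>2 + (cmod (g x))\<^sup>2)"
    using f g by (intro Bochner_Integration.integrable_add L2_integrable)
  show "(\<lambda>x. f x * g x) \<in> borel_measurable M" by measurable
  show "AE x in M. norm (f x * g x) \<le> norm ((cmod (f x))\<^sup>2 + (cmod (g x))\<^sup>2)"
  proof (rule AE_I2)
    fix x
    have "2 * (cmod (f x) * cmod (g x)) \<le> (cmod (f x))\<^sup>2 + (cmod (g x))\<^sup>2"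
      using sum_squares_bound[of "cmod (f x)" "cmod (g x)"] by simp
    moreover have "0 \<le> cmod (f x) * cmod (g x)" by simp
    ultimately have "cmod (f x) * cmod (g x) \<le> (cmod (f x))\<^sup>2 + (cmod (g x))\<^sup>2" by linarith
    then show "norm (f x * g x) \<le> norm ((cmod (f x))\<^sup>2 + (cmod (g x))\<^sup>2)" by (simp add: norm_mult)
  qed
qed

text \<open>
  The functions are not elements of an inner product space, so the inequality is transferred from the one
  for nonnegative integrals.
\<close>

lemma L2_Cauchy_Schwarz_norm:
  assumes f: "f \<in> L2_functions M" and g: "g \<in> L2_functions M"
  shows "(\<integral>x. cmod (f x * g x) \<partial>M) \<le> L2_norm M f * L2_norm M g"
proof -
  note [measurable] = L2_measurable[OF f] L2_measurable[OF g]
  have e1: "(\<integral>\<^sup>+x. ennreal (cmod (f x)) * ennreal (cmod (g x)) \<partial>M) = ennreal (\<integral>x. cmod (f x * g x) \<partial>M)"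
    using nn_integral_eq_integral[OF integrable_norm[OF L2_product_integrable[OF f g]]]
    by (simp add: norm_mult ennreal_mult)
  have e2: "(\<integral>\<^sup>+x. (ennreal (cmod (h x)))\<^sup>2 \<partial>M) = ennreal (\<integral>x. (cmod (h x))\<^sup>2 \<partial>M)"
    if "h \<in> L2_functions M" for h
    using nn_integral_eq_integral[OF L2_integrable[OF that]] by (simp add: ennreal_power)
  have "(ennreal (\<integral>x. cmod (f x * g x) \<partial>M))\<^sup>2
      \<le> ennreal (\<integral>x. (cmod (f x))\<^sup>2 \<partial>M) * ennreal (\<integral>x. (cmod (g x))\<^sup>2 \<partial>M)"
    using Cauchy_Schwarz_nn_integral[of "\<lambda>x. ennreal (cmod (f x))" M "\<lambda>x. ennreal (cmod (g x))"]
    unfolding e1 e2[OF f] e2[OF g] by simp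
  then have "(\<integral>x. cmod (f x * g x) \<partial>M)\<^sup>2 \<le> (\<integral>x. (cmod (f x))\<^sup>2 \<partial>M) * (\<integral>x. (cmod (g x))\<^sup>2 \<partial>M)"
    by (simp add: ennreal_power ennreal_mult[symmetric])
  then have "(\<integral>x. cmod (f x * g x) \<partial>M)\<^sup>2 \<le> (L2_norm M f * L2_norm M g)\<^sup>2"
    by (simp add: power_mult_distrib L2_norm_square)
  then show ?thesis by (rule power2_le_imp_le) simp
qed

lemma L2_Cauchy_Schwarz:
  assumes f: "f \<in> L2_functions M" and g: "g \<in> L2_functions M"
  shows "cmod (\<integral>x. f x * g x \<partial>M) \<le> L2_norm M f * L2_norm M g"
  by (rule order_trans[OF Bochner_Integration.integral_norm_bound L2_Cauchy_Schwarz_norm[OF f g]])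

context pair_sigma_finite
begin

text \<open>
  The pairing of \<open>I\<^sub>k \<xi>\<close> with \<open>\<eta>\<close>. It is bilinear, without a conjugate, because multipliers
  \<open>a(x) b(y)\<close> can then be moved from the kernel to the two arguments.
\<close>

definition kernel_form :: "('a \<times> 'b \<Rightarrow> complex) \<Rightarrow> ('a \<Rightarrow> complex) \<Rightarrow> ('b \<Rightarrow> complex) \<Rightarrow> complex" where
  "kernel_form k \<xi> \<eta> = (\<integral>z. k z * (\<xi> (fst z) * \<eta> (snd z)) \<partial>(M1 \<Otimes>\<^sub>M M2))"

lemma L2_tensor:
  assumes f: "f \<in> L2_functions M1" and g: "g \<in> L2_functions M2"
  shows "(\<lambda>z. f (fst z) * g (snd z)) \<in> L2_functions (M1 \<Otimes>\<^sub>M M2)"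
proof (rule L2_functionsI)
  note [measurable] = L2_measurable[OF f] L2_measurable[OF g]
  show "(\<lambda>z. f (fst z) * g (snd z)) \<in> borel_measurable (M1 \<Otimes>\<^sub>M M2)" by measurable
  show "integrable (M1 \<Otimes>\<^sub>M M2) (\<lambda>z. (cmod (f (fst z) * g (snd z)))\<^sup>2)"
  proof (rule Fubini_integrable)
    show "integrable M1 (\<lambda>x. \<integral>y. norm ((cmod (f (fst (x, y)) * g (snd (x, y))))\<^sup>2) \<partial>M2)"
      by (simp add: norm_mult power_mult_distrib L2_integrable[OF f])
    show "AE x in M1. integrable M2 (\<lambda>y. (cmod (f (fst (x, y)) * g (snd (x, y))))\<^sup>2)"
      by (simp add: norm_mult power_mult_distrib L2_integrable[OF g])
  qed measurable
qed

lemma kernel_form_integrable: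
  assumes "k \<in> L2_functions (M1 \<Otimes>\<^sub>M M2)" "\<xi> \<in> L2_functions M1" "\<eta> \<in> L2_functions M2"
  shows "integrable (M1 \<Otimes>\<^sub>M M2) (\<lambda>z. k z * (\<xi> (fst z) * \<eta> (snd z)))"
  using assms by (intro L2_product_integrable L2_tensor)

lemma integral_op_L2:
  assumes k: "k \<in> L2_functions (M1 \<Otimes>\<^sub>M M2)" and \<xi>: "\<xi> \<in> L2_functions M1"
  shows "integral_op M1 k \<xi> \<in> L2_functions M2"
    and "(L2_norm M2 (integral_op M1 k \<xi>))\<^sup>2 \<le> (L2_norm (M1 \<Otimes>\<^sub>M M2) k)\<^sup>2 * (L2_norm M1 \<xi>)\<^sup>2"
proof -
  note [measurable] = L2_measurable[OF k] L2_measurable[OF \<xi>]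
  interpret Q: pair_sigma_finite M2 M1 ..
  have [measurable]: "integral_op M1 k \<xi> \<in> borel_measurable M2"
    unfolding integral_op_def by measurable
  have I: "integrable (M1 \<Otimes>\<^sub>M M2) (\<lambda>(x, y). (cmod (k (x, y)))\<^sup>2)"
    using L2_integrable[OF k] by (simp add: case_prod_beta')
  have bnd: "AE y in M2. (cmod (integral_op M1 k \<xi> y))\<^sup>2 \<le> (\<integral>x. (cmod (k (x, y)))\<^sup>2 \<partial>M1) * (L2_norm M1 \<xi>)\<^sup>2"
    using AE_integrable_snd[OF I] AE_space
  proof eventually_elim
    case (elim y)
    note [measurable] = elim(2)
    have ky: "(\<lambda>x. k (x, y)) \<in> L2_functions M1"
      using elim by (intro L2_functionsI) measurable
    show ?case
      using power_mono[OF L2_Cauchy_Schwarz[OF ky \<xi>], of 2]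
      unfolding integral_op_def by (simp add: power_mult_distrib L2_norm_square)
  qed
  have J: "integrable M2 (\<lambda>y. (\<integral>x. (cmod (k (x, y)))\<^sup>2 \<partial>M1) * (L2_norm M1 \<xi>)\<^sup>2)"
    using integrable_snd[OF I] by simp
  have K: "integrable M2 (\<lambda>y. (cmod (integral_op M1 k \<xi> y))\<^sup>2)"
  proof (rule Bochner_Integration.integrable_bound[OF J])
    show "AE y in M2. norm ((cmod (integral_op M1 k \<xi> y))\<^sup>2)
        \<le> norm ((\<integral>x. (cmod (k (x, y)))\<^sup>2 \<partial>M1) * (L2_norm M1 \<xi>)\<^sup>2)"
      using bnd
    proof eventually_elim
      case (elim y)
      from order_trans[OF elim abs_ge_self] show ?case unfolding real_norm_def by simp
    qed
  qed measurable
  then show "integral_op M1 k \<xi> \<in> L2_functions M2" by (intro L2_functionsI) auto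
  have "(L2_norm M2 (integral_op M1 k \<xi>))\<^sup>2 \<le> (\<integral>y. (\<integral>x. (cmod (k (x, y)))\<^sup>2 \<partial>M1) * (L2_norm M1 \<xi>)\<^sup>2 \<partial>M2)"
    unfolding L2_norm_square by (intro integral_mono_AE K J[unfolded L2_norm_square] bnd[unfolded L2_norm_square])
  also have "\<dots> = (L2_norm (M1 \<Otimes>\<^sub>M M2) k)\<^sup>2 * (L2_norm M1 \<xi>)\<^sup>2"
    using integral_snd[OF I] by (simp add: L2_norm_square case_prod_beta')
  finally show "(L2_norm M2 (integral_op M1 k \<xi>))\<^sup>2 \<le> (L2_norm (M1 \<Otimes>\<^sub>M M2) k)\<^sup>2 * (L2_norm M1 \<xi>)\<^sup>2" .
qed

lemma kernel_form_integral_op: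
  assumes k: "k \<in> L2_functions (M1 \<Otimes>\<^sub>M M2)" and \<xi>: "\<xi> \<in> L2_functions M1" and \<eta>: "\<eta> \<in> L2_functions M2"
  shows "kernel_form k \<xi> \<eta> = (\<integral>y. integral_op M1 k \<xi> y * \<eta> y \<partial>M2)"
proof -
  have I: "integrable (M1 \<Otimes>\<^sub>M M2) (\<lambda>(x, y). k (x, y) * (\<xi> x * \<eta> y))"
    using kernel_form_integrable[OF assms] by (simp add: case_prod_beta')
  have "kernel_form k \<xi> \<eta> = (\<integral>y. (\<integral>x. (k (x, y) * \<xi> x) * \<eta> y \<partial>M1) \<partial>M2)"
    using integral_snd[OF I] by (simp add: kernel_form_def case_prod_beta' mult.assoc)
  also have "\<dots> = (\<integral>y. integral_op M1 k \<xi> y * \<eta> y \<partial>M2)"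
    unfolding integral_op_def by (intro Bochner_Integration.integral_cong refl integral_mult_left_zero)
  finally show ?thesis .
qed

lemma op_norm_bdd:
  assumes k: "k \<in> L2_functions (M1 \<Otimes>\<^sub>M M2)"
  shows "bdd_above ((\<lambda>\<xi>. L2_norm M2 (integral_op M1 k \<xi>)) ` {\<xi> \<in> L2_functions M1. L2_norm M1 \<xi> \<le> 1})"
proof (rule bdd_aboveI2[where M="L2_norm (M1 \<Otimes>\<^sub>M M2) k"])
  fix \<xi> assume "\<xi> \<in> {\<xi> \<in> L2_functions M1. L2_norm M1 \<xi> \<le> 1}"
  then have \<xi>: "\<xi> \<in> L2_functions M1" "L2_norm M1 \<xi> \<le> 1" by auto
  have "(L2_norm M2 (integral_op M1 k \<xi>))\<^sup>2 \<le> (L2_norm (M1 \<Otimes>\<^sub>M M2) k)\<^sup>2 * (L2_norm M1 \<xi>)\<^sup>2"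
    by (rule integral_op_L2[OF k \<xi>(1)])
  also have "\<dots> \<le> (L2_norm (M1 \<Otimes>\<^sub>M M2) k)\<^sup>2"
    by (rule mult_right_le_one_le[OF _ _ power_le_one]) (use \<xi>(2) in simp_all)
  finally show "L2_norm M2 (integral_op M1 k \<xi>) \<le> L2_norm (M1 \<Otimes>\<^sub>M M2) k"
    by (rule power2_le_imp_le[OF _ L2_norm_nonneg])
qed

lemma integral_op_scale: "integral_op M1 k (\<lambda>x. c * \<xi> x) = (\<lambda>y. c * integral_op M1 k \<xi> y)"
proof
  fix y
  have "(\<lambda>x. k (x, y) * (c * \<xi> x)) = (\<lambda>x. c * (k (x, y) * \<xi> x))"
    by (rule ext) (rule mult.left_commute)
  then show "integral_op M1 k (\<lambda>x. c * \<xi> x) y = c * integral_op M1 k \<xi> y"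
    unfolding integral_op_def by (simp only: integral_mult_right_zero)
qed

lemma op_norm_nonneg:
  assumes k: "k \<in> L2_functions (M1 \<Otimes>\<^sub>M M2)"
  shows "0 \<le> op_norm M1 M2 (integral_op M1 k)"
  unfolding op_norm_def
  by (rule cSUP_upper2[OF op_norm_bdd[OF k], of "\<lambda>_. 0"]) auto

lemma kernel_form_le_op_norm:
  assumes k: "k \<in> L2_functions (M1 \<Otimes>\<^sub>M M2)" and \<xi>: "\<xi> \<in> L2_functions M1" and \<eta>: "\<eta> \<in> L2_functions M2"
  shows "cmod (kernel_form k \<xi> \<eta>) \<le> op_norm M1 M2 (integral_op M1 k) * L2_norm M1 \<xi> * L2_norm M2 \<eta>"
proof -
  define D where "D = op_norm M1 M2 (integral_op M1 k)"
  have "L2_norm M2 (integral_op M1 k \<xi>) \<le> D * L2_norm M1 \<xi>"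
  proof (cases "L2_norm M1 \<xi> = 0")
    case True
    then have "(L2_norm M2 (integral_op M1 k \<xi>))\<^sup>2 \<le> 0"
      using integral_op_L2(2)[OF k \<xi>] by simp
    then show ?thesis using True by simp
  next
    case False
    define c where "c = L2_norm M1 \<xi>"
    have c: "0 < c" using False by (simp add: c_def less_le)
    have "L2_norm M2 (integral_op M1 k (\<lambda>x. complex_of_real (1/c) * \<xi> x)) \<le> D"
      unfolding D_def op_norm_def
    proof (rule cSUP_upper[OF _ op_norm_bdd[OF k]])
      have "L2_norm M1 (\<lambda>x. complex_of_real (1/c) * \<xi> x) = 1"
        unfolding L2_norm_scale c_def[symmetric] using c by (simp add: norm_divide)
      with L2_scale[OF \<xi>, of "complex_of_real (1/c)"]
      show "(\<lambda>x. complex_of_real (1/c) * \<xi> x) \<in> {\<xi> \<in> L2_functions M1. L2_norm M1 \<xi> \<le> 1}" by simp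
    qed
    then have "L2_norm M2 (integral_op M1 k \<xi>) / c \<le> D"
      unfolding integral_op_scale L2_norm_scale using c by (simp add: norm_divide)
    then show ?thesis using c by (simp add: c_def[symmetric] field_simps)
  qed
  then have "L2_norm M2 (integral_op M1 k \<xi>) * L2_norm M2 \<eta> \<le> D * L2_norm M1 \<xi> * L2_norm M2 \<eta>"
    by (rule mult_right_mono) simp
  then show ?thesis unfolding kernel_form_integral_op[OF assms] D_def
    by (rule order_trans[OF L2_Cauchy_Schwarz[OF integral_op_L2(1)[OF k \<xi>] \<eta>]])
qed

text \<open>
  Testing against the conjugate of the image of \<open>\<xi>\<close> recovers the norm of that image.
\<close>

lemma op_norm_leI:
  assumes k: "k \<in> L2_functions (M1 \<Otimes>\<^sub>M M2)" and D: "0 \<le> D"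
    and bnd: "\<And>\<xi> \<eta>. \<xi> \<in> L2_functions M1 \<Longrightarrow> \<eta> \<in> L2_functions M2 \<Longrightarrow>
      cmod (kernel_form k \<xi> \<eta>) \<le> D * L2_norm M1 \<xi> * L2_norm M2 \<eta>"
  shows "op_norm M1 M2 (integral_op M1 k) \<le> D"
  unfolding op_norm_def
proof (rule cSUP_least)
  show "{\<xi> \<in> L2_functions M1. L2_norm M1 \<xi> \<le> 1} \<noteq> {}"
    by (auto intro!: exI[of _ "\<lambda>_. 0"])
  fix \<xi> assume "\<xi> \<in> {\<xi> \<in> L2_functions M1. L2_norm M1 \<xi> \<le> 1}"
  then have \<xi>: "\<xi> \<in> L2_functions M1" "L2_norm M1 \<xi> \<le> 1" by auto
  define T where "T = integral_op M1 k \<xi>"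
  have T: "T \<in> L2_functions M2" unfolding T_def by (rule integral_op_L2[OF k \<xi>(1)])
  have "kernel_form k \<xi> (\<lambda>y. cnj (T y)) = (\<integral>y. T y * cnj (T y) \<partial>M2)"
    unfolding T_def by (rule kernel_form_integral_op[OF k \<xi>(1) L2_cnj[OF T, unfolded T_def]])
  also have "\<dots> = of_real ((L2_norm M2 T)\<^sup>2)"
    unfolding complex_norm_square[symmetric] L2_norm_square by (simp del: of_real_power)
  finally have eq: "kernel_form k \<xi> (\<lambda>y. cnj (T y)) = of_real ((L2_norm M2 T)\<^sup>2)" .
  have "(L2_norm M2 T)\<^sup>2 \<le> D * L2_norm M1 \<xi> * L2_norm M2 T"
    using bnd[OF \<xi>(1) L2_cnj[OF T]] unfolding eq norm_of_real by simp
  also have "\<dots> \<le> D * 1 * L2_norm M2 T"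
    using \<xi> D by (intro mult_right_mono mult_left_mono) auto
  finally have "L2_norm M2 T * L2_norm M2 T \<le> D * L2_norm M2 T" by (simp add: power2_eq_square)
  then show "L2_norm M2 (integral_op M1 k \<xi>) \<le> D"
    unfolding T_def[symmetric] using D
    by (cases "L2_norm M2 T = 0") (simp_all add: less_le)
qed

end

lemma L2_add:
  assumes f: "f \<in> L2_functions M" and g: "g \<in> L2_functions M"
  shows "(\<lambda>x. f x + g x) \<in> L2_functions M"
proof (rule L2_functionsI)
  note [measurable] = L2_measurable[OF f] L2_measurable[OF g]
  show "(\<lambda>x. f x + g x) \<in> borel_measurable M" by measurable
  show "integrable M (\<lambda>x. (cmod (f x + g x))\<^sup>2)"
  proof (rule Bochner_Integration.integrable_bound)
    show "integrable M (\<lambda>x. 2 * (cmod (f x))\<^sup>2 + 2 * (cmod (g x))\<^sup>2)"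
      using f g by (intro Bochner_Integration.integrable_add integrable_mult_right L2_integrable)
    show "AE x in M. norm ((cmod (f x + g x))\<^sup>2) \<le> norm (2 * (cmod (f x))\<^sup>2 + 2 * (cmod (g x))\<^sup>2)"
    proof (rule AE_I2)
      fix x
      have "(cmod (f x + g x))\<^sup>2 \<le> (cmod (f x) + cmod (g x))\<^sup>2"
        by (intro power_mono norm_triangle_ineq) simp
      also have "\<dots> \<le> 2 * (cmod (f x))\<^sup>2 + 2 * (cmod (g x))\<^sup>2"
        using sum_squares_bound[of "cmod (f x)" "cmod (g x)"] by (simp add: power2_sum)
      finally show "norm ((cmod (f x + g x))\<^sup>2) \<le> norm (2 * (cmod (f x))\<^sup>2 + 2 * (cmod (g x))\<^sup>2)"
        by simp
    qed
  qed measurable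
qed

lemma L2_sum:
  assumes "\<And>i. i \<in> I \<Longrightarrow> f i \<in> L2_functions M"
  shows "(\<lambda>x. \<Sum>i\<in>I. f i x) \<in> L2_functions M"
  using assms by (induction I rule: infinite_finite_induct) (auto intro: L2_add)

text \<open>
  The best \<open>t\<close> is \<open>sqrt B / sqrt A\<close>. Both numbers are first enlarged by \<open>d > 0\<close>, so that the quotient makes sense.
\<close>

lemma le_two_sqrt_mult:
  fixes F A B :: real
  assumes A: "0 \<le> A" and B: "0 \<le> B" and le: "\<And>t. 0 < t \<Longrightarrow> F \<le> t * A + B / t"
  shows "F \<le> 2 * (sqrt A * sqrt B)"
proof -
  have 1: "F \<le> 2 * (sqrt (A + d) * sqrt (B + d))" if d: "0 < d" for d
  proof -
    define t where "t = sqrt (B + d) / sqrt (A + d)"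
    have p: "0 < sqrt (A + d)" "0 < sqrt (B + d)" using A B d by auto
    have t: "0 < t" using p by (simp add: t_def)
    have "F \<le> t * A + B / t" by (rule le[OF t])
    also have "\<dots> \<le> t * (A + d) + (B + d) / t"
      using t d by (intro add_mono mult_left_mono divide_right_mono) auto
    also have "t * (A + d) = sqrt (A + d) * sqrt (B + d)"
    proof -
      have "t * (A + d) = sqrt (B + d) * ((A + d) / sqrt (A + d))" by (simp add: t_def)
      also have "(A + d) / sqrt (A + d) = sqrt (A + d)" using A d by (intro real_div_sqrt) simp
      finally show ?thesis by (simp only: mult.commute)
    qed
    also have "(B + d) / t = sqrt (A + d) * sqrt (B + d)"
    proof -
      have "(B + d) / t = sqrt (A + d) * ((B + d) / sqrt (B + d))" by (simp add: t_def)
      also have "(B + d) / sqrt (B + d) = sqrt (B + d)" using B d by (intro real_div_sqrt) simp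
      finally show ?thesis .
    qed
    finally show ?thesis by simp
  qed
  have "((\<lambda>d. 2 * (sqrt (A + d) * sqrt (B + d))) \<longlongrightarrow> 2 * (sqrt (A + 0) * sqrt (B + 0))) (at_right 0)"
    by (intro tendsto_intros)
  then have lim: "((\<lambda>d. 2 * (sqrt (A + d) * sqrt (B + d))) \<longlongrightarrow> 2 * (sqrt A * sqrt B)) (at_right 0)"
    by simp
  have ev: "\<forall>\<^sub>F d in at_right (0::real). F \<le> 2 * (sqrt (A + d) * sqrt (B + d))"
    using eventually_at_right_less[of "0::real"] by eventually_elim (rule 1)
  show ?thesis
    by (rule tendsto_lowerbound[OF lim ev]) simp
qed

text \<open>
  Bessel's inequality for orthogonal functions. Since their supports are disjoint, it follows from the
  Cauchy-Schwarz inequality on each support.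
\<close>

lemma disjoint_Bessel:
  fixes e :: "'i \<Rightarrow> 'a \<Rightarrow> real"
  assumes I: "finite I" and e: "\<And>i. i \<in> I \<Longrightarrow> (\<lambda>x. complex_of_real (e i x)) \<in> L2_functions M"
    and disj: "\<And>i j x. i \<in> I \<Longrightarrow> j \<in> I \<Longrightarrow> i \<noteq> j \<Longrightarrow> e i x * e j x = 0"
    and pos: "\<And>i. i \<in> I \<Longrightarrow> 0 < (\<integral>x. (e i x)\<^sup>2 \<partial>M)"
    and \<xi>: "\<xi> \<in> L2_functions M"
  shows "(\<Sum>i\<in>I. (cmod (\<integral>x. of_real (e i x) * \<xi> x \<partial>M))\<^sup>2 / (\<integral>x. (e i x)\<^sup>2 \<partial>M)) \<le> (L2_norm M \<xi>)\<^sup>2"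
proof -
  note [measurable] = L2_measurable[OF \<xi>]
  have em: "e i \<in> borel_measurable M" if "i \<in> I" for i
  proof -
    have "(\<lambda>x. Re (complex_of_real (e i x))) \<in> borel_measurable M"
      using L2_measurable[OF e[OF that]] by measurable
    then show ?thesis by simp
  qed
  define S where "S i = {x \<in> space M. e i x \<noteq> 0}" for i
  have S[measurable]: "S i \<in> sets M" if "i \<in> I" for i
    unfolding S_def using em[OF that] by measurable
  define \<xi>' where "\<xi>' i x = complex_of_real (indicator (S i) x) * \<xi> x" for i x
  have \<xi>': "\<xi>' i \<in> L2_functions M" if "i \<in> I" for i
    unfolding \<xi>'_def using S[OF that]
    by (intro L2_bounded_mult[OF \<xi>, where B=1]) (auto simp: indicator_def)
  have one: "(cmod (\<integral>x. of_real (e i x) * \<xi> x \<partial>M))\<^sup>2 / (\<integral>x. (e i x)\<^sup>2 \<partial>M) \<le> (\<integral>x. (cmod (\<xi>' i x))\<^sup>2 \<partial>M)"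
    if "i \<in> I" for i
  proof -
    have "(\<integral>x. of_real (e i x) * \<xi> x \<partial>M) = (\<integral>x. of_real (e i x) * \<xi>' i x \<partial>M)"
      by (intro Bochner_Integration.integral_cong) (auto simp: \<xi>'_def S_def indicator_def)
    then have "(cmod (\<integral>x. of_real (e i x) * \<xi> x \<partial>M))\<^sup>2 \<le> (L2_norm M (\<lambda>x. complex_of_real (e i x)) * L2_norm M (\<xi>' i))\<^sup>2"
      using L2_Cauchy_Schwarz[OF e[OF that] \<xi>'[OF that]] by (intro power_mono) auto
    also have "\<dots> = (\<integral>x. (e i x)\<^sup>2 \<partial>M) * (\<integral>x. (cmod (\<xi>' i x))\<^sup>2 \<partial>M)"
      by (simp only: power_mult_distrib L2_norm_square norm_of_real power2_abs)
    finally show ?thesis using pos[OF that] by (simp add: pos_divide_le_eq mult.commute)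
  qed
  have "(\<Sum>i\<in>I. (cmod (\<integral>x. of_real (e i x) * \<xi> x \<partial>M))\<^sup>2 / (\<integral>x. (e i x)\<^sup>2 \<partial>M))
      \<le> (\<Sum>i\<in>I. \<integral>x. (cmod (\<xi>' i x))\<^sup>2 \<partial>M)"
    by (intro sum_mono one)
  also have "\<dots> = (\<integral>x. (\<Sum>i\<in>I. (cmod (\<xi>' i x))\<^sup>2) \<partial>M)"
    using L2_integrable[OF \<xi>'] by (intro Bochner_Integration.integral_sum[symmetric]) auto
  also have "\<dots> \<le> (\<integral>x. (cmod (\<xi> x))\<^sup>2 \<partial>M)"
  proof (intro integral_mono Bochner_Integration.integrable_sum L2_integrable \<xi> \<xi>')
    fix x assume "x \<in> space M"
    show "(\<Sum>i\<in>I. (cmod (\<xi>' i x))\<^sup>2) \<le> (cmod (\<xi> x))\<^sup>2"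
    proof (cases "\<exists>i\<in>I. x \<in> S i")
      case True
      then obtain i where i: "i \<in> I" "x \<in> S i" by auto
      have "x \<notin> S j" if "j \<in> I - {i}" for j
        using disj[of i j x] that i by (auto simp: S_def)
      then have "(\<Sum>j\<in>I - {i}. (cmod (\<xi>' j x))\<^sup>2) = 0"
        by (intro sum.neutral) (auto simp: \<xi>'_def)
      moreover have "(\<Sum>j\<in>I. (cmod (\<xi>' j x))\<^sup>2) = (cmod (\<xi>' i x))\<^sup>2 + (\<Sum>j\<in>I - {i}. (cmod (\<xi>' j x))\<^sup>2)"
        using I i by (intro sum.remove) auto
      moreover have "\<xi>' i x = \<xi> x" using i by (simp add: \<xi>'_def)
      ultimately show ?thesis by simp
    next
      case False
      then have "(\<Sum>i\<in>I. (cmod (\<xi>' i x))\<^sup>2) = 0"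
        by (intro sum.neutral) (auto simp: \<xi>'_def)
      then show ?thesis by simp
    qed
  qed
  finally show ?thesis by (simp add: L2_norm_square)
qed

lemma disjoint_support_sum:
  fixes e :: "'i \<Rightarrow> 'c \<Rightarrow> real" and a :: "'i \<Rightarrow> complex"
  assumes "finite I" "i \<in> I" and disj: "\<And>i j. i \<in> I \<Longrightarrow> j \<in> I \<Longrightarrow> i \<noteq> j \<Longrightarrow> e i x * e j x = 0"
  shows "of_real (e i x) * (\<Sum>k\<in>I. a k * of_real (e k x)) = a i * of_real ((e i x)\<^sup>2)"
proof -
  have "of_real (e i x) * (\<Sum>k\<in>I. a k * of_real (e k x)) = (\<Sum>k\<in>I. a k * of_real (e i x * e k x))"
    by (simp add: sum_distrib_left mult_ac)
  also have "\<dots> = (\<Sum>k\<in>{i}. a k * of_real (e i x * e k x))"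
    using assms by (intro sum.mono_neutral_right) auto
  finally show ?thesis by (simp add: power2_eq_square)
qed

text \<open>
  The test function at which the form of the multiplied kernel is evaluated later. The real factor \<open>sqrt (w i / \<mu> i)\<close>
  gives the summand of index \<open>i\<close> the squared norm \<open>w i\<close>.
\<close>

lemma disjoint_test_function:
  fixes e :: "'i \<Rightarrow> 'a \<Rightarrow> real" and w \<mu> :: "'i \<Rightarrow> real"
  assumes I: "finite I" and e: "\<And>i. i \<in> I \<Longrightarrow> (\<lambda>x. complex_of_real (e i x)) \<in> L2_functions M"
    and disj: "\<And>i j x. i \<in> I \<Longrightarrow> j \<in> I \<Longrightarrow> i \<noteq> j \<Longrightarrow> e i x * e j x = 0"
    and \<mu>: "\<And>i. i \<in> I \<Longrightarrow> 0 < \<mu> i" "\<And>i. i \<in> I \<Longrightarrow> \<mu> i = (\<integral>x. (e i x)\<^sup>2 \<partial>M)"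
    and w: "\<And>i. i \<in> I \<Longrightarrow> 0 < w i"
  defines "\<xi> \<equiv> \<lambda>x. \<Sum>i\<in>I. complex_of_real (sqrt (w i / \<mu> i)) * of_real (e i x)"
  shows "\<xi> \<in> L2_functions M"
    and "i \<in> I \<Longrightarrow> of_real (e i x) * \<xi> x = of_real (sqrt (w i / \<mu> i) * (e i x)\<^sup>2)"
    and "(L2_norm M \<xi>)\<^sup>2 = (\<Sum>i\<in>I. w i)"
proof -
  show "\<xi> \<in> L2_functions M" unfolding \<xi>_def by (intro L2_sum L2_scale e)
  show E\<xi>: "of_real (e i x) * \<xi> x = of_real (sqrt (w i / \<mu> i) * (e i x)\<^sup>2)" if "i \<in> I" for i x
    unfolding \<xi>_def using disjoint_support_sum[OF I that, of e x] disj by simp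
  have "(cmod (\<xi> x))\<^sup>2 = (\<Sum>i\<in>I. w i / \<mu> i * (e i x)\<^sup>2)" for x
  proof -
    have "complex_of_real ((cmod (\<xi> x))\<^sup>2) = \<xi> x * \<xi> x"
    proof -
      have "cnj (\<xi> x) = \<xi> x" by (simp add: \<xi>_def)
      then show ?thesis unfolding complex_norm_square by simp
    qed
    also have "\<dots> = (\<Sum>i\<in>I. complex_of_real (sqrt (w i / \<mu> i)) * (of_real (e i x) * \<xi> x))"
      by (subst \<xi>_def) (simp add: sum_distrib_right sum_distrib_left mult_ac)
    also have "\<dots> = (\<Sum>i\<in>I. complex_of_real (w i / \<mu> i * (e i x)\<^sup>2))"
    proof (rule sum.cong[OF refl])
      fix i assume i: "i \<in> I"
      have "sqrt (w i / \<mu> i) * sqrt (w i / \<mu> i) = w i / \<mu> i"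
        using w[OF i] \<mu>(1)[OF i] by simp
      then show "complex_of_real (sqrt (w i / \<mu> i)) * (of_real (e i x) * \<xi> x) = complex_of_real (w i / \<mu> i * (e i x)\<^sup>2)"
        unfolding E\<xi>[OF i] by (simp only: of_real_mult[symmetric] mult.assoc[symmetric])
    qed
    finally show ?thesis by (simp only: of_real_sum[symmetric] of_real_eq_iff)
  qed
  then have "(L2_norm M \<xi>)\<^sup>2 = (\<integral>x. (\<Sum>i\<in>I. w i / \<mu> i * (e i x)\<^sup>2) \<partial>M)"
    unfolding L2_norm_square by simp
  also have "\<dots> = (\<Sum>i\<in>I. w i / \<mu> i * (\<integral>x. (e i x)\<^sup>2 \<partial>M))"
    using L2_integrable[OF e] by (subst Bochner_Integration.integral_sum) auto
  also have "\<dots> = (\<Sum>i\<in>I. w i)"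
    using \<mu> by (intro sum.cong) (auto simp: less_imp_neq[symmetric] field_simps)
  finally show "(L2_norm M \<xi>)\<^sup>2 = (\<Sum>i\<in>I. w i)" .
qed

lemma disjoint_weighted_Bessel:
  fixes e :: "'i \<Rightarrow> 'a \<Rightarrow> real" and w \<mu> :: "'i \<Rightarrow> real"
  assumes I: "finite I" and e: "\<And>i. i \<in> I \<Longrightarrow> (\<lambda>x. complex_of_real (e i x)) \<in> L2_functions M"
    and disj: "\<And>i j x. i \<in> I \<Longrightarrow> j \<in> I \<Longrightarrow> i \<noteq> j \<Longrightarrow> e i x * e j x = 0"
    and \<mu>: "\<And>i. i \<in> I \<Longrightarrow> 0 < \<mu> i" "\<And>i. i \<in> I \<Longrightarrow> \<mu> i = (\<integral>x. (e i x)\<^sup>2 \<partial>M)"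
    and w: "\<And>i. i \<in> I \<Longrightarrow> 0 < w i" and \<xi>: "\<xi> \<in> L2_functions M"
  shows "(\<Sum>i\<in>I. w i * (cmod (of_real (1 / sqrt (\<mu> i * w i)) * (\<integral>x. of_real (e i x) * \<xi> x \<partial>M)))\<^sup>2) \<le> (L2_norm M \<xi>)\<^sup>2"
proof -
  have "(\<Sum>i\<in>I. w i * (cmod (of_real (1 / sqrt (\<mu> i * w i)) * (\<integral>x. of_real (e i x) * \<xi> x \<partial>M)))\<^sup>2) =
      (\<Sum>i\<in>I. (cmod (\<integral>x. of_real (e i x) * \<xi> x \<partial>M))\<^sup>2 / (\<integral>x. (e i x)\<^sup>2 \<partial>M))"
  proof (rule sum.cong[OF refl])
    fix i assume i: "i \<in> I"
    have "w i * (cmod (of_real (1 / sqrt (\<mu> i * w i)))) \<^sup>2 = 1 / \<mu> i"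
      using w[OF i] \<mu>(1)[OF i] unfolding norm_of_real by (simp add: power_divide)
    then show "w i * (cmod (of_real (1 / sqrt (\<mu> i * w i)) * (\<integral>x. of_real (e i x) * \<xi> x \<partial>M)))\<^sup>2 =
        (cmod (\<integral>x. of_real (e i x) * \<xi> x \<partial>M))\<^sup>2 / (\<integral>x. (e i x)\<^sup>2 \<partial>M)"
      unfolding norm_mult power_mult_distrib \<mu>(2)[OF i, symmetric] mult.assoc[symmetric] by simp
  qed
  also have "\<dots> \<le> (L2_norm M \<xi>)\<^sup>2"
    using \<mu> by (intro disjoint_Bessel I e disj \<xi>) auto
  finally show ?thesis .
qed

context pair_sigma_finite
begin

lemma kernel_form_sum_tensor:
  assumes e: "\<And>i. i \<in> I \<Longrightarrow> e i \<in> L2_functions M1" and f: "\<And>j. j \<in> J \<Longrightarrow> f j \<in> L2_functions M2"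
    and \<xi>: "\<xi> \<in> L2_functions M1" and \<eta>: "\<eta> \<in> L2_functions M2"
  shows "kernel_form (\<lambda>z. \<Sum>i\<in>I. \<Sum>j\<in>J. c i j * (e i (fst z) * f j (snd z))) \<xi> \<eta>
    = (\<Sum>i\<in>I. \<Sum>j\<in>J. c i j * ((\<integral>x. e i x * \<xi> x \<partial>M1) * (\<integral>y. f j y * \<eta> y \<partial>M2)))"
proof -
  have int: "integrable (M1 \<Otimes>\<^sub>M M2) (\<lambda>z. (e i (fst z) * f j (snd z)) * (\<xi> (fst z) * \<eta> (snd z)))"
    if "i \<in> I" "j \<in> J" for i j
    using L2_tensor[OF e[OF that(1)] f[OF that(2)]] \<xi> \<eta> by (rule kernel_form_integrable)
  have val: "(\<integral>z. (e i (fst z) * f j (snd z)) * (\<xi> (fst z) * \<eta> (snd z)) \<partial>(M1 \<Otimes>\<^sub>M M2))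
      = (\<integral>x. e i x * \<xi> x \<partial>M1) * (\<integral>y. f j y * \<eta> y \<partial>M2)" if "i \<in> I" "j \<in> J" for i j
  proof -
    have "integrable (M1 \<Otimes>\<^sub>M M2) (\<lambda>(x, y). (e i x * \<xi> x) * (f j y * \<eta> y))"
      using int[OF that] by (simp add: case_prod_beta' mult_ac)
    from integral_fst[OF this]
    have "(\<integral>z. (e i (fst z) * \<xi> (fst z)) * (f j (snd z) * \<eta> (snd z)) \<partial>(M1 \<Otimes>\<^sub>M M2))
      = (\<integral>x. e i x * \<xi> x \<partial>M1) * (\<integral>y. f j y * \<eta> y \<partial>M2)"
      by (simp add: case_prod_beta')
    moreover have "(\<lambda>z. (e i (fst z) * f j (snd z)) * (\<xi> (fst z) * \<eta> (snd z))) =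
        (\<lambda>z. (e i (fst z) * \<xi> (fst z)) * (f j (snd z) * \<eta> (snd z)))"
      by (rule ext) (simp only: mult_ac)
    ultimately show ?thesis by simp
  qed
  have "kernel_form (\<lambda>z. \<Sum>i\<in>I. \<Sum>j\<in>J. c i j * (e i (fst z) * f j (snd z))) \<xi> \<eta> =
    (\<integral>z. (\<Sum>i\<in>I. \<Sum>j\<in>J. c i j * ((e i (fst z) * f j (snd z)) * (\<xi> (fst z) * \<eta> (snd z)))) \<partial>(M1 \<Otimes>\<^sub>M M2))"
    unfolding kernel_form_def by (simp add: sum_distrib_right mult.assoc)
  also have "\<dots> = (\<Sum>i\<in>I. \<Sum>j\<in>J. c i j * ((\<integral>x. e i x * \<xi> x \<partial>M1) * (\<integral>y. f j y * \<eta> y \<partial>M2)))"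
  proof (subst Bochner_Integration.integral_sum)
    show "integrable (M1 \<Otimes>\<^sub>M M2) (\<lambda>z. \<Sum>j\<in>J. c i j * ((e i (fst z) * f j (snd z)) * (\<xi> (fst z) * \<eta> (snd z))))"
      if "i \<in> I" for i
      using int[OF that] by (intro Bochner_Integration.integrable_sum integrable_mult_right) auto
    show "(\<Sum>i\<in>I. \<integral>z. (\<Sum>j\<in>J. c i j * ((e i (fst z) * f j (snd z)) * (\<xi> (fst z) * \<eta> (snd z)))) \<partial>(M1 \<Otimes>\<^sub>M M2)) =
      (\<Sum>i\<in>I. \<Sum>j\<in>J. c i j * ((\<integral>x. e i x * \<xi> x \<partial>M1) * (\<integral>y. f j y * \<eta> y \<partial>M2)))"
    proof (rule sum.cong[OF refl])
      fix i assume i: "i \<in> I"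
      show "(\<integral>z. (\<Sum>j\<in>J. c i j * ((e i (fst z) * f j (snd z)) * (\<xi> (fst z) * \<eta> (snd z)))) \<partial>(M1 \<Otimes>\<^sub>M M2)) =
        (\<Sum>j\<in>J. c i j * ((\<integral>x. e i x * \<xi> x \<partial>M1) * (\<integral>y. f j y * \<eta> y \<partial>M2)))"
        using int[OF i] val[OF i] by (subst Bochner_Integration.integral_sum) auto
    qed
  qed
  finally show ?thesis .
qed

text \<open>
  The kernel \<open>k\<close> with the coefficients \<open>u i j / sqrt (\<mu> i * w i * \<nu> j * v j)\<close> in the products \<open>e i (x) * f j (y)\<close> has norm
  at most \<open>2\<close>: the hypothesis on \<open>u\<close>, \<open>w\<close> and \<open>v\<close> bounds the real part of its form, and rotating and rescaling the
  arguments improves this to the modulus. The functions \<open>\<xi>\<close> and \<open>\<eta>\<close> with the coefficients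
  \<open>sqrt (w i / \<mu> i)\<close> and \<open>sqrt (v j / \<nu> j)\<close> have squared norms \<open>\<Sum>i. w i\<close> and \<open>\<Sum>j. v j\<close>, and because the supports
  are disjoint, the form of \<open>\<phi> k\<close> at \<open>\<xi>\<close> and \<open>\<eta>\<close> is the sum to be estimated.
\<close>

lemma schur_multiplier_averages:
  fixes e :: "'i \<Rightarrow> 'a \<Rightarrow> real" and f :: "'j \<Rightarrow> 'b \<Rightarrow> real"
  assumes \<phi>: "\<phi> \<in> Linf_functions (M1 \<Otimes>\<^sub>M M2)" and C: "0 \<le> C"
    and schur: "\<And>k. k \<in> L2_functions (M1 \<Otimes>\<^sub>M M2) \<Longrightarrow>
      op_norm M1 M2 (integral_op M1 (\<lambda>z. \<phi> z * k z)) \<le> C * op_norm M1 M2 (integral_op M1 k)"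
    and I: "finite I" and J: "finite J"
    and e: "\<And>i. i \<in> I \<Longrightarrow> (\<lambda>x. complex_of_real (e i x)) \<in> L2_functions M1"
    and f: "\<And>j. j \<in> J \<Longrightarrow> (\<lambda>y. complex_of_real (f j y)) \<in> L2_functions M2"
    and de: "\<And>i j x. i \<in> I \<Longrightarrow> j \<in> I \<Longrightarrow> i \<noteq> j \<Longrightarrow> e i x * e j x = 0"
    and df: "\<And>i j y. i \<in> J \<Longrightarrow> j \<in> J \<Longrightarrow> i \<noteq> j \<Longrightarrow> f i y * f j y = 0"
    and epos: "\<And>i. i \<in> I \<Longrightarrow> 0 < \<mu> i" "\<And>i. i \<in> I \<Longrightarrow> \<mu> i = (\<integral>x. (e i x)\<^sup>2 \<partial>M1)"
    and fpos: "\<And>j. j \<in> J \<Longrightarrow> 0 < \<nu> j" "\<And>j. j \<in> J \<Longrightarrow> \<nu> j = (\<integral>y. (f j y)\<^sup>2 \<partial>M2)"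
    and w: "\<And>i. i \<in> I \<Longrightarrow> 0 < w i" and v: "\<And>j. j \<in> J \<Longrightarrow> 0 < v j"
    and uwv: "\<And>a b. Re (\<Sum>i\<in>I. \<Sum>j\<in>J. u i j * (a i * b j))
          \<le> (\<Sum>i\<in>I. w i * (cmod (a i))\<^sup>2) + (\<Sum>j\<in>J. v j * (cmod (b j))\<^sup>2)"
  shows "Re (\<Sum>i\<in>I. \<Sum>j\<in>J. u i j *
      ((\<integral>z. \<phi> z * of_real ((e i (fst z))\<^sup>2 * (f j (snd z))\<^sup>2) \<partial>(M1 \<Otimes>\<^sub>M M2)) / of_real (\<mu> i * \<nu> j)))
     \<le> C * ((\<Sum>i\<in>I. w i) + (\<Sum>j\<in>J. v j))"
proof -
  define \<alpha> where "\<alpha> i = complex_of_real (1 / sqrt (\<mu> i * w i))" for i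
  define \<beta> where "\<beta> j = complex_of_real (1 / sqrt (\<nu> j * v j))" for j
  define c where "c i j = u i j * (\<alpha> i * \<beta> j)" for i j
  define E where "E i x = complex_of_real (e i x)" for i x
  define F where "F j y = complex_of_real (f j y)" for j y
  have E: "E i \<in> L2_functions M1" if "i \<in> I" for i using e[OF that] by (simp add: E_def[abs_def])
  have F: "F j \<in> L2_functions M2" if "j \<in> J" for j using f[OF that] by (simp add: F_def[abs_def])
  define k where "k z = (\<Sum>i\<in>I. \<Sum>j\<in>J. c i j * (E i (fst z) * F j (snd z)))" for z
  have k: "k \<in> L2_functions (M1 \<Otimes>\<^sub>M M2)"
    unfolding k_def[abs_def] by (intro L2_sum L2_scale L2_tensor E F)
  have form: "kernel_form k \<xi> \<eta> = (\<Sum>i\<in>I. \<Sum>j\<in>J. u i j * ((\<alpha> i * (\<integral>x. E i x * \<xi> x \<partial>M1)) * (\<beta> j * (\<integral>y. F j y * \<eta> y \<partial>M2))))"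
    if "\<xi> \<in> L2_functions M1" "\<eta> \<in> L2_functions M2" for \<xi> \<eta>
    unfolding k_def[abs_def] using kernel_form_sum_tensor[of I E J F, OF E F that, of c]
    by (simp add: c_def mult_ac)
  have Re_form: "Re (kernel_form k \<xi> \<eta>) \<le> (L2_norm M1 \<xi>)\<^sup>2 + (L2_norm M2 \<eta>)\<^sup>2"
    if \<xi>: "\<xi> \<in> L2_functions M1" and \<eta>: "\<eta> \<in> L2_functions M2" for \<xi> \<eta>
  proof -
    have 1: "(\<Sum>i\<in>I. w i * (cmod (\<alpha> i * (\<integral>x. E i x * \<xi> x \<partial>M1)))\<^sup>2) \<le> (L2_norm M1 \<xi>)\<^sup>2"
      unfolding \<alpha>_def E_def by (rule disjoint_weighted_Bessel[OF I e de epos w \<xi>])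
    have 2: "(\<Sum>j\<in>J. v j * (cmod (\<beta> j * (\<integral>y. F j y * \<eta> y \<partial>M2)))\<^sup>2) \<le> (L2_norm M2 \<eta>)\<^sup>2"
      unfolding \<beta>_def F_def by (rule disjoint_weighted_Bessel[OF J f df fpos v \<eta>])
    show ?thesis unfolding form[OF \<xi> \<eta>] using uwv 1 2 by (meson add_mono order_trans)
  qed
  have norm_form: "cmod (kernel_form k \<xi> \<eta>) \<le> 2 * L2_norm M1 \<xi> * L2_norm M2 \<eta>"
    if \<xi>: "\<xi> \<in> L2_functions M1" and \<eta>: "\<eta> \<in> L2_functions M2" for \<xi> \<eta>
  proof -
    have "cmod (kernel_form k \<xi> \<eta>) \<le> t * (L2_norm M1 \<xi>)\<^sup>2 + (L2_norm M2 \<eta>)\<^sup>2 / t" if t: "0 < t" for t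
    proof -
      \<comment> \<open>A unimodular factor (or \<open>0\<close>) that makes the form real and nonnegative.\<close>
      define s where "s = sgn (cnj (kernel_form k \<xi> \<eta>))"
      have s1: "cmod s \<le> 1" by (simp add: s_def norm_sgn)
      have s2: "s * kernel_form k \<xi> \<eta> = of_real (cmod (kernel_form k \<xi> \<eta>))"
      proof (cases "kernel_form k \<xi> \<eta> = 0")
        case False
        have "s * kernel_form k \<xi> \<eta> = kernel_form k \<xi> \<eta> * cnj (kernel_form k \<xi> \<eta>) / of_real (cmod (kernel_form k \<xi> \<eta>))"
          by (simp add: s_def sgn_eq mult.commute)
        also have "\<dots> = of_real (cmod (kernel_form k \<xi> \<eta>))"
          using False unfolding complex_norm_square[symmetric] by (simp add: power2_eq_square)
        finally show ?thesis .
      qed simp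
      have fs: "kernel_form k (\<lambda>x. (s * of_real (sqrt t)) * \<xi> x) (\<lambda>y. of_real (1 / sqrt t) * \<eta> y) = s * kernel_form k \<xi> \<eta>"
      proof -
        have "k z * ((s * of_real (sqrt t)) * \<xi> (fst z) * (of_real (1 / sqrt t) * \<eta> (snd z))) =
            s * (k z * (\<xi> (fst z) * \<eta> (snd z)))" for z
        proof -
          have "complex_of_real (sqrt t) * of_real (1 / sqrt t) = 1" using t by (simp flip: of_real_mult)
          moreover have "k z * ((s * of_real (sqrt t)) * \<xi> (fst z) * (of_real (1 / sqrt t) * \<eta> (snd z))) =
            (complex_of_real (sqrt t) * of_real (1 / sqrt t)) * (s * (k z * (\<xi> (fst z) * \<eta> (snd z))))"
            by (simp only: mult_ac)
          ultimately show ?thesis by (simp only: mult_1)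
        qed
        then show ?thesis unfolding kernel_form_def by (simp only: integral_mult_right_zero)
      qed
      have "cmod (kernel_form k \<xi> \<eta>) = Re (s * kernel_form k \<xi> \<eta>)" unfolding s2 by simp
      also have "\<dots> \<le> (L2_norm M1 (\<lambda>x. (s * of_real (sqrt t)) * \<xi> x))\<^sup>2 + (L2_norm M2 (\<lambda>y. of_real (1 / sqrt t) * \<eta> y))\<^sup>2"
        unfolding fs[symmetric] by (intro Re_form L2_scale \<xi> \<eta>)
      also have "\<dots> = (cmod s)\<^sup>2 * (t * (L2_norm M1 \<xi>)\<^sup>2) + (L2_norm M2 \<eta>)\<^sup>2 / t"
        unfolding L2_norm_scale using t by (simp add: norm_mult norm_divide power_mult_distrib power_divide)
      also have "\<dots> \<le> 1 * (t * (L2_norm M1 \<xi>)\<^sup>2) + (L2_norm M2 \<eta>)\<^sup>2 / t"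
        using s1 t by (intro add_mono mult_right_mono) (auto simp: power_le_one)
      finally show ?thesis by simp
    qed
    from le_two_sqrt_mult[OF _ _ this] show ?thesis by simp
  qed
  have opk: "op_norm M1 M2 (integral_op M1 k) \<le> 2"
    using norm_form by (intro op_norm_leI k) auto
  define \<xi> where "\<xi> x = (\<Sum>i\<in>I. complex_of_real (sqrt (w i / \<mu> i)) * E i x)" for x
  define \<eta> where "\<eta> y = (\<Sum>j\<in>J. complex_of_real (sqrt (v j / \<nu> j)) * F j y)" for y
  have \<xi>: "\<xi> \<in> L2_functions M1" and n\<xi>: "(L2_norm M1 \<xi>)\<^sup>2 = (\<Sum>i\<in>I. w i)"
    and E\<xi>: "i \<in> I \<Longrightarrow> E i x * \<xi> x = of_real (sqrt (w i / \<mu> i) * (e i x)\<^sup>2)" for i x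
    unfolding \<xi>_def[abs_def] E_def by (rule disjoint_test_function[OF I e de epos w]; assumption)+
  have \<eta>: "\<eta> \<in> L2_functions M2" and n\<eta>: "(L2_norm M2 \<eta>)\<^sup>2 = (\<Sum>j\<in>J. v j)"
    and F\<eta>: "j \<in> J \<Longrightarrow> F j y * \<eta> y = of_real (sqrt (v j / \<nu> j) * (f j y)\<^sup>2)" for j y
    unfolding \<eta>_def[abs_def] F_def by (rule disjoint_test_function[OF J f df fpos v]; assumption)+
  from \<phi> obtain B where \<phi>m: "\<phi> \<in> borel_measurable (M1 \<Otimes>\<^sub>M M2)" and B: "AE z in M1 \<Otimes>\<^sub>M M2. cmod (\<phi> z) \<le> B"
    unfolding Linf_functions_def by blast
  have \<phi>L2: "(\<lambda>z. \<phi> z * h z) \<in> L2_functions (M1 \<Otimes>\<^sub>M M2)" if "h \<in> L2_functions (M1 \<Otimes>\<^sub>M M2)" for h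
    by (rule L2_bounded_mult[OF that \<phi>m B])
  define m where "m i j = (\<integral>z. \<phi> z * of_real ((e i (fst z))\<^sup>2 * (f j (snd z))\<^sup>2) \<partial>(M1 \<Otimes>\<^sub>M M2)) / of_real (\<mu> i * \<nu> j)" for i j
  have eq: "kernel_form (\<lambda>z. \<phi> z * k z) \<xi> \<eta> = (\<Sum>i\<in>I. \<Sum>j\<in>J. u i j * m i j)"
  proof -
    have coef: "c i j * (of_real (sqrt (w i / \<mu> i)) * of_real (sqrt (v j / \<nu> j))) = u i j / of_real (\<mu> i * \<nu> j)"
      if "i \<in> I" "j \<in> J" for i j
    proof -
      have q: "1 / sqrt (a * b) * sqrt (b / a) = 1 / a" if "0 < a" "0 < b" for a b :: real
        using that by (simp add: real_sqrt_mult real_sqrt_divide)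
      have 1: "\<alpha> i * of_real (sqrt (w i / \<mu> i)) = of_real (1 / \<mu> i)"
        unfolding \<alpha>_def of_real_mult[symmetric] using q[OF epos(1) w] that by simp
      have 2: "\<beta> j * of_real (sqrt (v j / \<nu> j)) = of_real (1 / \<nu> j)"
        unfolding \<beta>_def of_real_mult[symmetric] using q[OF fpos(1) v] that by simp
      have "c i j * (of_real (sqrt (w i / \<mu> i)) * of_real (sqrt (v j / \<nu> j))) =
          u i j * ((\<alpha> i * of_real (sqrt (w i / \<mu> i))) * (\<beta> j * of_real (sqrt (v j / \<nu> j))))"
        unfolding c_def by (simp only: mult_ac)
      then show ?thesis unfolding 1 2 by simp
    qed
    have pt: "(\<phi> z * k z) * (\<xi> (fst z) * \<eta> (snd z)) = (\<Sum>i\<in>I. \<Sum>j\<in>J.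
        (u i j / of_real (\<mu> i * \<nu> j)) * (\<phi> z * of_real ((e i (fst z))\<^sup>2 * (f j (snd z))\<^sup>2)))" for z
    proof -
      have "(\<phi> z * k z) * (\<xi> (fst z) * \<eta> (snd z)) =
        (\<Sum>i\<in>I. \<Sum>j\<in>J. (c i j * \<phi> z) * ((E i (fst z) * \<xi> (fst z)) * (F j (snd z) * \<eta> (snd z))))"
        unfolding k_def by (simp add: sum_distrib_right sum_distrib_left mult_ac)
      also have "\<dots> = (\<Sum>i\<in>I. \<Sum>j\<in>J.
        (u i j / of_real (\<mu> i * \<nu> j)) * (\<phi> z * of_real ((e i (fst z))\<^sup>2 * (f j (snd z))\<^sup>2)))"
      proof (intro sum.cong refl)
        fix i j assume ij: "i \<in> I" "j \<in> J"
        have "(c i j * \<phi> z) * ((E i (fst z) * \<xi> (fst z)) * (F j (snd z) * \<eta> (snd z))) =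
          (c i j * (of_real (sqrt (w i / \<mu> i)) * of_real (sqrt (v j / \<nu> j)))) * (\<phi> z * of_real ((e i (fst z))\<^sup>2 * (f j (snd z))\<^sup>2))"
          unfolding E\<xi>[OF ij(1)] F\<eta>[OF ij(2)] of_real_mult by (simp only: mult_ac)
        then show "(c i j * \<phi> z) * ((E i (fst z) * \<xi> (fst z)) * (F j (snd z) * \<eta> (snd z))) =
          (u i j / of_real (\<mu> i * \<nu> j)) * (\<phi> z * of_real ((e i (fst z))\<^sup>2 * (f j (snd z))\<^sup>2))"
          unfolding coef[OF ij] .
      qed
      finally show ?thesis .
    qed
    have int: "integrable (M1 \<Otimes>\<^sub>M M2) (\<lambda>z. \<phi> z * of_real ((e i (fst z))\<^sup>2 * (f j (snd z))\<^sup>2))"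
      if ij: "i \<in> I" "j \<in> J" for i j
      using kernel_form_integrable[OF \<phi>L2[OF L2_tensor[OF e[OF ij(1)] f[OF ij(2)]]] e[OF ij(1)] f[OF ij(2)]]
      by (simp add: power2_eq_square mult_ac)
    define g where "g i j z = (u i j / of_real (\<mu> i * \<nu> j)) * (\<phi> z * of_real ((e i (fst z))\<^sup>2 * (f j (snd z))\<^sup>2))" for i j z
    have g: "integrable (M1 \<Otimes>\<^sub>M M2) (g i j)" if "i \<in> I" "j \<in> J" for i j
      unfolding g_def by (intro integrable_mult_right int that)
    have "kernel_form (\<lambda>z. \<phi> z * k z) \<xi> \<eta> = (\<integral>z. (\<Sum>i\<in>I. \<Sum>j\<in>J. g i j z) \<partial>(M1 \<Otimes>\<^sub>M M2))"
      unfolding kernel_form_def pt g_def ..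
    also have "\<dots> = (\<Sum>i\<in>I. \<integral>z. (\<Sum>j\<in>J. g i j z) \<partial>(M1 \<Otimes>\<^sub>M M2))"
      by (intro Bochner_Integration.integral_sum Bochner_Integration.integrable_sum g)
    also have "\<dots> = (\<Sum>i\<in>I. \<Sum>j\<in>J. \<integral>z. g i j z \<partial>(M1 \<Otimes>\<^sub>M M2))"
      by (intro sum.cong refl Bochner_Integration.integral_sum g)
    also have "\<dots> = (\<Sum>i\<in>I. \<Sum>j\<in>J. u i j * m i j)"
      unfolding g_def integral_mult_right_zero m_def by simp
    finally show ?thesis .
  qed
  have "Re (\<Sum>i\<in>I. \<Sum>j\<in>J. u i j * m i j) \<le> cmod (kernel_form (\<lambda>z. \<phi> z * k z) \<xi> \<eta>)"
    unfolding eq by (rule complex_Re_le_cmod)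
  also have "\<dots> \<le> op_norm M1 M2 (integral_op M1 (\<lambda>z. \<phi> z * k z)) * L2_norm M1 \<xi> * L2_norm M2 \<eta>"
    by (intro kernel_form_le_op_norm \<phi>L2 k \<xi> \<eta>)
  also have "\<dots> \<le> (C * 2) * L2_norm M1 \<xi> * L2_norm M2 \<eta>"
    using schur[OF k] mult_left_mono[OF opk C] by (intro mult_right_mono) auto
  also have "\<dots> = C * (2 * L2_norm M1 \<xi> * L2_norm M2 \<eta>)" by simp
  also have "\<dots> \<le> C * ((L2_norm M1 \<xi>)\<^sup>2 + (L2_norm M2 \<eta>)\<^sup>2)"
    by (intro mult_left_mono C sum_squares_bound)
  also have "\<dots> = C * ((\<Sum>i\<in>I. w i) + (\<Sum>j\<in>J. v j))" unfolding n\<xi> n\<eta> ..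
  finally show ?thesis unfolding m_def .
qed

end

section \<open>Limits of Gram matrices\<close>

lemma diagonal_subsequence:
  fixes P :: "nat \<Rightarrow> (nat \<Rightarrow> nat) \<Rightarrow> bool"
  assumes ex: "\<And>n (s :: nat \<Rightarrow> nat). strict_mono s \<Longrightarrow> \<exists>r. strict_mono r \<and> P n (s \<circ> r)"
    and sub: "\<And>n s (r :: nat \<Rightarrow> nat). strict_mono r \<Longrightarrow> P n s \<Longrightarrow> P n (s \<circ> r)"
    and tail: "\<And>n s k. P n (s \<circ> (+) k) \<Longrightarrow> P n s"
  obtains \<sigma> where "strict_mono \<sigma>" "\<And>n. P n \<sigma>"
proof -
  interpret subseqs P by standard (rule ex)
  show ?thesis
  proof (rule that)
    show "strict_mono diagseq" by (rule subseq_diagseq)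
    show "P n diagseq" for n
      by (rule tail[of n diagseq "Suc n"], rule diagseq_holds) (rule sub)
  qed
qed

lemma bounded_family_convergent_subsequence:
  fixes g :: "nat \<Rightarrow> nat \<Rightarrow> complex"
  assumes bnd: "\<And>i n. cmod (g i n) \<le> b i"
  obtains \<sigma> where "strict_mono \<sigma>" "\<And>i. convergent (\<lambda>n. g i (\<sigma> n))"
proof (rule diagonal_subsequence[of "\<lambda>i s. convergent (\<lambda>n. g i (s n))"])
  fix n and s :: "nat \<Rightarrow> nat"
  have "bounded (range (\<lambda>m. g n (s m)))"
    by (rule boundedI[of _ "b n"]) (use bnd in auto)
  from bounded_imp_convergent_subsequence[OF this]
  show "\<exists>r. strict_mono r \<and> convergent (\<lambda>m. g n ((s \<circ> r) m))"
    by (auto simp: convergent_def o_def)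
next
  fix n and s r :: "nat \<Rightarrow> nat" assume "strict_mono r" "convergent (\<lambda>m. g n (s m))"
  then show "convergent (\<lambda>m. g n ((s \<circ> r) m))"
    using convergent_subseq_convergent[of "\<lambda>m. g n (s m)" r] by (simp add: o_def)
next
  fix n and s :: "nat \<Rightarrow> nat" and k assume "convergent (\<lambda>m. g n ((s \<circ> (+) k) m))"
  then have "convergent (\<lambda>m. g n (s (m + k)))" by (simp add: o_def add.commute)
  then obtain l where "(\<lambda>m. g n (s (m + k))) \<longlonglongrightarrow> l" by (auto simp: convergent_def)
  then have "(\<lambda>m. g n (s m)) \<longlonglongrightarrow> l" by (rule LIMSEQ_offset)
  then show "convergent (\<lambda>m. g n (s m))" by (auto simp: convergent_def)
next
  fix \<sigma> :: "nat \<Rightarrow> nat" assume "strict_mono \<sigma>" "\<And>n. convergent (\<lambda>m. g n (\<sigma> m))"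
  then show thesis by (rule that)
qed

text \<open>
  Positive semidefinite kernels on the natural numbers. The quadratic form is bounded below through its real
  part, which is why symmetry is a separate clause.
\<close>

definition pos_kernel :: "(nat \<Rightarrow> nat \<Rightarrow> complex) \<Rightarrow> bool" where
  "pos_kernel P \<longleftrightarrow> (\<forall>i j. P j i = cnj (P i j)) \<and>
     (\<forall>n c. 0 \<le> Re (\<Sum>i<n. \<Sum>j<n. c i * cnj (c j) * P i j))"

lemma pos_kernel_hermitian: "pos_kernel P \<Longrightarrow> P j i = cnj (P i j)"
  unfolding pos_kernel_def by blast

lemma pos_kernel_nonneg:
  "pos_kernel P \<Longrightarrow> 0 \<le> Re (\<Sum>i<n. \<Sum>j<n. c i * cnj (c j) * P i j)"
  unfolding pos_kernel_def by blast

text \<open>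
  The quadratic form after a change of one coefficient, from which squares are completed.
\<close>

lemma pos_kernel_form_add:
  fixes P :: "nat \<Rightarrow> nat \<Rightarrow> complex"
  assumes P: "\<And>i j. P j i = cnj (P i j)" and k: "k < n"
  shows "Re (\<Sum>i<n. \<Sum>j<n. (c i + (if i = k then t else 0)) * cnj (c j + (if j = k then t else 0)) * P i j)
    = Re (\<Sum>i<n. \<Sum>j<n. c i * cnj (c j) * P i j) + 2 * Re (cnj t * (\<Sum>i<n. c i * P i k)) + (cmod t)\<^sup>2 * Re (P k k)"
proof -
  define \<delta> where "\<delta> i = (if i = k then t else 0)" for i
  have gen: "Re (A + W + (cnj W + of_real a * p)) = Re A + 2 * Re W + a * Re p" for A W p :: complex and a :: real
    by simp
  have "(\<Sum>i<n. \<Sum>j<n. (c i + \<delta> i) * cnj (c j + \<delta> j) * P i j) =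
     (\<Sum>i<n. \<Sum>j<n. c i * cnj (c j) * P i j) + (\<Sum>i<n. \<Sum>j<n. c i * cnj (\<delta> j) * P i j)
     + ((\<Sum>i<n. \<Sum>j<n. \<delta> i * cnj (c j) * P i j) + (\<Sum>i<n. \<Sum>j<n. \<delta> i * cnj (\<delta> j) * P i j))"
    by (simp add: sum.distrib[symmetric] algebra_simps)
  also have "(\<Sum>i<n. \<Sum>j<n. c i * cnj (\<delta> j) * P i j) = (\<Sum>i<n. cnj t * (c i * P i k))"
  proof (rule sum.cong[OF refl])
    fix i
    have "(\<Sum>j<n. c i * cnj (\<delta> j) * P i j) = (\<Sum>j\<in>{k}. c i * cnj (\<delta> j) * P i j)"
      using k by (intro sum.mono_neutral_right) (auto simp: \<delta>_def)
    then show "(\<Sum>j<n. c i * cnj (\<delta> j) * P i j) = cnj t * (c i * P i k)" by (simp add: \<delta>_def)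
  qed
  also have "(\<Sum>i<n. \<Sum>j<n. \<delta> i * cnj (c j) * P i j) = (\<Sum>i\<in>{k}. \<Sum>j<n. \<delta> i * cnj (c j) * P i j)"
    using k by (intro sum.mono_neutral_right) (auto simp: \<delta>_def)
  also have "\<dots> = cnj (\<Sum>i<n. cnj t * (c i * P i k))"
    by (simp add: \<delta>_def mult_ac P[symmetric])
  also have "(\<Sum>i<n. \<Sum>j<n. \<delta> i * cnj (\<delta> j) * P i j) = (\<Sum>i\<in>{k}. \<Sum>j<n. \<delta> i * cnj (\<delta> j) * P i j)"
    using k by (intro sum.mono_neutral_right) (auto simp: \<delta>_def)
  also have "\<dots> = (\<Sum>j<n. \<delta> k * cnj (\<delta> j) * P k j)" by simp
  also have "\<dots> = (\<Sum>j\<in>{k}. \<delta> k * cnj (\<delta> j) * P k j)"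
    using k by (intro sum.mono_neutral_right) (auto simp: \<delta>_def)
  also have "\<dots> = of_real ((cmod t)\<^sup>2) * P k k"
    unfolding complex_norm_square by (simp add: \<delta>_def)
  finally have "(\<Sum>i<n. \<Sum>j<n. (c i + \<delta> i) * cnj (c j + \<delta> j) * P i j) =
     (\<Sum>i<n. \<Sum>j<n. c i * cnj (c j) * P i j) + cnj t * (\<Sum>i<n. c i * P i k)
     + (cnj (cnj t * (\<Sum>i<n. c i * P i k)) + of_real ((cmod t)\<^sup>2) * P k k)"
    unfolding sum_distrib_left .
  then show ?thesis
    unfolding \<delta>_def by (simp only: gen)
qed

lemma pos_kernel_diag:
  assumes "pos_kernel P"
  shows "0 \<le> Re (P k k)" "P k k = of_real (Re (P k k))"
proof -
  have P: "\<And>i j. P j i = cnj (P i j)" by (rule pos_kernel_hermitian[OF assms])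
  have "Im (P k k) = 0" using arg_cong[OF P[of k k], of Im] by simp
  then show "P k k = of_real (Re (P k k))" by (simp add: complex_eq_iff)
  have "0 \<le> Re (\<Sum>i<Suc k. \<Sum>j<Suc k. (0 + (if i = k then 1 else 0)) * cnj (0 + (if j = k then 1 else 0)) * P i j)"
    by (rule pos_kernel_nonneg[OF assms])
  then show "0 \<le> Re (P k k)"
    by (subst (asm) pos_kernel_form_add[OF P lessI]) simp
qed

text \<open>
  With a vanishing pivot the form is affine in the coefficient at \<open>k\<close>, so it is nonnegative only if the
  slope vanishes.
\<close>

lemma pos_kernel_zero_pivot:
  assumes pos: "pos_kernel P" and zero: "Re (P k k) = 0"
  shows "P i k = 0"
proof (rule ccontr)
  assume nz: "P i k \<noteq> 0"
  have P: "\<And>i j. P j i = cnj (P i j)" by (rule pos_kernel_hermitian[OF pos])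
  define n where "n = Suc (max i k)"
  have ik: "i < n" "k < n" by (auto simp: n_def)
  define s where "s = - of_real (Re (P i i) + 1) * P i k / of_real (2 * (cmod (P i k))\<^sup>2)"
  define c where "c j = (0::complex) + (if j = i then 1 else 0)" for j
  have "0 \<le> Re (\<Sum>a<n. \<Sum>b<n. (c a + (if a = k then s else 0)) * cnj (c b + (if b = k then s else 0)) * P a b)"
    by (rule pos_kernel_nonneg[OF pos])
  also have "\<dots> = Re (\<Sum>a<n. \<Sum>b<n. c a * cnj (c b) * P a b) + 2 * Re (cnj s * (\<Sum>a<n. c a * P a k))"
    using zero by (subst pos_kernel_form_add[OF P ik(2)]) simp
  also have "Re (\<Sum>a<n. \<Sum>b<n. c a * cnj (c b) * P a b) = Re (P i i)"
    unfolding c_def using zero by (subst pos_kernel_form_add[OF P ik(1)]) simp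
  also have "(\<Sum>a<n. c a * P a k) = (\<Sum>a\<in>{i}. c a * P a k)"
    using ik by (intro sum.mono_neutral_right) (auto simp: c_def)
  also have "\<dots> = P i k" by (simp add: c_def)
  also have "cnj s * P i k = - of_real (Re (P i i) + 1) * (P i k * cnj (P i k)) / of_real (2 * (cmod (P i k))\<^sup>2)"
    by (simp add: s_def mult_ac)
  also have "\<dots> = of_real (- (Re (P i i) + 1) / 2)"
    unfolding complex_norm_square[symmetric] using nz by simp
  finally show False by (simp add: field_simps)
qed

text \<open>
  One step of the Cholesky decomposition. The coefficient at \<open>k\<close> that minimizes the form of \<open>P\<close> produces the form of
  the difference. If the pivot is \<open>0\<close>, then \<open>L = 0\<close> by division by zero, which is the right value
  because the column of \<open>P\<close> vanishes.
\<close>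

lemma pos_kernel_schur_complement:
  fixes P :: "nat \<Rightarrow> nat \<Rightarrow> complex" and k :: nat
  assumes pos: "pos_kernel P"
  defines "L \<equiv> (\<lambda>i. P i k / of_real (sqrt (Re (P k k))))"
  shows "pos_kernel (\<lambda>i j. P i j - L i * cnj (L j))"
    and "P i k = L i * cnj (L k)" and "P k i = L k * cnj (L i)"
    and "(\<And>j. P a j = 0) \<Longrightarrow> L a = 0"
proof -
  have P: "\<And>i j. P j i = cnj (P i j)" by (rule pos_kernel_hermitian[OF pos])
  define p where "p = Re (P k k)"
  have p: "0 \<le> p" "P k k = of_real p" using pos_kernel_diag[OF pos] by (simp_all add: p_def)
  have LL: "L i * cnj (L j) = P i k * P k j / of_real p" for i j
  proof -
    have "complex_of_real (sqrt p) * of_real (sqrt p) = of_real p" using p by (simp flip: of_real_mult)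
    then show ?thesis unfolding L_def p_def[symmetric] using P[of j k] by simp
  qed
  have col: "P i k = L i * cnj (L k)" for i
    using pos_kernel_zero_pivot[OF pos, of k i] unfolding LL p(2) p_def[symmetric] by (cases "p = 0") auto
  show "P i k = L i * cnj (L k)" by (rule col)
  show "P k i = L k * cnj (L i)" by (simp only: P[of k i] col[of i] complex_cnj_mult complex_cnj_cnj mult.commute)
  show "(\<And>j. P a j = 0) \<Longrightarrow> L a = 0" by (simp add: L_def)
  show "pos_kernel (\<lambda>i j. P i j - L i * cnj (L j))"
    unfolding pos_kernel_def
  proof (intro conjI allI)
    fix i j show "P j i - L j * cnj (L i) = cnj (P i j - L i * cnj (L j))"
      using P[of i j] by simp
  next
    fix n and c :: "nat \<Rightarrow> complex"
    define d where "d i = (if i < n then c i else 0)" for i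
    define N where "N = max n (Suc k)"
    have kN: "k < N" by (simp add: N_def)
    define S where "S = (\<Sum>i<N. d i * P i k)"
    have ext1: "(\<Sum>i<n. f (c i) i) = (\<Sum>i<N. f (d i) i)" if "\<And>i. f 0 i = 0" for f :: "complex \<Rightarrow> nat \<Rightarrow> complex"
    proof -
      have "(\<Sum>i<n. f (c i) i) = (\<Sum>i<n. f (d i) i)" by (intro sum.cong) (auto simp: d_def)
      also have "\<dots> = (\<Sum>i<N. f (d i) i)"
        by (intro sum.mono_neutral_left) (auto simp: N_def d_def that)
      finally show ?thesis .
    qed
    have ext: "(\<Sum>i<n. \<Sum>j<n. c i * cnj (c j) * R i j) = (\<Sum>i<N. \<Sum>j<N. d i * cnj (d j) * R i j)"
      for R :: "nat \<Rightarrow> nat \<Rightarrow> complex"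
    proof -
      have "(\<Sum>i<n. \<Sum>j<n. c i * cnj (c j) * R i j) = (\<Sum>i<n. \<Sum>j<N. c i * cnj (d j) * R i j)"
        by (intro sum.cong refl ext1[where f="\<lambda>x j. _ * cnj x * R _ j"]) auto
      also have "\<dots> = (\<Sum>i<N. \<Sum>j<N. d i * cnj (d j) * R i j)"
        by (rule ext1[where f="\<lambda>x i. \<Sum>j<N. x * cnj (d j) * R i j"]) auto
      finally show ?thesis .
    qed
    have sq: "(\<Sum>i<N. \<Sum>j<N. d i * cnj (d j) * (L i * cnj (L j))) = of_real ((cmod (\<Sum>i<N. d i * L i))\<^sup>2)"
      unfolding complex_norm_square by (simp add: sum_product cnj_sum mult_ac)
    have split: "Re (\<Sum>i<n. \<Sum>j<n. c i * cnj (c j) * (P i j - L i * cnj (L j))) =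
        Re (\<Sum>i<N. \<Sum>j<N. d i * cnj (d j) * P i j) - (cmod (\<Sum>i<N. d i * L i))\<^sup>2"
      unfolding ext right_diff_distrib sum_subtractf sq by simp
    have SL: "(\<Sum>i<N. d i * L i) = S / of_real (sqrt p)"
      by (simp add: S_def L_def p_def sum_divide_distrib)
    have pos': "0 \<le> Re (\<Sum>i<N. \<Sum>j<N. e i * cnj (e j) * P i j)" for e
      by (rule pos_kernel_nonneg[OF pos])
    show "0 \<le> Re (\<Sum>i<n. \<Sum>j<n. c i * cnj (c j) * (P i j - L i * cnj (L j)))"
    proof (cases "p = 0")
      case True
      then show ?thesis unfolding split SL using pos'[of d] by simp
    next
      case False
      with p have p0: "0 < p" by simp
      have "0 \<le> Re (\<Sum>i<N. \<Sum>j<N. d i * cnj (d j) * P i j) + 2 * Re (cnj (- S / of_real p) * S) + (cmod (- S / of_real p))\<^sup>2 * p"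
        using pos'[of "\<lambda>i. d i + (if i = k then - S / of_real p else 0)"]
        unfolding pos_kernel_form_add[OF P kN] S_def[symmetric] p_def[symmetric] .
      also have "Re (cnj (- S / of_real p) * S) = - (cmod S)\<^sup>2 / p"
      proof -
        have "cnj (- S / of_real p) * S = - (S * cnj S) / of_real p" by simp
        also have "\<dots> = of_real (- (cmod S)\<^sup>2 / p)" unfolding complex_norm_square[symmetric] by simp
        finally show ?thesis by (simp only: Re_complex_of_real)
      qed
      also have "(cmod (- S / of_real p))\<^sup>2 * p = (cmod S)\<^sup>2 / p"
        using p0 by (simp add: norm_divide power_divide power2_eq_square)
      finally have "0 \<le> Re (\<Sum>i<N. \<Sum>j<N. d i * cnj (d j) * P i j) - (cmod S)\<^sup>2 / p" by simp
      moreover have "(cmod (S / of_real (sqrt p)))\<^sup>2 = (cmod S)\<^sup>2 / p"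
        using p0 by (simp add: norm_divide power_divide)
      ultimately show ?thesis unfolding split SL by simp
    qed
  qed
qed

text \<open>
  The first \<open>k\<close> steps clear the first \<open>k\<close> rows and columns, so each entry is settled after finitely many steps.
\<close>

lemma pos_kernel_Cholesky:
  assumes pos: "pos_kernel P"
  obtains L where "\<And>i k. i < k \<Longrightarrow> L i k = 0" "\<And>i j. P i j = (\<Sum>k\<le>i. L i k * cnj (L j k))"
proof -
  define piv where "piv R k i = R i k / of_real (sqrt (Re (R k k)))" for R :: "nat \<Rightarrow> nat \<Rightarrow> complex" and k i
  define R where "R = rec_nat P (\<lambda>k R i j. R i j - piv R k i * cnj (piv R k j))"
  have R0: "R 0 = P" and RS: "R (Suc k) = (\<lambda>i j. R k i j - piv (R k) k i * cnj (piv (R k) k j))" for k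
    by (simp_all add: R_def)
  have Rpos: "pos_kernel (R k)" for k
    by (induction k) (use pos pos_kernel_schur_complement(1) in \<open>auto simp: R0 RS piv_def\<close>)
  have Rzero: "R k i j = 0 \<and> R k j i = 0" if "i < k" for k i j
    using that
  proof (induction k arbitrary: i j)
    case (Suc k)
    show ?case
    proof (cases "i = k")
      case True
      show ?thesis unfolding RS True
        using pos_kernel_schur_complement(2,3)[OF Rpos[of k], where i=j and k=k, folded piv_def] by simp
    next
      case False
      with Suc have "i < k" by simp
      note IH = Suc.IH[OF this]
      have "piv (R k) k i = 0" using IH by (simp add: piv_def)
      then show ?thesis unfolding RS using IH by simp
    qed
  qed simp
  define L where "L i k = piv (R k) k i" for i k
  have sum: "P i j = (\<Sum>l<k. L i l * cnj (L j l)) + R k i j" for i j k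
    by (induction k) (simp_all add: R0 RS L_def)
  show ?thesis
  proof (rule that[of L])
    show "L i k = 0" if "i < k" for i k using Rzero[OF that] by (simp add: L_def piv_def)
    show "P i j = (\<Sum>k\<le>i. L i k * cnj (L j k))" for i j
      using sum[of i j "Suc i"] Rzero[of i "Suc i" j] by (simp add: lessThan_Suc_atMost)
  qed
qed

text \<open>
  The entries of the Gram matrices are bounded, so a diagonal sequence makes all of them converge, and
  limits of Gram matrices are positive semidefinite. The Cholesky decomposition realizes the limit by finitely supported
  vectors, of which all sums below are finite.
\<close>

lemma gram_subsequence:
  fixes v :: "nat \<Rightarrow> 'i::countable \<Rightarrow> nat \<Rightarrow> complex" and r :: "nat \<Rightarrow> nat"
  assumes bnd: "\<And>n i. (\<Sum>k<r n. (cmod (v n i k))\<^sup>2) \<le> B i"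
  obtains \<sigma> L where "strict_mono \<sigma>" "\<And>i k. to_nat i < k \<Longrightarrow> L i k = 0"
    "\<And>i j. (\<lambda>n. \<Sum>k<r (\<sigma> n). v (\<sigma> n) i k * cnj (v (\<sigma> n) j k)) \<longlonglongrightarrow> (\<Sum>k\<le>to_nat i. L i k * cnj (L j k))"
proof -
  define G where "G i j n = (\<Sum>k<r n. v n i k * cnj (v n j k))" for i j n
  have Gb: "cmod (G i j n) \<le> B i + B j" for i j n
  proof -
    have "cmod (G i j n) \<le> (\<Sum>k<r n. cmod (v n i k * cnj (v n j k)))"
      unfolding G_def by (rule norm_sum)
    also have "\<dots> \<le> (\<Sum>k<r n. (cmod (v n i k))\<^sup>2 + (cmod (v n j k))\<^sup>2)"
    proof (rule sum_mono)
      fix k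
      have "2 * cmod (v n i k) * cmod (v n j k) \<le> (cmod (v n i k))\<^sup>2 + (cmod (v n j k))\<^sup>2"
        by (rule sum_squares_bound)
      moreover have "0 \<le> cmod (v n i k) * cmod (v n j k)" by simp
      ultimately have "cmod (v n i k) * cmod (v n j k) \<le> (cmod (v n i k))\<^sup>2 + (cmod (v n j k))\<^sup>2"
        by linarith
      then show "cmod (v n i k * cnj (v n j k)) \<le> (cmod (v n i k))\<^sup>2 + (cmod (v n j k))\<^sup>2"
        by (simp add: norm_mult)
    qed
    also have "\<dots> \<le> B i + B j" unfolding sum.distrib by (intro add_mono bnd)
    finally show ?thesis .
  qed
  obtain \<sigma> where \<sigma>: "strict_mono \<sigma>"
    and conv: "\<And>p. convergent (\<lambda>n. case (from_nat p :: 'i \<times> 'i) of (i, j) \<Rightarrow> G i j (\<sigma> n))"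
    by (rule bounded_family_convergent_subsequence[of "\<lambda>p n. case (from_nat p :: 'i \<times> 'i) of (i, j) \<Rightarrow> G i j n"
            "\<lambda>p. case (from_nat p :: 'i \<times> 'i) of (i, j) \<Rightarrow> B i + B j"]) (auto split: prod.splits intro: Gb)
  have conv': "convergent (\<lambda>n. G i j (\<sigma> n))" for i j using conv[of "to_nat (i, j)"] by simp
  define g where "g i j = lim (\<lambda>n. G i j (\<sigma> n))" for i j
  have g: "(\<lambda>n. G i j (\<sigma> n)) \<longlonglongrightarrow> g i j" for i j
    using conv' by (simp add: g_def convergent_LIMSEQ_iff)
  have "pos_kernel (\<lambda>a b. g (from_nat a) (from_nat b))"
    unfolding pos_kernel_def
  proof (intro conjI allI)
    fix a b
    have "(\<lambda>n. cnj (G i j (\<sigma> n))) \<longlonglongrightarrow> cnj (g i j)" for i j by (intro tendsto_cnj g)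
    moreover have "cnj (G i j n) = G j i n" for i j n by (simp add: G_def mult.commute)
    ultimately have "(\<lambda>n. G j i (\<sigma> n)) \<longlonglongrightarrow> cnj (g i j)" for i j by simp
    then show "g (from_nat b) (from_nat a) = cnj (g (from_nat a) (from_nat b))"
      using g LIMSEQ_unique by blast
  next
    fix N and c :: "nat \<Rightarrow> complex"
    have lim: "(\<lambda>n. Re (\<Sum>i<N. \<Sum>j<N. c i * cnj (c j) * G (from_nat i) (from_nat j) (\<sigma> n)))
       \<longlonglongrightarrow> Re (\<Sum>i<N. \<Sum>j<N. c i * cnj (c j) * g (from_nat i) (from_nat j))"
      by (intro tendsto_intros g)
    have "0 \<le> Re (\<Sum>i<N. \<Sum>j<N. c i * cnj (c j) * G (from_nat i) (from_nat j) n)" for n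
    proof -
      have "(\<Sum>i<N. \<Sum>j<N. c i * cnj (c j) * G (from_nat i) (from_nat j) n) =
        (\<Sum>k<r n. \<Sum>i<N. \<Sum>j<N. (c i * v n (from_nat i) k) * cnj (c j * v n (from_nat j) k))"
      proof -
        have "(\<Sum>i<N. \<Sum>j<N. c i * cnj (c j) * G (from_nat i) (from_nat j) n) =
          (\<Sum>i<N. \<Sum>j<N. \<Sum>k<r n. (c i * v n (from_nat i) k) * cnj (c j * v n (from_nat j) k))"
          unfolding G_def sum_distrib_left by (intro sum.cong refl) (simp add: mult_ac)
        also have "\<dots> = (\<Sum>i<N. \<Sum>k<r n. \<Sum>j<N. (c i * v n (from_nat i) k) * cnj (c j * v n (from_nat j) k))"
          by (intro sum.cong refl sum.swap)
        also have "\<dots> = (\<Sum>k<r n. \<Sum>i<N. \<Sum>j<N. (c i * v n (from_nat i) k) * cnj (c j * v n (from_nat j) k))"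
          by (rule sum.swap)
        finally show ?thesis .
      qed
      also have "\<dots> = (\<Sum>k<r n. of_real ((cmod (\<Sum>i<N. c i * v n (from_nat i) k))\<^sup>2))"
        unfolding complex_norm_square by (simp add: sum_product cnj_sum)
      finally show ?thesis by (simp add: sum_nonneg)
    qed
    then show "0 \<le> Re (\<Sum>i<N. \<Sum>j<N. c i * cnj (c j) * g (from_nat i) (from_nat j))"
      by (intro LIMSEQ_le_const[OF lim]) auto
  qed
  then obtain L where L0: "\<And>i k. i < k \<Longrightarrow> L i k = 0"
    and L: "\<And>a b. g (from_nat a) (from_nat b) = (\<Sum>k\<le>a. L a k * cnj (L b k))"
    by (rule pos_kernel_Cholesky) blast
  show ?thesis
  proof (rule that[of \<sigma> "\<lambda>i. L (to_nat i)"])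
    fix i j :: 'i
    show "(\<lambda>n. \<Sum>k<r (\<sigma> n). v (\<sigma> n) i k * cnj (v (\<sigma> n) j k)) \<longlonglongrightarrow> (\<Sum>k\<le>to_nat i. L (to_nat i) k * cnj (L (to_nat j) k))"
      using g[of i j] L[of "to_nat i" "to_nat j"] by (simp add: G_def)
  qed (use \<sigma> L0 in auto)
qed

section \<open>Densities of square summable set functions\<close>

text \<open>
  The sum of the absolute steps has finite integral, so it is finite almost everywhere.
\<close>

lemma AE_convergent_of_summable_L1_steps:
  fixes u :: "nat \<Rightarrow> 'a \<Rightarrow> complex"
  assumes int: "\<And>j. integrable M (u j)" and b: "summable b"
    and le: "\<And>j. (\<integral>x. cmod (u (Suc j) x - u j x) \<partial>M) \<le> b j"
  shows "AE x in M. convergent (\<lambda>j. u j x)"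
proof -
  note [measurable] = borel_measurable_integrable[OF int]
  have b0: "0 \<le> b j" for j
    by (rule order_trans[OF _ le]) simp
  have intd: "integrable M (\<lambda>x. u (Suc j) x - u j x)" for j using int by simp
  have "(\<integral>\<^sup>+x. (\<Sum>j. ennreal (cmod (u (Suc j) x - u j x))) \<partial>M) = (\<Sum>j. \<integral>\<^sup>+x. ennreal (cmod (u (Suc j) x - u j x)) \<partial>M)"
    by (rule nn_integral_suminf) measurable
  also have "\<dots> \<le> (\<Sum>j. ennreal (b j))"
  proof (rule suminf_le)
    fix j
    have "(\<integral>\<^sup>+x. ennreal (cmod (u (Suc j) x - u j x)) \<partial>M) = ennreal (\<integral>x. cmod (u (Suc j) x - u j x) \<partial>M)"
      by (intro nn_integral_eq_integral integrable_norm intd) simp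
    then show "(\<integral>\<^sup>+x. ennreal (cmod (u (Suc j) x - u j x)) \<partial>M) \<le> ennreal (b j)"
      using le[of j] by (simp add: ennreal_leI)
  qed auto
  also have "\<dots> = ennreal (\<Sum>j. b j)" by (intro suminf_ennreal2 b0 b)
  also have "\<dots> < \<infinity>" by simp
  finally have "AE x in M. (\<Sum>j. ennreal (cmod (u (Suc j) x - u j x))) \<noteq> \<infinity>"
    by (intro nn_integral_PInf_AE) auto
  then show ?thesis
  proof eventually_elim
    case (elim x)
    then have "summable (\<lambda>j. cmod (u (Suc j) x - u j x))"
      by (intro summable_suminf_not_top) auto
    then have "summable (\<lambda>j. u (Suc j) x - u j x)" by (rule summable_norm_cancel)
    then have "convergent (\<lambda>n. u 0 x + (\<Sum>j<n. u (Suc j) x - u j x))"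
      by (intro convergent_add convergent_const) (simp add: summable_iff_convergent)
    then show ?case by (simp add: sum_lessThan_telescope[of "\<lambda>j. u j x"])
  qed
qed

lemma L1_Cauchy_AE_convergent_subsequence:
  fixes u :: "nat \<Rightarrow> 'a \<Rightarrow> complex"
  assumes int: "\<And>j. integrable M (u j)"
    and cau: "\<And>e. 0 < e \<Longrightarrow> \<exists>N. \<forall>m\<ge>N. \<forall>n\<ge>N. (\<integral>x. cmod (u m x - u n x) \<partial>M) < e"
  obtains r :: "nat \<Rightarrow> nat" where "strict_mono r" "AE x in M. convergent (\<lambda>j. u (r j) x)"
proof -
  have "\<forall>j. \<exists>N. \<forall>m\<ge>N. \<forall>n\<ge>N. (\<integral>x. cmod (u m x - u n x) \<partial>M) < (1/2) ^ j"
    by (intro allI cau) simp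
  then obtain N where N: "\<And>j m n. N j \<le> m \<Longrightarrow> N j \<le> n \<Longrightarrow> (\<integral>x. cmod (u m x - u n x) \<partial>M) < (1/2) ^ j"
    by metis
  define r where "r j = (\<Sum>i\<le>j. Suc (N i))" for j
  have r: "strict_mono r" unfolding strict_mono_Suc_iff by (simp add: r_def)
  have rN: "N j \<le> r j" for j
    unfolding r_def by (rule order_trans[OF _ member_le_sum[of j]]) auto
  have "AE x in M. convergent (\<lambda>j. u (r j) x)"
  proof (rule AE_convergent_of_summable_L1_steps[OF int])
    show "summable (\<lambda>j. (1/2::real) ^ j)" by (intro summable_geometric) simp
    fix j
    have "N j \<le> r (Suc j)" using rN[of j] strict_monoD[OF r, of j "Suc j"] by simp
    then show "(\<integral>x. cmod (u (r (Suc j)) x - u (r j) x) \<partial>M) \<le> (1/2) ^ j"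
      using N[of j "r (Suc j)" "r j"] rN[of j] by simp
  qed
  then show ?thesis using that r by blast
qed

text \<open>
  The first \<open>n\<close> membership bits of \<open>x\<close>, read as a binary number. Coarsening the partition into the level sets
  of the code is reduction modulo a power of two (\<open>code_mod\<close>), so all the partitions are indexed by natural numbers.
\<close>

definition code :: "(nat \<Rightarrow> 'a set) \<Rightarrow> nat \<Rightarrow> 'a \<Rightarrow> nat" where
  "code G n x = (\<Sum>i<n. if x \<in> G i then 2 ^ i else 0)"

lemma code_less: "code G n x < 2 ^ n"
  by (induction n) (auto simp: code_def)

lemma code_mod: "l \<le> n \<Longrightarrow> code G n x mod 2 ^ l = code G l x"
proof (induction n)
  case (Suc n)
  show ?case
  proof (cases "l = Suc n")
    case True
    then show ?thesis using code_less[of G "Suc n" x] by simp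
  next
    case False
    with Suc.prems have l: "l \<le> n" by simp
    have d: "(2::nat) ^ l dvd (if x \<in> G n then 2 ^ n else 0)" using l by (auto intro: le_imp_power_dvd)
    have "code G (Suc n) x mod 2 ^ l = (code G n x + (if x \<in> G n then 2 ^ n else 0)) mod 2 ^ l"
      by (simp add: code_def)
    also have "\<dots> = code G n x mod 2 ^ l"
      using d by (metis add.right_neutral mod_add_right_eq mod_eq_0_iff_dvd)
    finally show ?thesis using Suc.IH[OF l] by simp
  qed
qed (simp add: code_def)

definition atom :: "'a measure \<Rightarrow> (nat \<Rightarrow> 'a set) \<Rightarrow> nat \<Rightarrow> nat \<Rightarrow> 'a set" where
  "atom M G n s = {x \<in> space M. code G n x = s}"

lemma measurable_code:
  assumes "\<And>i. G i \<in> sets M"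
  shows "code G n \<in> measurable M (count_space UNIV)"
proof (induction n)
  case (Suc n)
  note [measurable] = Suc assms
  have "code G (Suc n) = (\<lambda>x. code G n x + (if x \<in> G n then 2 ^ n else 0))"
    by (simp add: code_def fun_eq_iff)
  then show ?case by simp
qed (simp add: code_def[abs_def])

lemma atom_sets:
  assumes "\<And>i. G i \<in> sets M"
  shows "atom M G n s \<in> sets M"
proof -
  note [measurable] = measurable_code[where G=G and n=n and M=M, OF assms]
  show ?thesis unfolding atom_def by measurable
qed

lemma indicator_atom_split:
  assumes l: "l \<le> n" and x: "x \<in> space M"
  shows "(indicator (atom M G l s) x :: 'b::semiring_1) =
    (\<Sum>s' | s' < 2 ^ n \<and> s' mod 2 ^ l = s. indicator (atom M G n s') x)"
proof (cases "code G l x = s")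
  case True
  then have "code G n x \<in> {s'. s' < 2 ^ n \<and> s' mod 2 ^ l = s}" using code_less code_mod[OF l] by auto
  then have "(\<Sum>s' | s' < 2 ^ n \<and> s' mod 2 ^ l = s. (indicator (atom M G n s') x :: 'b)) =
     (\<Sum>s' \<in> {code G n x}. indicator (atom M G n s') x)"
    by (intro sum.mono_neutral_right) (auto simp: atom_def)
  then show ?thesis using x True by (simp add: atom_def)
next
  case False
  then have "(\<Sum>s' | s' < 2 ^ n \<and> s' mod 2 ^ l = s. (indicator (atom M G n s') x :: 'b)) = 0"
    using code_mod[OF l, of G x] by (intro sum.neutral) (auto simp: atom_def indicator_def)
  then show ?thesis using False by (simp add: atom_def)
qed

lemma (in finite_measure) integral_indicator_complex:
  assumes "A \<in> sets M"
  shows "integrable M (\<lambda>x. indicator A x :: complex)"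
    and "(\<integral>x. indicator A x \<partial>M) = complex_of_real (measure M A)"
proof -
  have "has_bochner_integral M (\<lambda>x. indicator A x *\<^sub>R (1::complex)) (measure M A *\<^sub>R 1)"
    using assms by (intro has_bochner_integral_indicator) (simp_all add: less_top[symmetric])
  moreover have "(\<lambda>x. indicator A x *\<^sub>R (1::complex)) = indicator A"
    by (auto simp: fun_eq_iff indicator_def)
  ultimately have "has_bochner_integral M (\<lambda>x. indicator A x :: complex) (of_real (measure M A))"
    by (simp add: scaleR_conv_of_real)
  then show "integrable M (\<lambda>x. indicator A x :: complex)"
    and "(\<integral>x. indicator A x \<partial>M) = complex_of_real (measure M A)"
    by (simp_all add: has_bochner_integral_iff)
qed

lemma (in finite_measure) code_integrable:
  fixes F :: "nat \<Rightarrow> 'b::{banach, second_countable_topology}"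
  assumes G: "\<And>i. G i \<in> sets M"
  shows "integrable M (\<lambda>x. F (code G n x))"
proof (rule integrable_const_bound)
  show "AE x in M. norm (F (code G n x)) \<le> Max ((\<lambda>s. norm (F s)) ` {..<2 ^ n})"
    by (rule AE_I2, rule Max_ge) (auto simp: code_less)
  show "(\<lambda>x. F (code G n x)) \<in> borel_measurable M"
    by (rule measurable_compose[OF measurable_code[OF G]]) simp
qed

lemma (in finite_measure) code_integral_atom:
  fixes F :: "nat \<Rightarrow> complex"
  assumes G: "\<And>i. G i \<in> sets M" and l: "l \<le> n"
  shows "(\<integral>x. F (code G n x) * indicator (atom M G l s) x \<partial>M) =
    (\<Sum>s' | s' < 2 ^ n \<and> s' mod 2 ^ l = s. F s' * of_real (measure M (atom M G n s')))"
proof -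
  have "(\<integral>x. F (code G n x) * indicator (atom M G l s) x \<partial>M) =
    (\<integral>x. (\<Sum>s' | s' < 2 ^ n \<and> s' mod 2 ^ l = s. F s' * indicator (atom M G n s') x) \<partial>M)"
  proof (rule Bochner_Integration.integral_cong[OF refl])
    fix x assume x: "x \<in> space M"
    have "F (code G n x) * indicator (atom M G l s) x =
      (\<Sum>s' | s' < 2 ^ n \<and> s' mod 2 ^ l = s. F (code G n x) * indicator (atom M G n s') x)"
      unfolding indicator_atom_split[OF l x] sum_distrib_left ..
    also have "\<dots> = (\<Sum>s' | s' < 2 ^ n \<and> s' mod 2 ^ l = s. F s' * indicator (atom M G n s') x)"
      by (intro sum.cong refl) (auto simp: atom_def indicator_def)
    finally show "F (code G n x) * indicator (atom M G l s) x =
      (\<Sum>s' | s' < 2 ^ n \<and> s' mod 2 ^ l = s. F s' * indicator (atom M G n s') x)" .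
  qed
  also have "\<dots> = (\<Sum>s' | s' < 2 ^ n \<and> s' mod 2 ^ l = s. \<integral>x. F s' * indicator (atom M G n s') x \<partial>M)"
    by (intro Bochner_Integration.integral_sum integrable_mult_right integral_indicator_complex atom_sets G)
  also have "\<dots> = (\<Sum>s' | s' < 2 ^ n \<and> s' mod 2 ^ l = s. F s' * of_real (measure M (atom M G n s')))"
  proof (intro sum.cong refl)
    fix s'
    show "(\<integral>x. F s' * indicator (atom M G n s') x \<partial>M) = F s' * of_real (measure M (atom M G n s'))"
      unfolding integral_mult_right_zero integral_indicator_complex(2)[OF atom_sets[OF G]] ..
  qed
  finally show ?thesis .
qed

text \<open>
  The quotients of \<open>t\<close> by the measure, taken on the cells of level \<open>n\<close>, form a martingale. By orthogonality of its
  increments the squared norms increase in \<open>n\<close>, and the squared distance of two members is the difference of their squared norms.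
  As these are bounded, the martingale is Cauchy in \<open>L\<^sup>2\<close> and so in \<open>L\<^sup>1\<close>, and a diagonal sequence makes all
  coordinates converge almost everywhere. The limit inherits the bound \<open>C\<close> from the quotients,
  and dominated convergence identifies its integrals over the cells.
\<close>

lemma (in finite_measure) ell2_density:
  fixes t :: "nat \<Rightarrow> nat \<Rightarrow> nat \<Rightarrow> complex"
  assumes G: "\<And>i. G i \<in> sets M" and C: "0 \<le> C"
    and add: "\<And>l n s k. l \<le> n \<Longrightarrow> s < 2 ^ l \<Longrightarrow> t l s k = (\<Sum>s' | s' < 2 ^ n \<and> s' mod 2 ^ l = s. t n s' k)"
    and bnd: "\<And>n s K. s < 2 ^ n \<Longrightarrow> (\<Sum>k<K. (cmod (t n s k))\<^sup>2) \<le> C * (measure M (atom M G n s))\<^sup>2"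
  obtains a :: "nat \<Rightarrow> 'a \<Rightarrow> complex" where "\<And>k. a k \<in> borel_measurable M"
    "\<And>x K. (\<Sum>k<K. (cmod (a k x))\<^sup>2) \<le> C"
    "\<And>l s k. s < 2 ^ l \<Longrightarrow> (\<integral>x. a k x * indicator (atom M G l s) x \<partial>M) = t l s k"
proof -
  define m where "m n s = measure M (atom M G n s)" for n s
  define \<alpha> where "\<alpha> n k s = t n s k / of_real (m n s)" for n k s
  define A where "A n k x = \<alpha> n k (code G n x)" for n k x
  have \<alpha>m: "\<alpha> n k s * of_real (m n s) = t n s k" if "s < 2 ^ n" for n k s
  proof (cases "m n s = 0")
    case True
    have "(cmod (t n s k))\<^sup>2 \<le> (\<Sum>k<Suc k. (cmod (t n s k))\<^sup>2)"
      by (rule member_le_sum) auto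
    also have "\<dots> \<le> 0" using bnd[OF that, of "Suc k"] True by (simp only: m_def) simp
    finally show ?thesis using True by simp
  qed (simp add: \<alpha>_def)
  have Abnd: "(\<Sum>k<K. (cmod (A n k x))\<^sup>2) \<le> C" for n K x
  proof -
    define s where "s = code G n x"
    have s: "s < 2 ^ n" by (simp add: s_def code_less)
    show ?thesis
    proof (cases "m n s = 0")
      case True
      then show ?thesis using C by (simp add: A_def \<alpha>_def s_def)
    next
      case False
      then have "0 < (m n s)\<^sup>2" by simp
      have "(\<Sum>k<K. (cmod (A n k x))\<^sup>2) = (\<Sum>k<K. (cmod (t n s k))\<^sup>2) / (m n s)\<^sup>2"
        by (simp add: A_def \<alpha>_def s_def norm_divide power_divide sum_divide_distrib)
      also have "\<dots> \<le> C" using bnd[OF s, of K] \<open>0 < (m n s)\<^sup>2\<close>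
        by (simp add: pos_divide_le_eq m_def)
      finally show ?thesis .
    qed
  qed
  have Asq: "(cmod (A n k x))\<^sup>2 \<le> C" for n k x
    using Abnd[of n x "Suc k"] member_le_sum[of k "{..<Suc k}" "\<lambda>k. (cmod (A n k x))\<^sup>2"] by simp
  have Ac: "cmod (A n k x) \<le> sqrt C" for n k x
    using Asq by (simp add: real_le_rsqrt)
  have Am[measurable]: "A n k \<in> borel_measurable M" for n k
    unfolding A_def[abs_def] by (rule borel_measurable_integrable[OF code_integrable[OF G]])
  have Aint: "integrable M (A n k)" for n k
    unfolding A_def[abs_def] by (rule code_integrable[OF G])
  have AL2: "A n k \<in> L2_functions M" for n k
  proof (rule L2_functionsI)
    show "integrable M (\<lambda>x. (cmod (A n k x))\<^sup>2)"
      by (rule integrable_const_bound[where B=C]) (simp_all add: Asq)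
  qed simp
  have Aatom: "(\<integral>x. A n k x * indicator (atom M G l s) x \<partial>M) = t l s k" if "l \<le> n" "s < 2 ^ l" for n k l s
  proof -
    have "(\<integral>x. A n k x * indicator (atom M G l s) x \<partial>M) = (\<Sum>s' | s' < 2 ^ n \<and> s' mod 2 ^ l = s. \<alpha> n k s' * of_real (m n s'))"
      unfolding A_def m_def by (rule code_integral_atom[OF G that(1)])
    also have "\<dots> = (\<Sum>s' | s' < 2 ^ n \<and> s' mod 2 ^ l = s. t n s' k)"
      by (intro sum.cong refl \<alpha>m) simp
    finally show ?thesis using add[OF that] by simp
  qed
  have Aorth: "(\<integral>x. A n k x * cnj (A l k x) \<partial>M) = (\<Sum>s<2 ^ l. cnj (\<alpha> l k s) * t l s k)" if l: "l \<le> n" for n k l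
  proof -
    have "(\<integral>x. A n k x * cnj (A l k x) \<partial>M) = (\<integral>x. (\<Sum>s<2 ^ l. cnj (\<alpha> l k s) * (A n k x * indicator (atom M G l s) x)) \<partial>M)"
    proof (rule Bochner_Integration.integral_cong[OF refl])
      fix x assume x: "x \<in> space M"
      have "(\<Sum>s<2 ^ l. cnj (\<alpha> l k s) * (A n k x * indicator (atom M G l s) x)) =
          (\<Sum>s\<in>{code G l x}. cnj (\<alpha> l k s) * (A n k x * indicator (atom M G l s) x))"
        by (intro sum.mono_neutral_right) (auto simp: code_less atom_def)
      then show "A n k x * cnj (A l k x) = (\<Sum>s<2 ^ l. cnj (\<alpha> l k s) * (A n k x * indicator (atom M G l s) x))"
        using x by (simp add: atom_def A_def)
    qed
    also have "\<dots> = (\<Sum>s<2 ^ l. \<integral>x. cnj (\<alpha> l k s) * (A n k x * indicator (atom M G l s) x) \<partial>M)"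
    proof (intro Bochner_Integration.integral_sum integrable_mult_right)
      fix s
      show "integrable M (\<lambda>x. A n k x * indicator (atom M G l s) x)"
        using atom_sets[of G M l s, OF G]
        by (intro Bochner_Integration.integrable_bound[OF Aint[of n k]]) (auto simp: indicator_def)
    qed
    also have "\<dots> = (\<Sum>s<2 ^ l. cnj (\<alpha> l k s) * t l s k)"
      unfolding integral_mult_right_zero by (intro sum.cong refl) (simp add: Aatom l)
    finally show ?thesis .
  qed
  define E where "E n k = (\<integral>x. (cmod (A n k x))\<^sup>2 \<partial>M)" for n k
  have prod_int: "integrable M (\<lambda>x. A n k x * cnj (A l k x))" for n k l
    using AL2 L2_cnj by (intro L2_product_integrable) auto
  have AE_: "(\<integral>x. A n k x * cnj (A l k x) \<partial>M) = of_real (E l k)" if "l \<le> n" for n k l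
  proof -
    have "(\<integral>x. A n k x * cnj (A l k x) \<partial>M) = (\<integral>x. A l k x * cnj (A l k x) \<partial>M)"
      unfolding Aorth[OF that] Aorth[OF order_refl] ..
    also have "\<dots> = of_real (E l k)"
      unfolding E_def complex_norm_square[symmetric] by (simp del: of_real_power)
    finally show ?thesis .
  qed
  have AE_': "(\<integral>x. A l k x * cnj (A n k x) \<partial>M) = of_real (E l k)" if "l \<le> n" for n k l
  proof -
    have "(\<lambda>x. A l k x * cnj (A n k x)) = (\<lambda>x. cnj (A n k x * cnj (A l k x)))"
      by (simp add: fun_eq_iff)
    then show ?thesis by (simp only: Bochner_Integration.integral_cnj AE_[OF that] complex_cnj_complex_of_real)
  qed
  have diff: "(\<integral>x. (cmod (A n k x - A l k x))\<^sup>2 \<partial>M) = E n k - E l k" if "l \<le> n" for n l k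
  proof -
    have "of_real (\<integral>x. (cmod (A n k x - A l k x))\<^sup>2 \<partial>M) =
       (\<integral>x. complex_of_real ((cmod (A n k x - A l k x))\<^sup>2) \<partial>M)"
      by (simp del: of_real_power)
    also have "\<dots> = (\<integral>x. (A n k x * cnj (A n k x) - A n k x * cnj (A l k x)) - (A l k x * cnj (A n k x) - A l k x * cnj (A l k x)) \<partial>M)"
      unfolding complex_norm_square by (simp add: algebra_simps)
    also have "\<dots> = (of_real (E n k) - of_real (E l k)) - (of_real (E l k) - of_real (E l k))"
      using prod_int AE_[OF that] AE_'[OF that] AE_[OF order_refl]
      by (simp add: Bochner_Integration.integral_diff Bochner_Integration.integrable_diff)
    also have "\<dots> = of_real (E n k - E l k)" by simp
    finally show ?thesis by (simp only: of_real_eq_iff)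
  qed
  have Einc: "incseq (\<lambda>n. E n k)" for k
  proof (rule incseq_SucI)
    fix n
    have "0 \<le> (\<integral>x. (cmod (A (Suc n) k x - A n k x))\<^sup>2 \<partial>M)" by simp
    then show "E n k \<le> E (Suc n) k" using diff[of n "Suc n" k] by simp
  qed
  have Ebnd: "E n k \<le> C * measure M (space M)" for n k
  proof -
    have "E n k \<le> (\<integral>x. C \<partial>M)"
      unfolding E_def using Asq by (intro integral_mono L2_integrable AL2) auto
    then show ?thesis by (simp add: mult.commute)
  qed
  have Econv: "convergent (\<lambda>n. E n k)" for k
    by (rule incseq_convergent[OF Einc, of k "C * measure M (space M)"])
      (use Ebnd in \<open>auto simp: convergent_def\<close>)
  have L1: "(\<integral>x. cmod (A n k x - A l k x) \<partial>M) \<le> sqrt \<bar>E n k - E l k\<bar> * sqrt (measure M (space M))" for n l k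
  proof -
    have D: "(\<lambda>x. A n k x - A l k x) \<in> L2_functions M"
      using L2_add[OF AL2[of n k] L2_scale[OF AL2[of l k], of "-1"]] by simp
    have one: "(\<lambda>_. 1) \<in> L2_functions M" by (simp add: L2_functions_def)
    have "(\<integral>x. (cmod (A n k x - A l k x))\<^sup>2 \<partial>M) = \<bar>E n k - E l k\<bar>"
    proof (cases "l \<le> n")
      case True
      then show ?thesis using diff[OF True, of k] incseqD[OF Einc True, of k] by simp
    next
      case False
      then have "n \<le> l" by simp
      then show ?thesis using diff[OF \<open>n \<le> l\<close>, of k] incseqD[OF Einc \<open>n \<le> l\<close>, of k] by (simp add: norm_minus_commute)
    qed
    then show ?thesis using L2_Cauchy_Schwarz_norm[OF D one] by (simp add: L2_norm_def)
  qed
  have cau: "\<exists>N. \<forall>m\<ge>N. \<forall>n\<ge>N. (\<integral>x. cmod (A m k x - A n k x) \<partial>M) < e" if e: "0 < e" for e k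
  proof -
    define c where "c = sqrt (measure M (space M)) + 1"
    have c: "0 < c" "sqrt (measure M (space M)) \<le> c" by (simp_all add: c_def add_nonneg_pos)
    have "0 < (e / c)\<^sup>2" using e c by simp
    with Econv[of k] obtain N where N: "\<And>m n. N \<le> m \<Longrightarrow> N \<le> n \<Longrightarrow> \<bar>E m k - E n k\<bar> < (e / c)\<^sup>2"
      unfolding Cauchy_convergent_iff[symmetric] Cauchy_def dist_real_def by metis
    have "(\<integral>x. cmod (A m k x - A n k x) \<partial>M) < e" if "N \<le> m" "N \<le> n" for m n
    proof -
      have "sqrt \<bar>E m k - E n k\<bar> < e / c"
        using N[OF that] e c by (intro real_less_lsqrt) auto
      then have "sqrt \<bar>E m k - E n k\<bar> * c < e" using c by (simp add: pos_less_divide_eq)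
      moreover have "sqrt \<bar>E m k - E n k\<bar> * sqrt (measure M (space M)) \<le> sqrt \<bar>E m k - E n k\<bar> * c"
        using c by (intro mult_left_mono) auto
      ultimately show ?thesis using L1[of m k n] by linarith
    qed
    then show ?thesis by blast
  qed
  obtain \<sigma> where \<sigma>: "strict_mono \<sigma>" and conv: "\<And>k. AE x in M. convergent (\<lambda>j. A (\<sigma> j) k x)"
  proof (rule diagonal_subsequence[of "\<lambda>k s. AE x in M. convergent (\<lambda>j. A (s j) k x)"])
    fix k and s :: "nat \<Rightarrow> nat" assume s: "strict_mono s"
    have "\<exists>N. \<forall>m\<ge>N. \<forall>n\<ge>N. (\<integral>x. cmod (A (s m) k x - A (s n) k x) \<partial>M) < e" if "0 < e" for e
      using cau[OF that, of k] seq_suble[OF s] by (meson order_trans)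
    from L1_Cauchy_AE_convergent_subsequence[OF Aint this]
    obtain r where "strict_mono r" "AE x in M. convergent (\<lambda>j. A (s (r j)) k x)" by blast
    then show "\<exists>r. strict_mono r \<and> (AE x in M. convergent (\<lambda>j. A ((s \<circ> r) j) k x))"
      by (auto simp: o_def)
  next
    fix k and s r :: "nat \<Rightarrow> nat" assume r: "strict_mono r" and s: "AE x in M. convergent (\<lambda>j. A (s j) k x)"
    from s show "AE x in M. convergent (\<lambda>j. A ((s \<circ> r) j) k x)"
    proof eventually_elim
      case (elim x)
      from convergent_subseq_convergent[OF this r] show ?case by (simp add: o_def)
    qed
  next
    fix k and s :: "nat \<Rightarrow> nat" and p assume "AE x in M. convergent (\<lambda>j. A ((s \<circ> (+) p) j) k x)"
    then show "AE x in M. convergent (\<lambda>j. A (s j) k x)"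
    proof eventually_elim
      case (elim x)
      then obtain l where "(\<lambda>j. A (s (j + p)) k x) \<longlonglongrightarrow> l" by (auto simp: convergent_def o_def add.commute)
      then have "(\<lambda>j. A (s j) k x) \<longlonglongrightarrow> l" by (rule LIMSEQ_offset)
      then show ?case by (auto simp: convergent_def)
    qed
  qed blast
  have "AE x in M. \<forall>k. convergent (\<lambda>j. A (\<sigma> j) k x)"
    using conv by (simp add: AE_all_countable)
  then obtain N where N: "N \<in> null_sets M" and Nc: "\<And>x k. x \<in> space M - N \<Longrightarrow> convergent (\<lambda>j. A (\<sigma> j) k x)"
    by (rule AE_E3) blast
  have NM[measurable]: "N \<in> sets M" using N by auto
  \<comment> \<open>The limit is set to \<open>0\<close> on the exceptional null set, so that the bound \<open>C\<close> holds everywhere.\<close>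
  define a where "a k x = (if x \<in> space M - N then lim (\<lambda>j. A (\<sigma> j) k x) else 0)" for k x
  have am[measurable]: "a k \<in> borel_measurable M" for k
    unfolding a_def[abs_def] by measurable
  have alim: "(\<lambda>j. A (\<sigma> j) k x) \<longlonglongrightarrow> a k x" if "x \<in> space M - N" for k x
    using Nc[OF that, of k] that unfolding a_def by (simp add: convergent_LIMSEQ_iff)
  have abnd: "(\<Sum>k<K. (cmod (a k x))\<^sup>2) \<le> C" for x K
  proof (cases "x \<in> space M - N")
    case True
    have "(\<lambda>j. \<Sum>k<K. (cmod (A (\<sigma> j) k x))\<^sup>2) \<longlonglongrightarrow> (\<Sum>k<K. (cmod (a k x))\<^sup>2)"
      by (intro tendsto_intros alim True)
    then show ?thesis by (rule LIMSEQ_le_const2) (use Abnd in auto)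
  next
    case False
    then have "a k x = 0" for k unfolding a_def by (rule if_not_P)
    then show ?thesis using C by simp
  qed
  have aatom: "(\<integral>x. a k x * indicator (atom M G l s) x \<partial>M) = t l s k" if s: "s < 2 ^ l" for l s k
  proof -
    note [measurable] = atom_sets[of G M l s, OF G]
    have "(\<lambda>j. \<integral>x. A (\<sigma> j) k x * indicator (atom M G l s) x \<partial>M) \<longlonglongrightarrow> (\<integral>x. a k x * indicator (atom M G l s) x \<partial>M)"
    proof (rule integral_dominated_convergence[where w="\<lambda>_. sqrt C"])
      have "AE x in M. x \<notin> N" using AE_not_in[OF N] .
      then show "AE x in M. (\<lambda>j. A (\<sigma> j) k x * indicator (atom M G l s) x) \<longlonglongrightarrow> a k x * indicator (atom M G l s) x"
        using AE_space by eventually_elim (intro tendsto_intros alim, simp)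
      show "AE x in M. norm (A (\<sigma> j) k x * indicator (atom M G l s) x) \<le> sqrt C" for j
        using Ac C by (intro AE_I2) (auto simp: indicator_def)
    qed (auto intro: borel_measurable_times)
    moreover have "(\<lambda>j. \<integral>x. A (\<sigma> j) k x * indicator (atom M G l s) x \<partial>M) \<longlonglongrightarrow> t l s k"
    proof (rule tendsto_eventually)
      have "l \<le> \<sigma> j" if "l \<le> j" for j using seq_suble[OF \<sigma>, of j] that by simp
      then show "\<forall>\<^sub>F j in sequentially. (\<integral>x. A (\<sigma> j) k x * indicator (atom M G l s) x \<partial>M) = t l s k"
        using Aatom s by (intro eventually_sequentiallyI[of l]) auto
    qed
    ultimately show ?thesis by (rule LIMSEQ_unique)
  qed
  show ?thesis by (rule that[OF am abnd aatom])
qed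

section \<open>Factorization from averages\<close>

text \<open>
  A linear relation says that a combination has norm \<open>0\<close>, and this norm is determined by the inner products.
  So a relation that holds from some index on passes to the limit vectors.
\<close>

lemma gram_relation_limit:
  fixes v :: "nat \<Rightarrow> 'i::countable \<Rightarrow> nat \<Rightarrow> complex" and r :: "nat \<Rightarrow> nat"
  assumes \<sigma>: "strict_mono \<sigma>"
    and L0: "\<And>i k. to_nat i < k \<Longrightarrow> L i k = 0"
    and lim: "\<And>i j. (\<lambda>n. \<Sum>k<r (\<sigma> n). v (\<sigma> n) i k * cnj (v (\<sigma> n) j k)) \<longlonglongrightarrow> (\<Sum>k\<le>to_nat i. L i k * cnj (L j k))"
    and J: "finite J"
    and rel: "\<And>n k. n0 \<le> n \<Longrightarrow> (\<Sum>j\<in>J. c j * v n j k) = 0"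
  shows "(\<Sum>j\<in>J. c j * L j k) = 0"
proof -
  define K where "K = Suc (k + Max (insert 0 (to_nat ` J)))"
  have K: "to_nat j < K" if "j \<in> J" for j
    unfolding K_def using J that by (simp add: le_imp_less_Suc trans_le_add2)
  have gram: "(\<lambda>n. \<Sum>k<r (\<sigma> n). v (\<sigma> n) i k * cnj (v (\<sigma> n) j k)) \<longlonglongrightarrow> (\<Sum>k<K. L i k * cnj (L j k))"
    if "i \<in> J" for i j
  proof -
    have "(\<Sum>k\<le>to_nat i. L i k * cnj (L j k)) = (\<Sum>k<K. L i k * cnj (L j k))"
      using K[OF that] L0[of i] by (intro sum.mono_neutral_left) auto
    then show ?thesis using lim[of i j] by simp
  qed
  have expand: "(\<Sum>k<m. of_real ((cmod (\<Sum>j\<in>J. c j * w j k))\<^sup>2)) =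
      (\<Sum>i\<in>J. \<Sum>j\<in>J. c i * cnj (c j) * (\<Sum>k<m. w i k * cnj (w j k)))"
    for m and w :: "'i \<Rightarrow> nat \<Rightarrow> complex"
  proof -
    have "(\<Sum>k<m. of_real ((cmod (\<Sum>j\<in>J. c j * w j k))\<^sup>2)) =
        (\<Sum>k<m. \<Sum>i\<in>J. \<Sum>j\<in>J. c i * cnj (c j) * (w i k * cnj (w j k)))"
      unfolding complex_norm_square by (simp add: sum_product cnj_sum mult_ac)
    also have "\<dots> = (\<Sum>i\<in>J. \<Sum>k<m. \<Sum>j\<in>J. c i * cnj (c j) * (w i k * cnj (w j k)))"
      by (rule sum.swap)
    also have "\<dots> = (\<Sum>i\<in>J. \<Sum>j\<in>J. \<Sum>k<m. c i * cnj (c j) * (w i k * cnj (w j k)))"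
      by (intro sum.cong refl sum.swap)
    finally show ?thesis by (simp add: sum_distrib_left)
  qed
  have "(\<lambda>n. \<Sum>k<r (\<sigma> n). complex_of_real ((cmod (\<Sum>j\<in>J. c j * v (\<sigma> n) j k))\<^sup>2))
     \<longlonglongrightarrow> (\<Sum>k<K. of_real ((cmod (\<Sum>j\<in>J. c j * L j k))\<^sup>2))"
    unfolding expand by (intro tendsto_intros gram)
  moreover have "(\<lambda>n. \<Sum>k<r (\<sigma> n). complex_of_real ((cmod (\<Sum>j\<in>J. c j * v (\<sigma> n) j k))\<^sup>2)) \<longlonglongrightarrow> 0"
  proof (rule tendsto_eventually, rule eventually_sequentiallyI)
    fix n assume "n0 \<le> n"
    then have "n0 \<le> \<sigma> n" using seq_suble[OF \<sigma>, of n] by simp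
    then show "(\<Sum>k<r (\<sigma> n). complex_of_real ((cmod (\<Sum>j\<in>J. c j * v (\<sigma> n) j k))\<^sup>2)) = 0"
      using rel by simp
  qed
  ultimately have "(\<Sum>k<K. complex_of_real ((cmod (\<Sum>j\<in>J. c j * L j k))\<^sup>2)) = 0"
    by (rule LIMSEQ_unique)
  then have "(\<Sum>k<K. (cmod (\<Sum>j\<in>J. c j * L j k))\<^sup>2) = 0"
    unfolding of_real_sum[symmetric] of_real_eq_0_iff .
  then have "\<forall>k\<in>{..<K}. (cmod (\<Sum>j\<in>J. c j * L j k))\<^sup>2 = 0"
    by (subst (asm) sum_nonneg_eq_0_iff) auto
  moreover have "k < K" by (simp add: K_def)
  ultimately show ?thesis by auto
qed

lemma AE_zero_of_set_integrals_real:
  fixes g :: "'a \<Rightarrow> real"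
  assumes g: "integrable M g" and zero: "\<And>A. A \<in> sets M \<Longrightarrow> (\<integral>x. g x * indicator A x \<partial>M) = 0"
  shows "AE x in M. g x = 0"
proof -
  note [measurable] = borel_measurable_integrable[OF g]
  have half: "AE x in M. f x \<le> 0" if f: "integrable M f" "\<And>A. A \<in> sets M \<Longrightarrow> (\<integral>x. f x * indicator A x \<partial>M) = 0" for f :: "'a \<Rightarrow> real"
  proof -
    note [measurable] = borel_measurable_integrable[OF f(1)]
    define A where "A = {x \<in> space M. 0 < f x}"
    have A: "A \<in> sets M" unfolding A_def by measurable
    have "integrable M (\<lambda>x. f x * indicator A x)" using f(1) A by (rule integrable_real_mult_indicator[rotated])
    moreover have "AE x in M. 0 \<le> f x * indicator A x" by (rule AE_I2) (auto simp: A_def indicator_def)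
    ultimately have "AE x in M. f x * indicator A x = 0"
      using f(2)[OF A] integral_nonneg_eq_0_iff_AE by blast
    then show ?thesis using AE_space by eventually_elim (auto simp: A_def indicator_def split: if_splits)
  qed
  have "AE x in M. g x \<le> 0" by (rule half[OF g zero])
  moreover have "AE x in M. - g x \<le> 0" by (rule half) (use g zero in auto)
  ultimately show ?thesis by eventually_elim simp
qed

text \<open>
  By Dynkin's argument the integrals vanish over all measurable sets, in particular over those on which the
  real or the imaginary part has a constant sign.
\<close>

lemma (in finite_measure) AE_zero_of_generator_integrals:
  fixes g :: "'a \<Rightarrow> complex"
  assumes g: "integrable M g"
    and E: "Int_stable E" "E \<subseteq> Pow (space M)" "sets M = sigma_sets (space M) E" "space M \<in> E"
    and zero: "\<And>A. A \<in> E \<Longrightarrow> (\<integral>x. g x * indicator A x \<partial>M) = 0"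
  shows "AE x in M. g x = 0"
proof -
  have gi: "integrable M (\<lambda>x. g x * indicator A x)" if "A \<in> sets M" for A
    using that by (intro Bochner_Integration.integrable_bound[OF g]) (auto simp: indicator_def intro!: borel_measurable_times borel_measurable_integrable[OF g])
  have total: "(\<integral>x. g x \<partial>M) = 0"
  proof -
    have "(\<integral>x. g x \<partial>M) = (\<integral>x. g x * indicator (space M) x \<partial>M)"
      by (intro Bochner_Integration.integral_cong) auto
    then show ?thesis using zero[OF E(4)] by simp
  qed
  have all: "(\<integral>x. g x * indicator A x \<partial>M) = 0" if A: "A \<in> sets M" for A
    using E(1,2) A[unfolded E(3)]
  proof (induction rule: sigma_sets_induct_disjoint)
    case (basic A) then show ?case by (rule zero)
  next
    case empty then show ?case by simp
  next
    case (compl A)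
    then have A: "A \<in> sets M" by (simp add: E(3))
    have "(\<integral>x. g x * indicator (space M - A) x \<partial>M) = (\<integral>x. g x - g x * indicator A x \<partial>M)"
      by (intro Bochner_Integration.integral_cong) (auto simp: indicator_def)
    also have "\<dots> = 0" using total compl(2) by (simp add: Bochner_Integration.integral_diff[OF g gi[OF A]])
    finally show ?case .
  next
    case (union A)
    then have A: "A i \<in> sets M" for i by (auto simp: E(3))
    have ind: "(LINT x:B|M. g x) = (\<integral>x. g x * indicator B x \<partial>M)" for B
      unfolding set_lebesgue_integral_def
      by (intro Bochner_Integration.integral_cong) (auto simp: indicator_def)
    have "(LINT x:(\<Union>i. A i)|M. g x) = (\<Sum>i. (LINT x:A i|M. g x))"
    proof (rule lebesgue_integral_countable_add)
      show "A i \<inter> A j = {}" if "i \<noteq> j" for i j using union(1) that by (auto simp: disjoint_family_on_def)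
      have "(\<Union>i. A i) \<in> sets M" using A by auto
      then show "set_integrable M (\<Union>i. A i) g"
        unfolding set_integrable_def by (rule integrable_mult_indicator) (rule g)
    qed (rule A)
    then show ?case unfolding ind using union(3) by simp
  qed
  have "AE x in M. Re (g x) = 0"
  proof (rule AE_zero_of_set_integrals_real)
    fix A assume A: "A \<in> sets M"
    have "(\<integral>x. Re (g x) * indicator A x \<partial>M) = (\<integral>x. Re (g x * indicator A x) \<partial>M)"
      by (intro Bochner_Integration.integral_cong) (auto simp: indicator_def)
    then show "(\<integral>x. Re (g x) * indicator A x \<partial>M) = 0"
      unfolding Bochner_Integration.integral_Re[OF gi[OF A]] all[OF A] by simp
  qed (use g in simp)
  moreover have "AE x in M. Im (g x) = 0"
  proof (rule AE_zero_of_set_integrals_real)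
    fix A assume A: "A \<in> sets M"
    have "(\<integral>x. Im (g x) * indicator A x \<partial>M) = (\<integral>x. Im (g x * indicator A x) \<partial>M)"
      by (intro Bochner_Integration.integral_cong) (auto simp: indicator_def)
    then show "(\<integral>x. Im (g x) * indicator A x \<partial>M) = 0"
      unfolding Bochner_Integration.integral_Im[OF gi[OF A]] all[OF A] by simp
  qed (use g in simp)
  ultimately show ?thesis by eventually_elim (simp add: complex_eq_iff)
qed

lemma atom_Int:
  assumes "l \<le> m"
  shows "atom M G l s \<inter> atom M G m u = (if u mod 2 ^ l = s then atom M G m u else {})"
  by (auto simp: atom_def code_mod[OF assms])

lemma atom_0: "atom M G 0 0 = space M"
  by (auto simp: atom_def code_def)

lemma (in finite_measure) measure_atom_split:
  assumes G: "\<And>i. G i \<in> sets M" and l: "l \<le> n"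
  shows "measure M (atom M G l s) = (\<Sum>s' | s' < 2 ^ n \<and> s' mod 2 ^ l = s. measure M (atom M G n s'))"
proof -
  have "complex_of_real (measure M (atom M G l s)) = (\<integral>x. 1 * indicator (atom M G l s) x \<partial>M)"
    by (simp add: integral_indicator_complex(2)[OF atom_sets[OF G]])
  also have "\<dots> = (\<Sum>s' | s' < 2 ^ n \<and> s' mod 2 ^ l = s. 1 * complex_of_real (measure M (atom M G n s')))"
    by (rule code_integral_atom[OF G l])
  finally show ?thesis by (simp only: mult_1 of_real_sum[symmetric] of_real_eq_iff)
qed

lemma atoms_generate:
  assumes G: "\<And>i. G i \<in> sets M" and gen: "sets M = sigma_sets (space M) (range G)"
  shows "sets M = sigma_sets (space M) {atom M G n s | n s. True}"
proof
  show "sigma_sets (space M) {atom M G n s | n s. True} \<subseteq> sets M"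
    using atom_sets[OF G] by (intro sets.sigma_sets_subset) auto
  have "G i \<in> sigma_sets (space M) {atom M G n s | n s. True}" for i
  proof -
    have "G i = (\<Union>s\<in>{2 ^ i..<2 ^ Suc i}. atom M G (Suc i) s)"
    proof (intro equalityI subsetI)
      fix x assume x: "x \<in> G i"
      then have "x \<in> space M" using sets.sets_into_space[OF G] by auto
      moreover have "2 ^ i \<le> code G (Suc i) x" using x by (simp add: code_def)
      ultimately show "x \<in> (\<Union>s\<in>{2 ^ i..<2 ^ Suc i}. atom M G (Suc i) s)"
        using code_less[of G "Suc i" x] by (auto simp: atom_def)
    next
      fix x assume "x \<in> (\<Union>s\<in>{2 ^ i..<2 ^ Suc i}. atom M G (Suc i) s)"
      then have "2 ^ i \<le> code G (Suc i) x" by (auto simp: atom_def)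
      moreover have "code G i x < 2 ^ i" by (rule code_less)
      ultimately show "x \<in> G i" by (auto simp: code_def split: if_splits)
    qed
    also have "\<dots> \<in> sigma_sets (space M) {atom M G n s | n s. True}"
    proof -
      interpret sigma_algebra "space M" "sigma_sets (space M) {atom M G n s | n s. True}"
        by (intro sigma_algebra_sigma_sets) (auto simp: atom_def)
      show ?thesis by (intro finite_UN) (auto intro!: sigma_sets.Basic)
    qed
    finally show ?thesis .
  qed
  then show "sets M \<subseteq> sigma_sets (space M) {atom M G n s | n s. True}"
    unfolding gen by (intro sigma_sets_mono) auto
qed

text \<open>
  Products of cells. The empty set is included to make the family stable under intersection.
\<close>

definition rect_atoms :: "'a measure \<Rightarrow> (nat \<Rightarrow> 'a set) \<Rightarrow> 'b measure \<Rightarrow> (nat \<Rightarrow> 'b set) \<Rightarrow> ('a \<times> 'b) set set" where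
  "rect_atoms M G N H = insert {} {atom M G n s \<times> atom N H n' s' | n s n' s'. s < 2 ^ n \<and> s' < 2 ^ n'}"

lemma atom_empty: "\<not> s < 2 ^ n \<Longrightarrow> atom M G n s = {}"
  using code_less[of G n] by (auto simp: atom_def)

lemma atom_Int_ex: "\<exists>n s. s < 2 ^ n \<and> atom M G l u \<inter> atom M G m w = atom M G n s \<or> atom M G l u \<inter> atom M G m w = {}"
proof -
  have "\<exists>n s. atom M G l u \<inter> atom M G m w = atom M G n s \<or> atom M G l u \<inter> atom M G m w = {}"
    using atom_Int[of l m M G u w] atom_Int[of m l M G w u] by (metis Int_commute nat_le_linear)
  then show ?thesis using atom_empty by metis
qed

lemma rect_atoms_generator:
  assumes G: "\<And>i. G i \<in> sets M" and genM: "sets M = sigma_sets (space M) (range G)"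
    and H: "\<And>i. H i \<in> sets N" and genN: "sets N = sigma_sets (space N) (range H)"
  shows "Int_stable (rect_atoms M G N H)" "rect_atoms M G N H \<subseteq> Pow (space (M \<Otimes>\<^sub>M N))"
    "sets (M \<Otimes>\<^sub>M N) = sigma_sets (space (M \<Otimes>\<^sub>M N)) (rect_atoms M G N H)"
    "space (M \<Otimes>\<^sub>M N) \<in> rect_atoms M G N H"
proof -
  have mem: "atom M G n s \<times> atom N H n' s' \<in> rect_atoms M G N H" for n s n' s'
    using atom_empty[of s n M G] atom_empty[of s' n' N H] unfolding rect_atoms_def by blast
  show "Int_stable (rect_atoms M G N H)"
  proof (rule Int_stableI)
    fix A B assume A: "A \<in> rect_atoms M G N H" and B: "B \<in> rect_atoms M G N H"
    show "A \<inter> B \<in> rect_atoms M G N H"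
    proof (cases "A = {} \<or> B = {}")
      case True
      then show ?thesis by (auto simp: rect_atoms_def)
    next
      case False
      then obtain n s n' s' m u m' u' where "A = atom M G n s \<times> atom N H n' s'" "B = atom M G m u \<times> atom N H m' u'"
        using A B unfolding rect_atoms_def by blast
      then have AB: "A \<inter> B = (atom M G n s \<inter> atom M G m u) \<times> (atom N H n' s' \<inter> atom N H m' u')" by auto
      show ?thesis
      proof (cases "A \<inter> B = {}")
        case True then show ?thesis by (simp add: rect_atoms_def)
      next
        case False
        then show ?thesis
          using atom_Int_ex[of M G n s m u] atom_Int_ex[of N H n' s' m' u'] mem unfolding AB by auto
      qed
    qed
  qed
  show sub: "rect_atoms M G N H \<subseteq> Pow (space (M \<Otimes>\<^sub>M N))"
    by (auto simp: rect_atoms_def atom_def space_pair_measure)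
  have "space (M \<Otimes>\<^sub>M N) = atom M G 0 0 \<times> atom N H 0 0" by (simp add: atom_0 space_pair_measure)
  then show "space (M \<Otimes>\<^sub>M N) \<in> rect_atoms M G N H" using mem by metis
  show "sets (M \<Otimes>\<^sub>M N) = sigma_sets (space (M \<Otimes>\<^sub>M N)) (rect_atoms M G N H)"
  proof
    have "sets (M \<Otimes>\<^sub>M N) = sets (sigma (space M \<times> space N)
       {a \<times> b | a b. a \<in> {atom M G n s | n s. True} \<and> b \<in> {atom N H n s | n s. True}})"
    proof (rule sets_pair_eq[where Ca="{atom M G 0 0}" and Cb="{atom N H 0 0}"])
      show "{atom M G 0 0} \<subseteq> {atom M G n s | n s. True}" "{atom N H 0 0} \<subseteq> {atom N H n s | n s. True}" by blast+
      show "{atom M G n s | n s. True} \<subseteq> Pow (space M)" "{atom N H n s | n s. True} \<subseteq> Pow (space N)"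
        by (auto simp: atom_def)
    qed (use atoms_generate[OF G genM] atoms_generate[OF H genN] in \<open>simp_all add: atom_0\<close>)
    also have "\<dots> \<subseteq> sigma_sets (space (M \<Otimes>\<^sub>M N)) (rect_atoms M G N H)"
      using mem by (subst sets_measure_of) (auto simp: atom_def space_pair_measure intro!: sigma_sets_mono)
    finally show "sets (M \<Otimes>\<^sub>M N) \<subseteq> sigma_sets (space (M \<Otimes>\<^sub>M N)) (rect_atoms M G N H)" .
    show "sigma_sets (space (M \<Otimes>\<^sub>M N)) (rect_atoms M G N H) \<subseteq> sets (M \<Otimes>\<^sub>M N)"
      using atom_sets[OF G] atom_sets[OF H] by (intro sets.sigma_sets_subset) (auto simp: rect_atoms_def)
  qed
qed

lemma (in pair_sigma_finite) integral_tensor: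
  fixes f :: "'a \<Rightarrow> complex" and g :: "'b \<Rightarrow> complex"
  assumes f: "integrable M1 f" and g: "integrable M2 g"
  shows "integrable (M1 \<Otimes>\<^sub>M M2) (\<lambda>z. f (fst z) * g (snd z))"
    and "(\<integral>z. f (fst z) * g (snd z) \<partial>(M1 \<Otimes>\<^sub>M M2)) = (\<integral>x. f x \<partial>M1) * (\<integral>y. g y \<partial>M2)"
proof -
  note [measurable] = borel_measurable_integrable[OF f] borel_measurable_integrable[OF g]
  show I: "integrable (M1 \<Otimes>\<^sub>M M2) (\<lambda>z. f (fst z) * g (snd z))"
  proof (rule Fubini_integrable)
    show "integrable M1 (\<lambda>x. \<integral>y. norm (f (fst (x, y)) * g (snd (x, y))) \<partial>M2)"
      using f by (simp add: norm_mult)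
    show "AE x in M1. integrable M2 (\<lambda>y. f (fst (x, y)) * g (snd (x, y)))" using g by simp
  qed measurable
  have "integrable (M1 \<Otimes>\<^sub>M M2) (\<lambda>(x, y). f x * g y)" using I by (simp add: case_prod_beta')
  from integral_fst[OF this]
  show "(\<integral>z. f (fst z) * g (snd z) \<partial>(M1 \<Otimes>\<^sub>M M2)) = (\<integral>x. f x \<partial>M1) * (\<integral>y. g y \<partial>M2)"
    by (simp add: case_prod_beta')
qed

text \<open>
  The norm of a weighted sum of vectors is at most the weighted sum of the norms. Vectors of weight \<open>0\<close> are not bounded,
  as happens on cells of measure \<open>0\<close>.
\<close>

lemma ell2_weighted_sum_bound:
  fixes p :: "nat \<Rightarrow> 's \<Rightarrow> complex" and m :: "'s \<Rightarrow> real"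
  assumes S: "finite S" and m: "\<And>s. s \<in> S \<Longrightarrow> 0 \<le> m s"
    and p: "\<And>s. s \<in> S \<Longrightarrow> 0 < m s \<Longrightarrow> (\<Sum>k<r. (cmod (p k s))\<^sup>2) \<le> D"
  shows "(\<Sum>k<r. (cmod (\<Sum>s\<in>S. of_real (m s) * p k s))\<^sup>2) \<le> D * (\<Sum>s\<in>S. m s)\<^sup>2"
proof -
  have M: "0 \<le> (\<Sum>s\<in>S. m s)" using m by (rule sum_nonneg)
  have one: "(cmod (\<Sum>s\<in>S. of_real (m s) * p k s))\<^sup>2 \<le> (\<Sum>s\<in>S. m s) * (\<Sum>s\<in>S. m s * (cmod (p k s))\<^sup>2)" for k
  proof -
    have "cmod (\<Sum>s\<in>S. of_real (m s) * p k s) \<le> (\<Sum>s\<in>S. sqrt (m s) * (sqrt (m s) * cmod (p k s)))"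
      using m by (intro order_trans[OF norm_sum] sum_mono) (simp add: norm_mult mult.assoc[symmetric])
    then have "(cmod (\<Sum>s\<in>S. of_real (m s) * p k s))\<^sup>2 \<le> (\<Sum>s\<in>S. sqrt (m s) * (sqrt (m s) * cmod (p k s)))\<^sup>2"
      by (rule power_mono) simp
    also have "\<dots> \<le> (\<Sum>s\<in>S. (sqrt (m s))\<^sup>2) * (\<Sum>s\<in>S. (sqrt (m s) * cmod (p k s))\<^sup>2)"
      by (rule Cauchy_Schwarz_ineq_sum)
    also have "\<dots> = (\<Sum>s\<in>S. m s) * (\<Sum>s\<in>S. m s * (cmod (p k s))\<^sup>2)"
      using m by (simp add: power_mult_distrib)
    finally show ?thesis .
  qed
  have "(\<Sum>k<r. (cmod (\<Sum>s\<in>S. of_real (m s) * p k s))\<^sup>2) \<le> (\<Sum>k<r. (\<Sum>s\<in>S. m s) * (\<Sum>s\<in>S. m s * (cmod (p k s))\<^sup>2))"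
    by (intro sum_mono one)
  also have "\<dots> = (\<Sum>s\<in>S. m s) * (\<Sum>s\<in>S. m s * (\<Sum>k<r. (cmod (p k s))\<^sup>2))"
    unfolding sum_distrib_left by (rule sum.swap)
  also have "\<dots> \<le> (\<Sum>s\<in>S. m s) * (\<Sum>s\<in>S. m s * D)"
  proof (intro mult_left_mono[OF _ M] sum_mono)
    fix s assume s: "s \<in> S"
    show "m s * (\<Sum>k<r. (cmod (p k s))\<^sup>2) \<le> m s * D"
      using m[OF s] p[OF s] by (cases "m s = 0") (auto intro: mult_left_mono)
  qed
  also have "\<dots> = D * (\<Sum>s\<in>S. m s)\<^sup>2" by (simp add: sum_distrib_right[symmetric] power2_eq_square)
  finally show ?thesis .
qed

lemma ell2_product_bound:
  fixes a b :: "nat \<Rightarrow> complex"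
  assumes a: "\<And>K. (\<Sum>k<K. (cmod (a k))\<^sup>2) \<le> C" and b: "\<And>K. (\<Sum>k<K. (cmod (b k))\<^sup>2) \<le> C"
  shows "summable (\<lambda>k. cmod (a k * b k))" and "(\<Sum>k<K. cmod (a k * b k)) \<le> C"
proof -
  show le: "(\<Sum>k<K. cmod (a k * b k)) \<le> C" for K
  proof -
    have "2 * (\<Sum>k<K. cmod (a k * b k)) \<le> (\<Sum>k<K. (cmod (a k))\<^sup>2 + (cmod (b k))\<^sup>2)"
      unfolding sum_distrib_left norm_mult mult.assoc[symmetric] by (intro sum_mono sum_squares_bound)
    then show ?thesis using a[of K] b[of K] by (simp add: sum.distrib)
  qed
  show "summable (\<lambda>k. cmod (a k * b k))"
    by (rule summableI_nonneg_bounded[where x=C]) (use le in auto)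
qed

lemma integrals_of_ell2_product:
  fixes a :: "nat \<Rightarrow> 'a \<Rightarrow> complex" and b :: "nat \<Rightarrow> 'b \<Rightarrow> complex"
  assumes "finite_measure M" "finite_measure N"
    and am: "\<And>k. a k \<in> borel_measurable M" and bm: "\<And>k. b k \<in> borel_measurable N"
    and ab: "\<And>x K. (\<Sum>k<K. (cmod (a k x))\<^sup>2) \<le> C" and bb: "\<And>y K. (\<Sum>k<K. (cmod (b k y))\<^sup>2) \<le> C"
    and A: "A \<in> sets M" and B: "B \<in> sets N"
  defines "\<psi> \<equiv> (\<lambda>z. \<Sum>k. a k (fst z) * b k (snd z))"
  shows "integrable (M \<Otimes>\<^sub>M N) \<psi>"
    and "(\<lambda>K. \<Sum>k<K. (\<integral>x. a k x * indicator A x \<partial>M) * (\<integral>y. b k y * indicator B y \<partial>N))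
      \<longlonglongrightarrow> (\<integral>z. \<psi> z * indicator (A \<times> B) z \<partial>(M \<Otimes>\<^sub>M N))"
    and "(\<lambda>k. a k (fst z) * b k (snd z)) sums \<psi> z"
proof -
  interpret M: finite_measure M by fact
  interpret N: finite_measure N by fact
  interpret pair_sigma_finite M N ..
  interpret P: finite_measure "M \<Otimes>\<^sub>M N" by (rule finite_measure_pair_measure) fact+
  note [measurable] = am bm A B
  show sums: "(\<lambda>k. a k (fst z) * b k (snd z)) sums \<psi> z" for z
    unfolding \<psi>_def by (rule summable_sums[OF summable_norm_cancel[OF ell2_product_bound(1)[OF ab bb]]])
  have C: "0 \<le> C" using ab[where K=0] by simp
  define S where "S K z = (\<Sum>k<K. a k (fst z) * b k (snd z))" for K z
  have Sm[measurable]: "S K \<in> borel_measurable (M \<Otimes>\<^sub>M N)" for K unfolding S_def[abs_def] by measurable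
  have Slim: "(\<lambda>K. S K z) \<longlonglongrightarrow> \<psi> z" for z using sums[of z] by (simp add: sums_def S_def)
  have Sb: "cmod (S K z) \<le> C" for K z
    unfolding S_def by (rule order_trans[OF norm_sum ell2_product_bound(2)[OF ab bb]])
  have \<psi>m[measurable]: "\<psi> \<in> borel_measurable (M \<Otimes>\<^sub>M N)"
    by (rule borel_measurable_LIMSEQ_metric[OF Sm Slim])
  have \<psi>b: "cmod (\<psi> z) \<le> C" for z
    by (rule LIMSEQ_le_const2[OF tendsto_norm[OF Slim]]) (use Sb in auto)
  show "integrable (M \<Otimes>\<^sub>M N) \<psi>"
    by (rule P.integrable_const_bound[where B=C]) (use \<psi>b in auto)
  have sq: "cmod (f k) \<le> sqrt C" if "\<And>K. (\<Sum>k<K. (cmod (f k))\<^sup>2) \<le> C" for f :: "nat \<Rightarrow> complex" and k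
  proof -
    have "(cmod (f k))\<^sup>2 \<le> (\<Sum>k<Suc k. (cmod (f k))\<^sup>2)" by (rule member_le_sum) auto
    also have "\<dots> \<le> C" by (rule that)
    finally show ?thesis by (simp add: real_le_rsqrt)
  qed
  have aI: "integrable M (\<lambda>x. a k x * indicator A x)" for k
    by (rule M.integrable_const_bound[where B="sqrt C"])
      (use sq[OF ab, of k] C in \<open>auto simp: indicator_def intro!: AE_I2\<close>)
  have bI: "integrable N (\<lambda>y. b k y * indicator B y)" for k
    by (rule N.integrable_const_bound[where B="sqrt C"])
      (use sq[OF bb, of k] C in \<open>auto simp: indicator_def intro!: AE_I2\<close>)
  have Sint: "(\<integral>z. S K z * indicator (A \<times> B) z \<partial>(M \<Otimes>\<^sub>M N)) =
     (\<Sum>k<K. (\<integral>x. a k x * indicator A x \<partial>M) * (\<integral>y. b k y * indicator B y \<partial>N))" for K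
  proof -
    have "(\<integral>z. S K z * indicator (A \<times> B) z \<partial>(M \<Otimes>\<^sub>M N)) =
      (\<integral>z. (\<Sum>k<K. (a k (fst z) * indicator A (fst z)) * (b k (snd z) * indicator B (snd z))) \<partial>(M \<Otimes>\<^sub>M N))"
      by (intro Bochner_Integration.integral_cong refl)
        (auto simp: S_def sum_distrib_right indicator_def split: if_splits)
    also have "\<dots> = (\<Sum>k<K. \<integral>z. (a k (fst z) * indicator A (fst z)) * (b k (snd z) * indicator B (snd z)) \<partial>(M \<Otimes>\<^sub>M N))"
      by (intro Bochner_Integration.integral_sum integral_tensor(1)[OF aI bI])
    finally show ?thesis unfolding integral_tensor(2)[OF aI bI] .
  qed
  have "(\<lambda>K. \<integral>z. S K z * indicator (A \<times> B) z \<partial>(M \<Otimes>\<^sub>M N)) \<longlonglongrightarrow> (\<integral>z. \<psi> z * indicator (A \<times> B) z \<partial>(M \<Otimes>\<^sub>M N))"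
  proof (rule integral_dominated_convergence[where w="\<lambda>_. C"])
    show "AE z in M \<Otimes>\<^sub>M N. (\<lambda>K. S K z * indicator (A \<times> B) z) \<longlonglongrightarrow> \<psi> z * indicator (A \<times> B) z"
      by (intro AE_I2 tendsto_intros Slim)
    show "AE z in M \<Otimes>\<^sub>M N. norm (S K z * indicator (A \<times> B) z) \<le> C" for K
      using Sb C by (intro AE_I2) (auto simp: indicator_def)
  qed (auto intro!: borel_measurable_times)
  then show "(\<lambda>K. \<Sum>k<K. (\<integral>x. a k x * indicator A x \<partial>M) * (\<integral>y. b k y * indicator B y \<partial>N))
      \<longlonglongrightarrow> (\<integral>z. \<psi> z * indicator (A \<times> B) z \<partial>(M \<Otimes>\<^sub>M N))"
    unfolding Sint .
qed

text \<open>
  The integrals of the vectors \<open>p\<close> and \<open>q\<close> of level \<open>n\<close> over a coarser cell are bounded by the measure of that cell,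
  and the product of two of them approximates the integral of \<open>\<phi>\<close> over the product of the cells. The Gram limit
  over all cells in both spaces at once keeps these bounds and makes the products exact. The densities
  \<open>a\<close> and \<open>b\<close> of the limit vectors give a function \<open>\<psi>\<close> with the same integrals as \<open>\<phi>\<close> over products of
  cells.
\<close>

lemma bounded_factorization_of_averages:
  assumes fM: "finite_measure M" and fN: "finite_measure N"
    and G: "\<And>i. G i \<in> sets M" and genM: "sets M = sigma_sets (space M) (range G)"
    and H: "\<And>i. H i \<in> sets N" and genN: "sets N = sigma_sets (space N) (range H)"
    and \<phi>: "integrable (M \<Otimes>\<^sub>M N) \<phi>" and C: "0 \<le> C"
    and approx: "\<And>n \<epsilon>. 0 < \<epsilon> \<Longrightarrow> \<exists>(r::nat) p q.
      (\<forall>s<2 ^ n. 0 < measure M (atom M G n s) \<longrightarrow> (\<Sum>k<r. (cmod (p k s))\<^sup>2) \<le> C + \<epsilon>) \<and>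
      (\<forall>s<2 ^ n. 0 < measure N (atom N H n s) \<longrightarrow> (\<Sum>k<r. (cmod (q k s))\<^sup>2) \<le> C + \<epsilon>) \<and>
      (\<forall>s<2 ^ n. \<forall>s'<2 ^ n. 0 < measure M (atom M G n s) \<longrightarrow> 0 < measure N (atom N H n s') \<longrightarrow>
         cmod ((\<integral>z. \<phi> z * indicator (atom M G n s \<times> atom N H n s') z \<partial>(M \<Otimes>\<^sub>M N)) /
           of_real (measure M (atom M G n s) * measure N (atom N H n s')) - (\<Sum>k<r. p k s * q k s')) \<le> \<epsilon>)"
  obtains a :: "nat \<Rightarrow> 'a \<Rightarrow> complex" and b :: "nat \<Rightarrow> 'b \<Rightarrow> complex" where
    "\<And>k. a k \<in> borel_measurable M" "\<And>k. b k \<in> borel_measurable N"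
    "\<And>x K. (\<Sum>k<K. (cmod (a k x))\<^sup>2) \<le> C" "\<And>y K. (\<Sum>k<K. (cmod (b k y))\<^sup>2) \<le> C"
    "AE z in M \<Otimes>\<^sub>M N. (\<lambda>k. a k (fst z) * b k (snd z)) sums \<phi> z"
proof -
  interpret M: finite_measure M by fact
  interpret N: finite_measure N by fact
  interpret pair_sigma_finite M N ..
  interpret P: finite_measure "M \<Otimes>\<^sub>M N" by (rule finite_measure_pair_measure) fact+
  define \<mu> where "\<mu> l s = measure M (atom M G l s)" for l s
  define \<nu> where "\<nu> l s = measure N (atom N H l s)" for l s
  define \<Phi> where "\<Phi> l s l' s' = (\<integral>z. \<phi> z * indicator (atom M G l s \<times> atom N H l' s') z \<partial>(M \<Otimes>\<^sub>M N))" for l s l' s'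
  define \<epsilon> where "\<epsilon> n = 1 / real (Suc n)" for n
  have \<epsilon>: "0 < \<epsilon> n" "\<epsilon> n \<le> 1" for n by (auto simp: \<epsilon>_def)
  have \<epsilon>lim: "\<epsilon> \<longlonglongrightarrow> 0" unfolding \<epsilon>_def using LIMSEQ_inverse_real_of_nat by (simp add: inverse_eq_divide)
  define good where "good n r p q \<longleftrightarrow>
      (\<forall>s<2 ^ n. 0 < \<mu> n s \<longrightarrow> (\<Sum>k<r. (cmod (p k s))\<^sup>2) \<le> C + \<epsilon> n) \<and>
      (\<forall>s<2 ^ n. 0 < \<nu> n s \<longrightarrow> (\<Sum>k<r. (cmod (q k s))\<^sup>2) \<le> C + \<epsilon> n) \<and>
      (\<forall>s<2 ^ n. \<forall>s'<2 ^ n. 0 < \<mu> n s \<longrightarrow> 0 < \<nu> n s' \<longrightarrow>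
         cmod (\<Phi> n s n s' / of_real (\<mu> n s * \<nu> n s') - (\<Sum>k<r. p k s * q k s')) \<le> \<epsilon> n)"
    for n and r :: nat and p q :: "nat \<Rightarrow> nat \<Rightarrow> complex"
  have "\<forall>n. \<exists>r p q. good n r p q"
    unfolding good_def \<mu>_def \<nu>_def \<Phi>_def using approx[OF \<epsilon>(1)] by blast
  then obtain r p q where good: "\<And>n. good n (r n) (p n) (q n)" by metis
  have pb: "s < 2 ^ n \<Longrightarrow> 0 < \<mu> n s \<Longrightarrow> (\<Sum>k<r n. (cmod (p n k s))\<^sup>2) \<le> C + \<epsilon> n" for n s
    using good[of n] unfolding good_def by blast
  have qb: "s < 2 ^ n \<Longrightarrow> 0 < \<nu> n s \<Longrightarrow> (\<Sum>k<r n. (cmod (q n k s))\<^sup>2) \<le> C + \<epsilon> n" for n s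
    using good[of n] unfolding good_def by blast
  have pq: "s < 2 ^ n \<Longrightarrow> s' < 2 ^ n \<Longrightarrow> 0 < \<mu> n s \<Longrightarrow> 0 < \<nu> n s' \<Longrightarrow>
         cmod (\<Phi> n s n s' / of_real (\<mu> n s * \<nu> n s') - (\<Sum>k<r n. p n k s * q n k s')) \<le> \<epsilon> n" for n s s'
    using good[of n] unfolding good_def by blast
  define I where "I n l s = {s'::nat. s' < 2 ^ n \<and> s' mod 2 ^ l = s}" for n l s
  have finI: "finite (I n l s)" for n l s by (simp add: I_def)
  have I: "s' < 2 ^ n" if "s' \<in> I n l s" for s' n l s using that by (simp add: I_def)
  have \<mu>I: "\<mu> l s = (\<Sum>s'\<in>I n l s. \<mu> n s')" if "l \<le> n" for l n s
    unfolding \<mu>_def I_def by (rule M.measure_atom_split[OF G that])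
  have \<nu>I: "\<nu> l s = (\<Sum>s'\<in>I n l s. \<nu> n s')" if "l \<le> n" for l n s
    unfolding \<nu>_def I_def by (rule N.measure_atom_split[OF H that])
  define PP where "PP n l s k = (\<Sum>s'\<in>I n l s. of_real (\<mu> n s') * p n k s')" for n l s k
  define QQ where "QQ n l s k = (\<Sum>s'\<in>I n l s. of_real (\<nu> n s') * q n k s')" for n l s k
  have PPb: "(\<Sum>k<r n. (cmod (PP n l s k))\<^sup>2) \<le> (C + \<epsilon> n) * (\<mu> l s)\<^sup>2" if "l \<le> n" for n l s
    unfolding PP_def \<mu>I[OF that] using pb I
    by (intro ell2_weighted_sum_bound finI) (auto simp: \<mu>_def)
  have QQb: "(\<Sum>k<r n. (cmod (QQ n l s k))\<^sup>2) \<le> (C + \<epsilon> n) * (\<nu> l s)\<^sup>2" if "l \<le> n" for n l s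
    unfolding QQ_def \<nu>I[OF that] using qb I
    by (intro ell2_weighted_sum_bound finI) (auto simp: \<nu>_def)
  have Isplit: "(\<Sum>s'\<in>I n l s. f s') = (\<Sum>u\<in>I m l s. \<Sum>s'\<in>I n m u. f s')" if "l \<le> m" "m \<le> n"
    for f :: "nat \<Rightarrow> complex" and n m l s
  proof -
    have "(\<Sum>u\<in>I m l s. \<Sum>s'\<in>{x \<in> I n l s. x mod 2 ^ m = u}. f s') = (\<Sum>s'\<in>I n l s. f s')"
    proof (rule sum.group[OF finI finI])
      show "(\<lambda>x. x mod 2 ^ m) ` I n l s \<subseteq> I m l s"
        using that by (auto simp: I_def mod_mod_cancel le_imp_power_dvd)
    qed
    moreover have "{x \<in> I n l s. x mod 2 ^ m = u} = I n m u" if "u \<in> I m l s" for u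
      using that \<open>l \<le> m\<close> by (auto simp: I_def mod_mod_cancel le_imp_power_dvd)
    ultimately show ?thesis by simp
  qed
  \<comment> \<open>The flag \<open>True\<close> marks cells of the first space. The vectors of the second space are conjugated,
    since the Gram matrix is sesquilinear and \<open>\<Sum>k. p k s * q k t\<close> is bilinear.\<close>
  define v where "v n i k = (case i of (c, l, s) \<Rightarrow> if l \<le> n then (if c then PP n l s k else cnj (QQ n l s k)) else 0)"
    for n k and i :: "bool \<times> nat \<times> nat"
  define B where "B i = (case i of (c, l, s) \<Rightarrow> (C + 1) * ((if c then \<mu> l s else \<nu> l s)\<^sup>2))" for i :: "bool \<times> nat \<times> nat"
  have vb': "(\<Sum>k<r n. (cmod (v n (c, l, s) k))\<^sup>2) \<le> (C + \<epsilon> n) * ((if c then \<mu> l s else \<nu> l s)\<^sup>2)" for n c l s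
    using PPb[of l n s] QQb[of l n s] C \<epsilon>(1)[of n]
    by (cases "l \<le> n"; cases c) (simp_all add: v_def)
  have vb: "(\<Sum>k<r n. (cmod (v n i k))\<^sup>2) \<le> B i" for n i
  proof -
    obtain c l s where i: "i = (c, l, s)" by (cases i)
    have "(\<Sum>k<r n. (cmod (v n i k))\<^sup>2) \<le> (C + \<epsilon> n) * ((if c then \<mu> l s else \<nu> l s)\<^sup>2)" unfolding i by (rule vb')
    also have "\<dots> \<le> (C + 1) * ((if c then \<mu> l s else \<nu> l s)\<^sup>2)" using \<epsilon>(2)[of n] by (intro mult_right_mono) auto
    finally show ?thesis by (simp add: B_def i)
  qed
  obtain \<sigma> L where \<sigma>: "strict_mono \<sigma>" and L0: "\<And>i k. to_nat i < k \<Longrightarrow> L i k = 0"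
    and lim: "\<And>i j. (\<lambda>n. \<Sum>k<r (\<sigma> n). v (\<sigma> n) i k * cnj (v (\<sigma> n) j k)) \<longlonglongrightarrow> (\<Sum>k\<le>to_nat i. L i k * cnj (L j k))"
    by (rule gram_subsequence[where r=r and v=v and B=B, OF vb]) (rule that, assumption+)
  have L0': "k \<le> to_nat i" if "L i k \<noteq> 0" for i k using L0[of i k] that by (rule_tac ccontr) simp
  have \<sigma>n: "n \<le> \<sigma> n" for n by (rule seq_suble[OF \<sigma>])
  have \<epsilon>\<sigma>: "(\<lambda>n. \<epsilon> (\<sigma> n)) \<longlonglongrightarrow> 0" using LIMSEQ_subseq_LIMSEQ[OF \<epsilon>lim \<sigma>] by (simp add: o_def)
  have Lb: "(\<Sum>k<K. (cmod (L (c, l, s) k))\<^sup>2) \<le> C * ((if c then \<mu> l s else \<nu> l s)\<^sup>2)" for K c l s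
  proof -
    define i where "i = (c, l, s)"
    define w where "w = (if c then \<mu> l s else \<nu> l s)\<^sup>2"
    have "(\<Sum>k<K. (cmod (L i k))\<^sup>2) = (\<Sum>k\<in>{..<K} \<inter> {..to_nat i}. (cmod (L i k))\<^sup>2)"
      by (intro sum.mono_neutral_right) (auto intro: L0')
    also have "\<dots> \<le> (\<Sum>k\<le>to_nat i. (cmod (L i k))\<^sup>2)"
      by (intro sum_mono2) auto
    also have "\<dots> \<le> (C + 0) * w"
    proof (rule LIMSEQ_le)
      have "(\<lambda>n. Re (\<Sum>k<r (\<sigma> n). v (\<sigma> n) i k * cnj (v (\<sigma> n) i k))) \<longlonglongrightarrow> Re (\<Sum>k\<le>to_nat i. L i k * cnj (L i k))"
        by (intro tendsto_Re lim)
      then show "(\<lambda>n. \<Sum>k<r (\<sigma> n). (cmod (v (\<sigma> n) i k))\<^sup>2) \<longlonglongrightarrow> (\<Sum>k\<le>to_nat i. (cmod (L i k))\<^sup>2)"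
        unfolding complex_norm_square[symmetric] Re_sum Re_complex_of_real .
      show "(\<lambda>n. (C + \<epsilon> (\<sigma> n)) * w) \<longlonglongrightarrow> (C + 0) * w" by (intro tendsto_intros \<epsilon>\<sigma>)
      show "\<exists>N. \<forall>n\<ge>N. (\<Sum>k<r (\<sigma> n). (cmod (v (\<sigma> n) i k))\<^sup>2) \<le> (C + \<epsilon> (\<sigma> n)) * w"
        unfolding i_def w_def using vb' by blast
    qed
    finally show ?thesis by (simp add: i_def w_def)
  qed
  have Ladd: "L (c, l, s) k = (\<Sum>u\<in>I m l s. L (c, m, u) k)" if lm: "l \<le> m" for c l m s k
  proof (cases "l = m")
    case True
    have "I m l s = (if s < 2 ^ m then {s} else {})" using True by (auto simp: I_def)
    moreover have "L (c, m, s) k = 0" if "\<not> s < 2 ^ m"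
    proof -
      have "\<mu> m s = 0" "\<nu> m s = 0" using that by (simp_all add: \<mu>_def \<nu>_def atom_empty)
      then have "(\<Sum>k<Suc k. (cmod (L (c, m, s) k))\<^sup>2) \<le> 0" using Lb[where K="Suc k" and c=c and l=m and s=s] by (cases c) simp_all
      moreover have "(cmod (L (c, m, s) k))\<^sup>2 \<le> (\<Sum>k<Suc k. (cmod (L (c, m, s) k))\<^sup>2)"
        by (rule member_le_sum) auto
      ultimately have "(cmod (L (c, m, s) k))\<^sup>2 \<le> 0" by linarith
      then show ?thesis by simp
    qed
    ultimately show ?thesis using True by auto
  next
    case False
    define J where "J = insert (c, l, s) ((\<lambda>u. (c, m, u)) ` I m l s)"
    define d where "d j = (if j = (c, l, s) then 1 else (-1::complex))" for j
    have Jsum: "(\<Sum>j\<in>J. d j * f j) = f (c, l, s) - (\<Sum>u\<in>I m l s. f (c, m, u))" for f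
    proof -
      have "(c, l, s) \<notin> (\<lambda>u. (c, m, u)) ` I m l s" using False by auto
      then have "(\<Sum>j\<in>J. d j * f j) = f (c, l, s) + (\<Sum>j\<in>(\<lambda>u. (c, m, u)) ` I m l s. d j * f j)"
        unfolding J_def using finI by (simp add: d_def)
      also have "(\<Sum>j\<in>(\<lambda>u. (c, m, u)) ` I m l s. d j * f j) = (\<Sum>u\<in>I m l s. - f (c, m, u))"
        using False by (subst sum.reindex) (auto simp: inj_on_def d_def)
      finally show ?thesis by (simp add: sum_negf)
    qed
    have "(\<Sum>j\<in>J. d j * L j k) = 0"
    proof (rule gram_relation_limit[OF \<sigma> L0 lim, of J m])
      show "finite J" unfolding J_def using finI by simp
      fix n k assume mn: "m \<le> n"
      have "PP n l s k = (\<Sum>u\<in>I m l s. PP n m u k)" "QQ n l s k = (\<Sum>u\<in>I m l s. QQ n m u k)"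
        unfolding PP_def QQ_def using lm mn by (intro Isplit; simp)+
      then show "(\<Sum>j\<in>J. d j * v n j k) = 0"
        unfolding Jsum using lm mn by (cases c) (simp_all add: v_def cnj_sum)
    qed
    then show ?thesis unfolding Jsum by simp
  qed
  have \<Phi>int: "integrable (M \<Otimes>\<^sub>M N) (\<lambda>z. \<phi> z * indicator (atom M G l s \<times> atom N H l' s') z)" for l s l' s'
  proof (rule Bochner_Integration.integrable_bound[OF \<phi>])
    have "atom M G l s \<times> atom N H l' s' \<in> sets (M \<Otimes>\<^sub>M N)" using atom_sets[OF G] atom_sets[OF H] by auto
    then show "(\<lambda>z. \<phi> z * indicator (atom M G l s \<times> atom N H l' s') z) \<in> borel_measurable (M \<Otimes>\<^sub>M N)"
      using borel_measurable_integrable[OF \<phi>] by simp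
  qed (auto simp: indicator_def)
  have \<Phi>split: "\<Phi> l s l' s' = (\<Sum>u\<in>I n l s. \<Sum>u'\<in>I n l' s'. \<Phi> n u n u')" if "l \<le> n" "l' \<le> n" for l s l' s' n
  proof -
    have "\<Phi> l s l' s' = (\<integral>z. (\<Sum>u\<in>I n l s. \<Sum>u'\<in>I n l' s'. \<phi> z * indicator (atom M G n u \<times> atom N H n u') z) \<partial>(M \<Otimes>\<^sub>M N))"
      unfolding \<Phi>_def
    proof (rule Bochner_Integration.integral_cong[OF refl])
      fix z assume "z \<in> space (M \<Otimes>\<^sub>M N)"
      then obtain x y where z: "z = (x, y)" "x \<in> space M" "y \<in> space N" by (auto simp: space_pair_measure)
      have split: "(indicator (atom M G l s \<times> atom N H l' s') z :: complex) =
          (\<Sum>u\<in>I n l s. indicator (atom M G n u) x) * (\<Sum>u'\<in>I n l' s'. indicator (atom N H n u') y)"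
        using indicator_atom_split[OF that(1) z(2), of G s, where 'b=complex] indicator_atom_split[OF that(2) z(3), of H s', where 'b=complex]
        unfolding z(1) indicator_times I_def by simp
      show "\<phi> z * indicator (atom M G l s \<times> atom N H l' s') z =
          (\<Sum>u\<in>I n l s. \<Sum>u'\<in>I n l' s'. \<phi> z * indicator (atom M G n u \<times> atom N H n u') z)"
        unfolding split sum_product unfolding sum_distrib_left
        unfolding z(1) indicator_times fst_conv snd_conv by (rule refl)
    qed
    also have "\<dots> = (\<Sum>u\<in>I n l s. \<integral>z. (\<Sum>u'\<in>I n l' s'. \<phi> z * indicator (atom M G n u \<times> atom N H n u') z) \<partial>(M \<Otimes>\<^sub>M N))"
      by (intro Bochner_Integration.integral_sum Bochner_Integration.integrable_sum \<Phi>int)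
    also have "\<dots> = (\<Sum>u\<in>I n l s. \<Sum>u'\<in>I n l' s'. \<Phi> n u n u')"
      unfolding \<Phi>_def by (intro sum.cong refl Bochner_Integration.integral_sum \<Phi>int)
    finally show ?thesis .
  qed
  have \<Phi>null: "\<Phi> n u n u' = 0" if "\<mu> n u = 0 \<or> \<nu> n u' = 0" for n u u'
  proof -
    have "emeasure M (atom M G n u) * emeasure N (atom N H n u') = 0"
      using that by (auto simp: \<mu>_def \<nu>_def M.emeasure_eq_measure N.emeasure_eq_measure)
    then have "atom M G n u \<times> atom N H n u' \<in> null_sets (M \<Otimes>\<^sub>M N)"
      using atom_sets[of G M n u, OF G] atom_sets[of H N n u', OF H] by (intro null_setsI) (auto simp: N.emeasure_pair_measure_Times)
    from AE_not_in[OF this] show ?thesis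
      unfolding \<Phi>_def by (intro integral_eq_zero_AE) (auto elim!: eventually_mono simp: indicator_def split: if_splits)
  qed
  have cross: "(\<Sum>k\<le>to_nat (True, l, s). L (True, l, s) k * cnj (L (False, l', s') k)) = \<Phi> l s l' s'" for l s l' s'
  proof (rule LIMSEQ_unique[OF lim])
    have close: "cmod ((\<Sum>k<r n. v n (True, l, s) k * cnj (v n (False, l', s') k)) - \<Phi> l s l' s') \<le> \<epsilon> n * (\<mu> l s * \<nu> l' s')"
      if n: "l \<le> n" "l' \<le> n" for n
    proof -
      have "(\<Sum>k<r n. v n (True, l, s) k * cnj (v n (False, l', s') k)) = (\<Sum>k<r n. PP n l s k * QQ n l' s' k)"
        using n by (simp add: v_def)
      also have "\<dots> = (\<Sum>k<r n. \<Sum>u\<in>I n l s. \<Sum>u'\<in>I n l' s'. of_real (\<mu> n u * \<nu> n u') * (p n k u * q n k u'))"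
        unfolding PP_def QQ_def by (simp add: sum_product mult_ac)
      also have "\<dots> = (\<Sum>u\<in>I n l s. \<Sum>k<r n. \<Sum>u'\<in>I n l' s'. of_real (\<mu> n u * \<nu> n u') * (p n k u * q n k u'))"
        by (rule sum.swap)
      also have "\<dots> = (\<Sum>u\<in>I n l s. \<Sum>u'\<in>I n l' s'. \<Sum>k<r n. of_real (\<mu> n u * \<nu> n u') * (p n k u * q n k u'))"
        by (intro sum.cong refl sum.swap)
      also have "\<dots> = (\<Sum>u\<in>I n l s. \<Sum>u'\<in>I n l' s'. of_real (\<mu> n u * \<nu> n u') * (\<Sum>k<r n. p n k u * q n k u'))"
        by (simp add: sum_distrib_left)
      finally have diff: "(\<Sum>k<r n. v n (True, l, s) k * cnj (v n (False, l', s') k)) - \<Phi> l s l' s' =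
          (\<Sum>u\<in>I n l s. \<Sum>u'\<in>I n l' s'. of_real (\<mu> n u * \<nu> n u') * (\<Sum>k<r n. p n k u * q n k u') - \<Phi> n u n u')"
        unfolding \<Phi>split[OF n] by (simp add: sum_subtractf)
      have "cmod ((\<Sum>k<r n. v n (True, l, s) k * cnj (v n (False, l', s') k)) - \<Phi> l s l' s')
          \<le> (\<Sum>u\<in>I n l s. \<Sum>u'\<in>I n l' s'. \<epsilon> n * (\<mu> n u * \<nu> n u'))"
        unfolding diff
      proof (intro sum_norm_le)
        fix u u' assume u: "u \<in> I n l s" and u': "u' \<in> I n l' s'"
        define X where "X = (\<Sum>k<r n. p n k u * q n k u')"
        show "cmod (of_real (\<mu> n u * \<nu> n u') * (\<Sum>k<r n. p n k u * q n k u') - \<Phi> n u n u') \<le> \<epsilon> n * (\<mu> n u * \<nu> n u')"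
        proof (cases "\<mu> n u = 0 \<or> \<nu> n u' = 0")
          case True
          then show ?thesis using \<Phi>null[OF True] by auto
        next
          case False
          have pos: "0 < \<mu> n u" "0 < \<nu> n u'" using False by (auto simp: \<mu>_def \<nu>_def less_le)
          have "cmod (of_real (\<mu> n u * \<nu> n u') * X - \<Phi> n u n u') =
              cmod (of_real (\<mu> n u * \<nu> n u') * (\<Phi> n u n u' / of_real (\<mu> n u * \<nu> n u') - X))"
            using pos by (subst norm_minus_commute) (simp add: right_diff_distrib)
          also have "\<dots> = (\<mu> n u * \<nu> n u') * cmod (\<Phi> n u n u' / of_real (\<mu> n u * \<nu> n u') - X)"
            unfolding norm_mult[of "of_real (\<mu> n u * \<nu> n u')"] norm_of_real using pos by simp
          also have "\<dots> \<le> (\<mu> n u * \<nu> n u') * \<epsilon> n"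
            unfolding X_def using pos by (intro mult_left_mono pq I[OF u] I[OF u']) auto
          finally show ?thesis by (simp add: X_def mult.commute)
        qed
      qed
      also have "\<dots> = \<epsilon> n * ((\<Sum>u\<in>I n l s. \<mu> n u) * (\<Sum>u'\<in>I n l' s'. \<nu> n u'))"
        unfolding sum_product unfolding sum_distrib_left by (rule refl)
      also have "\<dots> = \<epsilon> n * (\<mu> l s * \<nu> l' s')"
        by (simp only: \<mu>I[OF n(1), of s, symmetric] \<nu>I[OF n(2), of s', symmetric])
      finally show ?thesis .
    qed
    show "(\<lambda>n. \<Sum>k<r (\<sigma> n). v (\<sigma> n) (True, l, s) k * cnj (v (\<sigma> n) (False, l', s') k)) \<longlonglongrightarrow> \<Phi> l s l' s'"
    proof (rule LIM_zero_cancel, rule Lim_null_comparison)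
      show "\<forall>\<^sub>F n in sequentially. norm ((\<Sum>k<r (\<sigma> n). v (\<sigma> n) (True, l, s) k * cnj (v (\<sigma> n) (False, l', s') k)) - \<Phi> l s l' s')
          \<le> \<epsilon> (\<sigma> n) * (\<mu> l s * \<nu> l' s')"
      proof (rule eventually_sequentiallyI[of "max l l'"])
        fix n assume "max l l' \<le> n"
        then have "l \<le> \<sigma> n" "l' \<le> \<sigma> n" using \<sigma>n[of n] by auto
        then show "norm ((\<Sum>k<r (\<sigma> n). v (\<sigma> n) (True, l, s) k * cnj (v (\<sigma> n) (False, l', s') k)) - \<Phi> l s l' s')
          \<le> \<epsilon> (\<sigma> n) * (\<mu> l s * \<nu> l' s')" by (rule close)
      qed
      show "(\<lambda>n. \<epsilon> (\<sigma> n) * (\<mu> l s * \<nu> l' s')) \<longlonglongrightarrow> 0" using tendsto_mult_left_zero[OF \<epsilon>\<sigma>] .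
    qed
  qed
  obtain a where am: "\<And>k. a k \<in> borel_measurable M" and ab: "\<And>x K. (\<Sum>k<K. (cmod (a k x))\<^sup>2) \<le> C"
    and aI: "\<And>l s k. s < 2 ^ l \<Longrightarrow> (\<integral>x. a k x * indicator (atom M G l s) x \<partial>M) = L (True, l, s) k"
  proof (rule M.ell2_density[of G C "\<lambda>l s k. L (True, l, s) k"])
    show "L (True, l, s) k = (\<Sum>s' | s' < 2 ^ n \<and> s' mod 2 ^ l = s. L (True, n, s') k)" if "l \<le> n" for l n s k
      using Ladd[OF that] unfolding I_def .
    show "(\<Sum>k<K. (cmod (L (True, n, s) k))\<^sup>2) \<le> C * (measure M (atom M G n s))\<^sup>2" for n s K
      using Lb[where c=True] unfolding \<mu>_def by simp
  qed (use G C in auto)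
  obtain b where bm: "\<And>k. b k \<in> borel_measurable N" and bb: "\<And>x K. (\<Sum>k<K. (cmod (b k x))\<^sup>2) \<le> C"
    and bI: "\<And>l s k. s < 2 ^ l \<Longrightarrow> (\<integral>x. b k x * indicator (atom N H l s) x \<partial>N) = cnj (L (False, l, s) k)"
  proof (rule N.ell2_density[of H C "\<lambda>l s k. cnj (L (False, l, s) k)"])
    show "cnj (L (False, l, s) k) = (\<Sum>s' | s' < 2 ^ n \<and> s' mod 2 ^ l = s. cnj (L (False, n, s') k))" if "l \<le> n" for l n s k
      using Ladd[OF that, of False s k] unfolding I_def by (simp add: cnj_sum)
    show "(\<Sum>k<K. (cmod (cnj (L (False, n, s) k)))\<^sup>2) \<le> C * (measure N (atom N H n s))\<^sup>2" for n s K
      using Lb[where c=False] unfolding \<nu>_def by simp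
  qed (use H C in auto)
  define \<psi> where "\<psi> z = (\<Sum>k. a k (fst z) * b k (snd z))" for z
  note ell2 = integrals_of_ell2_product[OF fM fN am bm ab bb]
  have \<psi>: "integrable (M \<Otimes>\<^sub>M N) \<psi>" unfolding \<psi>_def[abs_def] by (rule ell2(1)[OF sets.top sets.top])
  have "AE z in M \<Otimes>\<^sub>M N. \<psi> z - \<phi> z = 0"
  proof (rule P.AE_zero_of_generator_integrals[OF _ rect_atoms_generator[OF G genM H genN]])
    show "integrable (M \<Otimes>\<^sub>M N) (\<lambda>z. \<psi> z - \<phi> z)" using \<psi> \<phi> by simp
    fix A assume "A \<in> rect_atoms M G N H"
    then consider "A = {}" | l s l' s' where "A = atom M G l s \<times> atom N H l' s'" "s < 2 ^ l" "s' < 2 ^ l'"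
      unfolding rect_atoms_def by blast
    then show "(\<integral>z. (\<psi> z - \<phi> z) * indicator A z \<partial>(M \<Otimes>\<^sub>M N)) = 0"
    proof cases
      case 2
      have R: "A \<in> sets (M \<Otimes>\<^sub>M N)" using atom_sets[OF G] atom_sets[OF H] by (simp add: 2)
      have \<psi>A: "integrable (M \<Otimes>\<^sub>M N) (\<lambda>z. \<psi> z * indicator A z)"
        by (rule Bochner_Integration.integrable_bound[OF \<psi>])
          (use R borel_measurable_integrable[OF \<psi>] in \<open>auto simp: indicator_def\<close>)
      define K0 where "K0 = to_nat (True, l, s)"
      have "(\<lambda>K. \<Sum>k<K. L (True, l, s) k * cnj (L (False, l', s') k)) \<longlonglongrightarrow> (\<integral>z. \<psi> z * indicator A z \<partial>(M \<Otimes>\<^sub>M N))"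
        using ell2(2)[OF atom_sets[of G M l s, OF G] atom_sets[of H N l' s', OF H]] unfolding aI[OF 2(2)] bI[OF 2(3)] 2(1) \<psi>_def .
      moreover have "(\<lambda>K. \<Sum>k<K. L (True, l, s) k * cnj (L (False, l', s') k)) \<longlonglongrightarrow> \<Phi> l s l' s'"
      proof (rule tendsto_eventually, rule eventually_sequentiallyI[of "Suc K0"])
        fix K assume "Suc K0 \<le> K"
        then have "(\<Sum>k<K. L (True, l, s) k * cnj (L (False, l', s') k)) = (\<Sum>k\<le>K0. L (True, l, s) k * cnj (L (False, l', s') k))"
          by (intro sum.mono_neutral_right) (auto simp: K0_def intro: L0')
        then show "(\<Sum>k<K. L (True, l, s) k * cnj (L (False, l', s') k)) = \<Phi> l s l' s'"
          using cross by (simp add: K0_def)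
      qed
      ultimately have "(\<integral>z. \<psi> z * indicator A z \<partial>(M \<Otimes>\<^sub>M N)) = \<Phi> l s l' s'" by (rule LIMSEQ_unique)
      then show ?thesis
        using \<psi>A \<Phi>int[of l s l' s'] by (simp add: left_diff_distrib \<Phi>_def 2)
    qed simp
  qed
  then have "AE z in M \<Otimes>\<^sub>M N. (\<lambda>k. a k (fst z) * b k (snd z)) sums \<phi> z"
  proof eventually_elim
    case (elim z)
    then show ?case using ell2(3)[OF sets.top sets.top, of z] by (simp add: \<psi>_def)
  qed
  then show ?thesis by (rule that[OF am bm ab bb])
qed

section \<open>Schur multipliers and bounded factorizations\<close>

lemma finite_measure_density:
  fixes h :: "'a \<Rightarrow> real"
  assumes h: "integrable M h" "\<And>x. 0 < h x"
  shows "finite_measure (density M (\<lambda>x. ennreal (h x)))"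
    and "A \<in> sets M \<Longrightarrow> measure (density M (\<lambda>x. ennreal (h x))) A = (\<integral>x. h x * indicator A x \<partial>M)"
proof -
  note [measurable] = borel_measurable_integrable[OF h(1)]
  have e: "emeasure (density M (\<lambda>x. ennreal (h x))) A = ennreal (\<integral>x. h x * indicator A x \<partial>M)" if A: "A \<in> sets M" for A
  proof -
    have "emeasure (density M (\<lambda>x. ennreal (h x))) A = (\<integral>\<^sup>+x. ennreal (h x * indicator A x) \<partial>M)"
      using A by (subst emeasure_density) (auto intro!: nn_integral_cong simp: indicator_def)
    also have "\<dots> = ennreal (\<integral>x. h x * indicator A x \<partial>M)"
      using h by (intro nn_integral_eq_integral integrable_real_mult_indicator A) (auto simp: less_imp_le)
    finally show ?thesis .
  qed
  show "finite_measure (density M (\<lambda>x. ennreal (h x)))"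
    by (rule finite_measureI) (simp add: e)
  have "0 \<le> (\<integral>x. h x * indicator A x \<partial>M)" using h by (intro integral_nonneg_AE) (auto simp: less_imp_le)
  then show "measure (density M (\<lambda>x. ennreal (h x))) A = (\<integral>x. h x * indicator A x \<partial>M)" if "A \<in> sets M"
    using e[OF that] by (simp add: measure_def)
qed

text \<open>
  Integrable positive weights \<open>h\<close> and \<open>g\<close> replace the measures by finite ones with the same null sets. The square
  roots of the weights, cut down to the cells, are the test functions of \<open>schur_multiplier_averages\<close>; their squares
  reproduce the averages with respect to the finite measures.
\<close>

lemma schur_multiplier_factorization:
  fixes G :: "nat \<Rightarrow> 'a set" and H :: "nat \<Rightarrow> 'b set"
  assumes "sigma_finite_measure M" "sigma_finite_measure N"
    and G: "\<And>i. G i \<in> sets M" and genM: "sets M = sigma_sets (space M) (range G)"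
    and H: "\<And>i. H i \<in> sets N" and genN: "sets N = sigma_sets (space N) (range H)"
    and schur: "schur_multiplier M N \<phi>"
  obtains C :: real and a :: "nat \<Rightarrow> 'a \<Rightarrow> complex" and b :: "nat \<Rightarrow> 'b \<Rightarrow> complex" where
    "0 \<le> C" "\<And>k. a k \<in> borel_measurable M" "\<And>k. b k \<in> borel_measurable N"
    "\<And>x K. (\<Sum>k<K. (cmod (a k x))\<^sup>2) \<le> C" "\<And>y K. (\<Sum>k<K. (cmod (b k y))\<^sup>2) \<le> C"
    "AE z in M \<Otimes>\<^sub>M N. (\<lambda>k. a k (fst z) * b k (snd z)) sums \<phi> z"
proof -
  interpret M: sigma_finite_measure M by fact
  interpret N: sigma_finite_measure N by fact
  interpret MN: pair_sigma_finite M N ..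
  obtain C where C0: "0 < C" and C: "\<And>k. k \<in> L2_functions (M \<Otimes>\<^sub>M N) \<Longrightarrow>
      op_norm M N (integral_op M (\<lambda>z. \<phi> z * k z)) \<le> C * op_norm M N (integral_op M k)"
    and \<phi>: "\<phi> \<in> Linf_functions (M \<Otimes>\<^sub>M N)"
    using schur unfolding schur_multiplier_def by blast
  from \<phi> obtain B where \<phi>m[measurable]: "\<phi> \<in> borel_measurable (M \<Otimes>\<^sub>M N)"
    and B: "AE z in M \<Otimes>\<^sub>M N. cmod (\<phi> z) \<le> B"
    unfolding Linf_functions_def by blast
  obtain h :: "'a \<Rightarrow> real" where hm[measurable]: "h \<in> borel_measurable M" and h0: "\<And>x. 0 < h x" and hI: "integrable M h"
    using M.obtain_positive_integrable_function by metis
  obtain g :: "'b \<Rightarrow> real" where gm[measurable]: "g \<in> borel_measurable N" and g0: "\<And>x. 0 < g x" and gI: "integrable N g"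
    using N.obtain_positive_integrable_function by metis
  define M' where "M' = density M (\<lambda>x. ennreal (h x))"
  define N' where "N' = density N (\<lambda>y. ennreal (g y))"
  have [measurable_cong]: "sets M' = sets M" "sets N' = sets N" by (simp_all add: M'_def N'_def)
  have sp: "space M' = space M" "space N' = space N" by (simp_all add: M'_def N'_def)
  have measM: "A \<in> sets M \<Longrightarrow> measure M' A = (\<integral>x. h x * indicator A x \<partial>M)" for A
    unfolding M'_def by (rule finite_measure_density(2)[OF hI h0])
  have measN: "A \<in> sets N \<Longrightarrow> measure N' A = (\<integral>x. g x * indicator A x \<partial>N)" for A
    unfolding N'_def by (rule finite_measure_density(2)[OF gI g0])
  interpret M': finite_measure M' unfolding M'_def by (rule finite_measure_density(1)[OF hI h0])
  interpret N': finite_measure N' unfolding N'_def by (rule finite_measure_density(1)[OF gI g0])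
  have prod: "M' \<Otimes>\<^sub>M N' = density (M \<Otimes>\<^sub>M N) (\<lambda>z. ennreal (h (fst z) * g (snd z)))"
  proof -
    have "M' \<Otimes>\<^sub>M N' = density (M \<Otimes>\<^sub>M N) (\<lambda>(x, y). ennreal (h x) * ennreal (g y))"
      unfolding M'_def N'_def
    proof (rule pair_measure_density)
      show "sigma_finite_measure (density N (\<lambda>y. ennreal (g y)))"
        using N'.sigma_finite_measure_axioms by (simp add: N'_def)
    qed (auto intro: N.sigma_finite_measure_axioms)
    then show ?thesis
      using h0 g0 by (simp add: case_prod_beta' ennreal_mult less_imp_le)
  qed
  interpret P: finite_measure "M' \<Otimes>\<^sub>M N'"
    by (rule finite_measure_pair_measure) (rule N'.finite_measure_axioms M'.finite_measure_axioms)+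
  have AE_eq: "(AE z in M' \<Otimes>\<^sub>M N'. P z) \<longleftrightarrow> (AE z in M \<Otimes>\<^sub>M N. P z)" for P
    unfolding prod using h0 g0 by (subst AE_density) auto
  have int_eq: "(\<integral>z. F z \<partial>(M' \<Otimes>\<^sub>M N')) = (\<integral>z. of_real (h (fst z) * g (snd z)) * F z \<partial>(M \<Otimes>\<^sub>M N))"
    if [measurable]: "F \<in> borel_measurable (M \<Otimes>\<^sub>M N)" for F :: "_ \<Rightarrow> complex"
    unfolding prod using h0 g0
    by (subst integral_density) (auto simp: less_imp_le scaleR_conv_of_real)
  have \<phi>int: "integrable (M' \<Otimes>\<^sub>M N') \<phi>"
    by (rule P.integrable_const_bound[where B=B]) (use B in \<open>simp_all add: AE_eq\<close>)
  have atomM: "atom M' G n s = atom M G n s" and atomN: "atom N' H n s = atom N H n s" for n s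
    by (simp_all add: atom_def sp)
  have G': "G i \<in> sets M'" and H': "H i \<in> sets N'" for i using G H by (simp_all add: M'_def N'_def)
  have genM': "sets M' = sigma_sets (space M') (range G)" and genN': "sets N' = sigma_sets (space N') (range H)"
    using genM genN by (simp_all add: M'_def N'_def)
  obtain a b where ab: "\<And>k. a k \<in> borel_measurable M'" "\<And>k. b k \<in> borel_measurable N'"
    "\<And>x K. (\<Sum>k<K. (cmod (a k x))\<^sup>2) \<le> C" "\<And>y K. (\<Sum>k<K. (cmod (b k y))\<^sup>2) \<le> C"
    "AE z in M' \<Otimes>\<^sub>M N'. (\<lambda>k. a k (fst z) * b k (snd z)) sums \<phi> z"
  proof (rule bounded_factorization_of_averages[OF M'.finite_measure_axioms N'.finite_measure_axioms G' genM' H' genN' \<phi>int less_imp_le[OF C0]])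
    fix n :: nat and \<epsilon> :: real assume \<epsilon>: "0 < \<epsilon>"
    define \<mu> where "\<mu> s = measure M' (atom M G n s)" for s
    define \<nu> where "\<nu> s = measure N' (atom N H n s)" for s
    define \<Phi> where "\<Phi> s s' = (\<integral>z. \<phi> z * indicator (atom M G n s \<times> atom N H n s') z \<partial>(M' \<Otimes>\<^sub>M N'))" for s s'
    define I where "I = {s. s < 2 ^ n \<and> 0 < \<mu> s}"
    define J where "J = {s. s < 2 ^ n \<and> 0 < \<nu> s}"
    define e where "e s x = sqrt (h x) * indicator (atom M G n s) x" for s x
    define f where "f s y = sqrt (g y) * indicator (atom N H n s) y" for s y
    have esq: "(e s x)\<^sup>2 = h x * indicator (atom M G n s) x" for s x
      using h0[of x] by (simp add: e_def power_mult_distrib indicator_def)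
    have fsq: "(f s y)\<^sup>2 = g y * indicator (atom N H n s) y" for s y
      using g0[of y] by (simp add: f_def power_mult_distrib indicator_def)
    note [measurable] = atom_sets[of G M, OF G] atom_sets[of H N, OF H]
    have eL2: "(\<lambda>x. complex_of_real (e s x)) \<in> L2_functions M" for s
    proof (rule L2_functionsI)
      show "(\<lambda>x. complex_of_real (e s x)) \<in> borel_measurable M" unfolding e_def by measurable
      show "integrable M (\<lambda>x. (cmod (complex_of_real (e s x)))\<^sup>2)"
        unfolding norm_of_real power2_abs esq by (intro integrable_real_mult_indicator hI atom_sets G)
    qed
    have fL2: "(\<lambda>x. complex_of_real (f s x)) \<in> L2_functions N" for s
    proof (rule L2_functionsI)
      show "(\<lambda>x. complex_of_real (f s x)) \<in> borel_measurable N" unfolding f_def by measurable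
      show "integrable N (\<lambda>x. (cmod (complex_of_real (f s x)))\<^sup>2)"
        unfolding norm_of_real power2_abs fsq by (intro integrable_real_mult_indicator gI atom_sets H)
    qed
    have \<Phi>_eq: "(\<integral>z. \<phi> z * of_real ((e s (fst z))\<^sup>2 * (f s' (snd z))\<^sup>2) \<partial>(M \<Otimes>\<^sub>M N)) = \<Phi> s s'" for s s'
    proof -
      have "\<Phi> s s' = (\<integral>z. of_real (h (fst z) * g (snd z)) * (\<phi> z * indicator (atom M G n s \<times> atom N H n s') z) \<partial>(M \<Otimes>\<^sub>M N))"
        unfolding \<Phi>_def by (rule int_eq) measurable
      also have "\<dots> = (\<integral>z. \<phi> z * of_real ((e s (fst z))\<^sup>2 * (f s' (snd z))\<^sup>2) \<partial>(M \<Otimes>\<^sub>M N))"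
        unfolding esq fsq by (intro Bochner_Integration.integral_cong refl) (auto simp: indicator_def)
      finally show ?thesis ..
    qed
    obtain r :: nat and p q where pq:
      "\<And>i. i \<in> I \<Longrightarrow> (\<Sum>k<r. (cmod (p k i))\<^sup>2) \<le> C + \<epsilon>"
      "\<And>j. j \<in> J \<Longrightarrow> (\<Sum>k<r. (cmod (q k j))\<^sup>2) \<le> C + \<epsilon>"
      "\<And>i j. i \<in> I \<Longrightarrow> j \<in> J \<Longrightarrow> cmod (\<Phi> i j / of_real (\<mu> i * \<nu> j) - (\<Sum>k<r. p k i * q k j)) \<le> \<epsilon>"
    proof (rule finite_matrix_factorization[of I J C \<epsilon> "\<lambda>i j. \<Phi> i j / of_real (\<mu> i * \<nu> j)"])
      show "finite I" "finite J" by (simp_all add: I_def J_def)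
      fix u :: "nat \<Rightarrow> nat \<Rightarrow> complex" and w v :: "nat \<Rightarrow> real"
      assume w: "\<And>i. i \<in> I \<Longrightarrow> 0 < w i" and v: "\<And>j. j \<in> J \<Longrightarrow> 0 < v j"
        and uwv: "\<And>f g. Re (\<Sum>i\<in>I. \<Sum>j\<in>J. u i j * (f i * g j))
          \<le> (\<Sum>i\<in>I. w i * (cmod (f i))\<^sup>2) + (\<Sum>j\<in>J. v j * (cmod (g j))\<^sup>2)"
      have "Re (\<Sum>i\<in>I. \<Sum>j\<in>J. u i j *
         ((\<integral>z. \<phi> z * of_real ((e i (fst z))\<^sup>2 * (f j (snd z))\<^sup>2) \<partial>(M \<Otimes>\<^sub>M N)) / of_real (\<mu> i * \<nu> j)))
         \<le> C * ((\<Sum>i\<in>I. w i) + (\<Sum>j\<in>J. v j))"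
      proof (rule MN.schur_multiplier_averages[OF \<phi> less_imp_le[OF C0] C])
        show "finite I" "finite J" by (simp_all add: I_def J_def)
        show "e i x * e j x = 0" if "i \<noteq> j" for i j x
          using that by (auto simp: e_def indicator_def atom_def)
        show "f i x * f j x = 0" if "i \<noteq> j" for i j x
          using that by (auto simp: f_def indicator_def atom_def)
        show "\<mu> i = (\<integral>x. (e i x)\<^sup>2 \<partial>M)" for i unfolding \<mu>_def esq by (intro measM atom_sets G)
        show "\<nu> i = (\<integral>x. (f i x)\<^sup>2 \<partial>N)" for i unfolding \<nu>_def fsq by (intro measN atom_sets H)
      qed (use eL2 fL2 w v uwv in \<open>auto simp: I_def J_def\<close>)
      then show "Re (\<Sum>i\<in>I. \<Sum>j\<in>J. u i j * (\<Phi> i j / of_real (\<mu> i * \<nu> j))) \<le> C * ((\<Sum>i\<in>I. w i) + (\<Sum>j\<in>J. v j))"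
        unfolding \<Phi>_eq .
    qed (use C0 \<epsilon> in auto)
    show "\<exists>(r::nat) p q.
      (\<forall>s<2 ^ n. 0 < measure M' (atom M' G n s) \<longrightarrow> (\<Sum>k<r. (cmod (p k s))\<^sup>2) \<le> C + \<epsilon>) \<and>
      (\<forall>s<2 ^ n. 0 < measure N' (atom N' H n s) \<longrightarrow> (\<Sum>k<r. (cmod (q k s))\<^sup>2) \<le> C + \<epsilon>) \<and>
      (\<forall>s<2 ^ n. \<forall>s'<2 ^ n. 0 < measure M' (atom M' G n s) \<longrightarrow> 0 < measure N' (atom N' H n s') \<longrightarrow>
         cmod ((\<integral>z. \<phi> z * indicator (atom M' G n s \<times> atom N' H n s') z \<partial>(M' \<Otimes>\<^sub>M N')) /
           of_real (measure M' (atom M' G n s) * measure N' (atom N' H n s')) - (\<Sum>k<r. p k s * q k s')) \<le> \<epsilon>)"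
      unfolding atomM atomN \<mu>_def[symmetric] \<nu>_def[symmetric] \<Phi>_def[symmetric]
      by (rule exI[of _ r], rule exI[of _ p], rule exI[of _ q]) (use pq in \<open>auto simp: I_def J_def\<close>)
  qed (rule that, assumption+)
  show ?thesis
  proof (rule that[of C a b])
    show "0 \<le> C" using C0 by simp
    show "AE z in M \<Otimes>\<^sub>M N. (\<lambda>k. a k (fst z) * b k (snd z)) sums \<phi> z"
      using ab(5) unfolding AE_eq .
    show "a k \<in> borel_measurable M" "b k \<in> borel_measurable N" for k
      using ab(1)[of k] ab(2)[of k] by (simp_all cong: measurable_cong_sets)
  qed (rule ab)+
qed

lemma ell2_multiplier_norms:
  fixes a :: "nat \<Rightarrow> 'a \<Rightarrow> complex"
  assumes am: "\<And>k. a k \<in> borel_measurable M" and ab: "\<And>x K. x \<in> space M \<Longrightarrow> (\<Sum>k<K. (cmod (a k x))\<^sup>2) \<le> C"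
    and \<xi>: "\<xi> \<in> L2_functions M"
  shows "(\<lambda>x. a k x * \<xi> x) \<in> L2_functions M"
    and "(\<Sum>k<K. (L2_norm M (\<lambda>x. a k x * \<xi> x))\<^sup>2) \<le> C * (L2_norm M \<xi>)\<^sup>2"
proof -
  have sq: "cmod (a k x) \<le> sqrt C" if "x \<in> space M" for k x
  proof -
    have "(cmod (a k x))\<^sup>2 \<le> (\<Sum>k<Suc k. (cmod (a k x))\<^sup>2)" by (rule member_le_sum) auto
    also have "\<dots> \<le> C" by (rule ab[OF that])
    finally show ?thesis by (simp add: real_le_rsqrt)
  qed
  show L2: "(\<lambda>x. a k x * \<xi> x) \<in> L2_functions M" for k
    by (rule L2_bounded_mult[OF \<xi> am, where B="sqrt C"]) (use sq in auto)
  have "(\<Sum>k<K. (L2_norm M (\<lambda>x. a k x * \<xi> x))\<^sup>2) = (\<integral>x. (\<Sum>k<K. (cmod (a k x * \<xi> x))\<^sup>2) \<partial>M)"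
    unfolding L2_norm_square by (intro Bochner_Integration.integral_sum[symmetric] L2_integrable L2)
  also have "\<dots> \<le> (\<integral>x. C * (cmod (\<xi> x))\<^sup>2 \<partial>M)"
  proof (intro integral_mono Bochner_Integration.integrable_sum L2_integrable L2 integrable_mult_right \<xi>)
    fix x assume x: "x \<in> space M"
    have "(\<Sum>k<K. (cmod (a k x * \<xi> x))\<^sup>2) = (\<Sum>k<K. (cmod (a k x))\<^sup>2) * (cmod (\<xi> x))\<^sup>2"
      by (simp add: norm_mult power_mult_distrib sum_distrib_right)
    also have "\<dots> \<le> C * (cmod (\<xi> x))\<^sup>2" by (intro mult_right_mono ab x) simp
    finally show "(\<Sum>k<K. (cmod (a k x * \<xi> x))\<^sup>2) \<le> C * (cmod (\<xi> x))\<^sup>2" .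
  qed
  finally show "(\<Sum>k<K. (L2_norm M (\<lambda>x. a k x * \<xi> x))\<^sup>2) \<le> C * (L2_norm M \<xi>)\<^sup>2"
    by (simp add: L2_norm_square)
qed

text \<open>
  The partial sums of \<open>\<Sum>j. a j (x) * b j (y)\<close> are bounded by \<open>C\<close>, so the form of \<open>\<phi> k\<close> at \<open>\<xi>\<close> and \<open>\<eta>\<close> is the limit
  of sums of forms of \<open>k\<close> at \<open>a j \<xi>\<close> and \<open>b j \<eta>\<close>. The square sum of the norms of \<open>a j \<xi>\<close> is at most \<open>C\<close>
  times the squared norm of \<open>\<xi>\<close>, and likewise for \<open>\<eta>\<close>.
\<close>

lemma schur_multiplier_of_factorization:
  fixes a :: "nat \<Rightarrow> 'a \<Rightarrow> complex" and b :: "nat \<Rightarrow> 'b \<Rightarrow> complex"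
  assumes "sigma_finite_measure M" "sigma_finite_measure N"
    and \<phi>m: "\<phi> \<in> borel_measurable (M \<Otimes>\<^sub>M N)"
    and am: "\<And>k. a k \<in> borel_measurable M" and bm: "\<And>k. b k \<in> borel_measurable N"
    and ab: "\<And>x K. x \<in> space M \<Longrightarrow> (\<Sum>k<K. (cmod (a k x))\<^sup>2) \<le> C"
    and bb: "\<And>y K. y \<in> space N \<Longrightarrow> (\<Sum>k<K. (cmod (b k y))\<^sup>2) \<le> C"
    and sums: "AE z in M \<Otimes>\<^sub>M N. (\<lambda>k. a k (fst z) * b k (snd z)) sums \<phi> z"
    and C: "0 < C"
  shows "schur_multiplier M N \<phi>"
proof -
  interpret M: sigma_finite_measure M by fact
  interpret N: sigma_finite_measure N by fact
  interpret pair_sigma_finite M N ..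
  note [measurable] = \<phi>m am bm
  define S where "S K z = (\<Sum>k<K. a k (fst z) * b k (snd z))" for K z
  have Sm[measurable]: "S K \<in> borel_measurable (M \<Otimes>\<^sub>M N)" for K unfolding S_def[abs_def] by measurable
  have Sb: "cmod (S K z) \<le> C" if "z \<in> space (M \<Otimes>\<^sub>M N)" for K z
    unfolding S_def using that
    by (intro order_trans[OF norm_sum ell2_product_bound(2)[OF ab bb]]) (auto simp: space_pair_measure)
  have Slim: "AE z in M \<Otimes>\<^sub>M N. (\<lambda>K. S K z) \<longlonglongrightarrow> \<phi> z"
    using sums by eventually_elim (simp add: sums_def S_def)
  have \<phi>b: "AE z in M \<Otimes>\<^sub>M N. cmod (\<phi> z) \<le> C"
    using Slim AE_space
  proof eventually_elim
    case (elim z)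
    show ?case by (rule LIMSEQ_le_const2[OF tendsto_norm[OF elim(1)]]) (use Sb[OF elim(2)] in auto)
  qed
  have bound: "op_norm M N (integral_op M (\<lambda>z. \<phi> z * k z)) \<le> C * op_norm M N (integral_op M k)"
    if k: "k \<in> L2_functions (M \<Otimes>\<^sub>M N)" for k
  proof (rule op_norm_leI)
    define D where "D = op_norm M N (integral_op M k)"
    have D: "0 \<le> D" unfolding D_def by (rule op_norm_nonneg[OF k])
    show "(\<lambda>z. \<phi> z * k z) \<in> L2_functions (M \<Otimes>\<^sub>M N)" by (rule L2_bounded_mult[OF k \<phi>m \<phi>b])
    show "0 \<le> C * op_norm M N (integral_op M k)" using C D by (simp add: D_def)
    fix \<xi> \<eta> assume \<xi>: "\<xi> \<in> L2_functions M" and \<eta>: "\<eta> \<in> L2_functions N"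
    define F where "F z = k z * (\<xi> (fst z) * \<eta> (snd z))" for z
    have F: "integrable (M \<Otimes>\<^sub>M N) F" unfolding F_def[abs_def] by (rule kernel_form_integrable[OF k \<xi> \<eta>])
    note [measurable] = borel_measurable_integrable[OF F]
    note La = ell2_multiplier_norms[OF am ab \<xi>] and Lb = ell2_multiplier_norms[OF bm bb \<eta>]
    have "(\<lambda>K. \<integral>z. S K z * F z \<partial>(M \<Otimes>\<^sub>M N)) \<longlonglongrightarrow> (\<integral>z. \<phi> z * F z \<partial>(M \<Otimes>\<^sub>M N))"
    proof (rule integral_dominated_convergence[where w="\<lambda>z. C * cmod (F z)"])
      show "AE z in M \<Otimes>\<^sub>M N. (\<lambda>K. S K z * F z) \<longlonglongrightarrow> \<phi> z * F z"
        using Slim by eventually_elim (intro tendsto_intros)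
      show "AE z in M \<Otimes>\<^sub>M N. norm (S K z * F z) \<le> C * cmod (F z)" for K
        using Sb by (intro AE_I2) (simp add: norm_mult mult_right_mono)
      show "integrable (M \<Otimes>\<^sub>M N) (\<lambda>z. C * cmod (F z))" using F by simp
    qed measurable
    moreover have "(\<integral>z. S K z * F z \<partial>(M \<Otimes>\<^sub>M N)) = (\<Sum>j<K. kernel_form k (\<lambda>x. a j x * \<xi> x) (\<lambda>y. b j y * \<eta> y))" for K
    proof -
      have "(\<integral>z. S K z * F z \<partial>(M \<Otimes>\<^sub>M N)) = (\<integral>z. (\<Sum>j<K. k z * ((a j (fst z) * \<xi> (fst z)) * (b j (snd z) * \<eta> (snd z)))) \<partial>(M \<Otimes>\<^sub>M N))"
        by (intro Bochner_Integration.integral_cong refl) (simp add: S_def F_def sum_distrib_left sum_distrib_right mult_ac)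
      then show ?thesis
        unfolding kernel_form_def
        by (simp add: Bochner_Integration.integral_sum kernel_form_integrable[OF k La(1) Lb(1)])
    qed
    moreover have "cmod (\<Sum>j<K. kernel_form k (\<lambda>x. a j x * \<xi> x) (\<lambda>y. b j y * \<eta> y)) \<le> C * D * L2_norm M \<xi> * L2_norm N \<eta>" for K
    proof -
      have "cmod (\<Sum>j<K. kernel_form k (\<lambda>x. a j x * \<xi> x) (\<lambda>y. b j y * \<eta> y)) \<le>
         (\<Sum>j<K. D * L2_norm M (\<lambda>x. a j x * \<xi> x) * L2_norm N (\<lambda>y. b j y * \<eta> y))"
        unfolding D_def by (intro order_trans[OF norm_sum] sum_mono kernel_form_le_op_norm k La(1) Lb(1))
      also have "\<dots> = D * (\<Sum>j<K. L2_norm M (\<lambda>x. a j x * \<xi> x) * L2_norm N (\<lambda>y. b j y * \<eta> y))"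
        by (simp add: sum_distrib_left mult.assoc)
      also have "\<dots> \<le> D * (C * L2_norm M \<xi> * L2_norm N \<eta>)"
      proof (intro mult_left_mono D)
        have "(\<Sum>j<K. L2_norm M (\<lambda>x. a j x * \<xi> x) * L2_norm N (\<lambda>y. b j y * \<eta> y))\<^sup>2
          \<le> (\<Sum>j<K. (L2_norm M (\<lambda>x. a j x * \<xi> x))\<^sup>2) * (\<Sum>j<K. (L2_norm N (\<lambda>y. b j y * \<eta> y))\<^sup>2)"
          by (rule Cauchy_Schwarz_ineq_sum)
        also have "\<dots> \<le> (C * (L2_norm M \<xi>)\<^sup>2) * (C * (L2_norm N \<eta>)\<^sup>2)"
          using C by (intro mult_mono La(2) Lb(2) sum_nonneg) auto
        also have "\<dots> = (C * L2_norm M \<xi> * L2_norm N \<eta>)\<^sup>2" by (simp add: power2_eq_square)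
        finally show "(\<Sum>j<K. L2_norm M (\<lambda>x. a j x * \<xi> x) * L2_norm N (\<lambda>y. b j y * \<eta> y)) \<le> C * L2_norm M \<xi> * L2_norm N \<eta>"
          using C by (rule_tac power2_le_imp_le) auto
      qed
      finally show ?thesis by (simp add: mult_ac)
    qed
    ultimately have "cmod (\<integral>z. \<phi> z * F z \<partial>(M \<Otimes>\<^sub>M N)) \<le> C * D * L2_norm M \<xi> * L2_norm N \<eta>"
      by (intro LIMSEQ_le_const2[OF tendsto_norm]) auto
    then show "cmod (kernel_form (\<lambda>z. \<phi> z * k z) \<xi> \<eta>) \<le> C * op_norm M N (integral_op M k) * L2_norm M \<xi> * L2_norm N \<eta>"
      by (simp add: kernel_form_def F_def D_def mult.assoc)
  qed
  show ?thesis
    unfolding schur_multiplier_def Linf_functions_def using \<phi>m \<phi>b bound C by blast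
qed

lemma pair_restrict_space:
  assumes "sigma_finite_measure M" "sigma_finite_measure N"
    and A: "A \<in> sets M" and B: "B \<in> sets N"
  shows "restrict_space M A \<Otimes>\<^sub>M restrict_space N B = restrict_space (M \<Otimes>\<^sub>M N) (A \<times> B)"
proof (rule pair_measure_eqI)
  interpret N: sigma_finite_measure N by fact
  show "sigma_finite_measure (restrict_space M A)" "sigma_finite_measure (restrict_space N B)"
    using assms by (intro sigma_finite_measure_restrict_space; simp)+
  have AB: "A \<times> B \<in> sets (M \<Otimes>\<^sub>M N)" using A B by simp
  show "sets (restrict_space M A \<Otimes>\<^sub>M restrict_space N B) = sets (restrict_space (M \<Otimes>\<^sub>M N) (A \<times> B))"
  proof
    have "X \<times> Y \<in> sets (restrict_space (M \<Otimes>\<^sub>M N) (A \<times> B))"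
      if "X \<in> sets (restrict_space M A)" "Y \<in> sets (restrict_space N B)" for X Y
      using that A B AB by (auto simp: sets_restrict_space_iff)
    moreover have "space (restrict_space (M \<Otimes>\<^sub>M N) (A \<times> B)) = space (restrict_space M A) \<times> space (restrict_space N B)"
      using A B AB by simp
    ultimately show "sets (restrict_space M A \<Otimes>\<^sub>M restrict_space N B) \<subseteq> sets (restrict_space (M \<Otimes>\<^sub>M N) (A \<times> B))"
      unfolding sets_pair_measure by (intro sets.sigma_sets_subset') auto
    show "sets (restrict_space (M \<Otimes>\<^sub>M N) (A \<times> B)) \<subseteq> sets (restrict_space M A \<Otimes>\<^sub>M restrict_space N B)"
    proof
      fix E assume "E \<in> sets (restrict_space (M \<Otimes>\<^sub>M N) (A \<times> B))"
      then obtain E' where E: "E' \<in> sets (M \<Otimes>\<^sub>M N)" "E = (A \<times> B) \<inter> E'" by (auto simp: sets_restrict_space)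
      have "(\<lambda>z. (fst z, snd z)) \<in> measurable (restrict_space M A \<Otimes>\<^sub>M restrict_space N B) (M \<Otimes>\<^sub>M N)"
      proof (rule measurable_Pair)
        show "fst \<in> measurable (restrict_space M A \<Otimes>\<^sub>M restrict_space N B) M"
          by (rule measurable_compose[OF measurable_fst measurable_restrict_space1[OF measurable_ident_sets[OF refl], simplified id_def]])
        show "snd \<in> measurable (restrict_space M A \<Otimes>\<^sub>M restrict_space N B) N"
          by (rule measurable_compose[OF measurable_snd measurable_restrict_space1[OF measurable_ident_sets[OF refl], simplified id_def]])
      qed
      from measurable_sets[OF this E(1)] show "E \<in> sets (restrict_space M A \<Otimes>\<^sub>M restrict_space N B)"
        using A B by (simp add: E(2) space_pair_measure Int_commute vimage_def)
    qed
  qed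
  fix X Y assume "X \<in> sets (restrict_space M A)" "Y \<in> sets (restrict_space N B)"
  then have XY: "X \<in> sets M" "X \<subseteq> A" "Y \<in> sets N" "Y \<subseteq> B" using A B by (auto simp: sets_restrict_space_iff)
  then show "emeasure (restrict_space M A) X * emeasure (restrict_space N B) Y = emeasure (restrict_space (M \<Otimes>\<^sub>M N) (A \<times> B)) (X \<times> Y)"
    using A B AB by (subst (1 2 3) emeasure_restrict_space) (auto simp: N.emeasure_pair_measure_Times)
qed

section \<open>Compactness of coverings by rectangles\<close>

lemma second_countable_base_sequence:
  assumes "second_countable T"
  shows "\<exists>V :: nat \<Rightarrow> 'a set. (\<forall>i. openin T (V i)) \<and>
    (\<forall>U x. openin T U \<longrightarrow> x \<in> U \<longrightarrow> (\<exists>i. x \<in> V i \<and> V i \<subseteq> U))"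
proof -
  obtain \<B> where "countable \<B> \<and> (\<forall>V\<in>\<B>. openin T V) \<and>
      (\<forall>U x. openin T U \<and> x \<in> U \<longrightarrow> (\<exists>V\<in>\<B>. x \<in> V \<and> V \<subseteq> U))"
    using assms unfolding second_countable_def by (rule exE)
  then have \<B>: "countable \<B>" "\<And>V. V \<in> \<B> \<Longrightarrow> openin T V"
    "\<And>U x. openin T U \<Longrightarrow> x \<in> U \<Longrightarrow> \<exists>V\<in>\<B>. x \<in> V \<and> V \<subseteq> U"
    by simp_all
  define V where "V = from_nat_into (insert {} \<B>)"
  have r: "range V = insert {} \<B>" unfolding V_def using \<B>(1) by (intro range_from_nat_into) auto
  show ?thesis
  proof (intro exI[of _ V] conjI allI impI)
    fix i
    have "V i \<in> insert {} \<B>" unfolding r[symmetric] by simp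
    then show "openin T (V i)" using \<B>(2) by auto
  next
    fix U x assume "openin T U" "x \<in> U"
    then obtain W where "W \<in> \<B>" "x \<in> W" "W \<subseteq> U" using \<B>(3) by blast
    moreover from \<open>W \<in> \<B>\<close> have "W \<in> range V" unfolding r by simp
    ultimately show "\<exists>i. x \<in> V i \<and> V i \<subseteq> U" by auto
  qed
qed

lemma standard_borel_generating_sequence:
  assumes "standard_borel M"
  obtains G :: "nat \<Rightarrow> 'a set" where "\<And>i. G i \<in> sets M" "sets M = sigma_sets (space M) (range G)"
proof -
  obtain T where T: "topspace T = space M" "second_countable T" "sets M = sigma_sets (space M) {U. openin T U}"
    using assms unfolding standard_borel_def by blast
  from second_countable_base_sequence[OF T(2)] obtain V :: "nat \<Rightarrow> 'a set" where
    "(\<forall>i. openin T (V i)) \<and> (\<forall>U x. openin T U \<longrightarrow> x \<in> U \<longrightarrow> (\<exists>i. x \<in> V i \<and> V i \<subseteq> U))"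
    by (rule exE)
  then have V: "\<And>i. openin T (V i)" "\<And>U x. openin T U \<Longrightarrow> x \<in> U \<Longrightarrow> \<exists>i. x \<in> V i \<and> V i \<subseteq> U"
    by simp_all
  have VM: "V i \<in> sets M" for i unfolding T(3) using V(1) by (auto intro: sigma_sets.Basic)
  have "U \<in> sigma_sets (space M) (range V)" if U: "openin T U" for U
  proof -
    have "U = (\<Union>i\<in>{i. V i \<subseteq> U}. V i)" using V(2)[OF U] by blast
    also have "\<dots> \<in> sigma_sets (space M) (range V)"
    proof -
      interpret sigma_algebra "space M" "sigma_sets (space M) (range V)"
        using sets.sets_into_space[OF VM] by (intro sigma_algebra_sigma_sets) auto
      show ?thesis by (rule countable_UN'') auto
    qed
    finally show ?thesis .
  qed
  then have "sets M \<subseteq> sigma_sets (space M) (range V)" unfolding T(3) by (intro sigma_sets_mono) auto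
  moreover have "sigma_sets (space M) (range V) \<subseteq> sets M" using VM by (intro sets.sigma_sets_subset) auto
  ultimately show ?thesis using that[of V] VM by blast
qed

lemma restrict_generating_sequence:
  assumes G: "\<And>i::nat. G i \<in> sets M" and gen: "sets M = sigma_sets (space M) (range G)" and A: "A \<in> sets M"
  shows "A \<inter> G i \<in> sets (restrict_space M A)"
    and "sets (restrict_space M A) = sigma_sets (space (restrict_space M A)) (range (\<lambda>i. A \<inter> G i))"
proof -
  show "A \<inter> G i \<in> sets (restrict_space M A)" using G A by (auto simp: sets_restrict_space)
  have "sets (restrict_space M A) = (\<inter>) A ` sigma_sets (space M) (range G)"
    unfolding sets_restrict_space gen ..
  also have "\<dots> = sigma_sets A ((\<inter>) A ` range G)"
    using A sets.sets_into_space[OF A] unfolding gen by (intro sigma_sets_Int) auto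
  finally show "sets (restrict_space M A) = sigma_sets (space (restrict_space M A)) (range (\<lambda>i. A \<inter> G i))"
    using A by (simp add: image_image)
qed

text \<open>
  The sets with this property form a \<open>\<sigma>\<close>-algebra. It contains the open sets because these are countable unions of closed sets
  in a metrizable space.
\<close>

lemma (in finite_measure) borel_regular_metrizable:
  assumes T: "metrizable_space T" "topspace T = space M" "sets M = sigma_sets (space M) {U. openin T U}"
    and A: "A \<in> sets M" and e: "0 < (e::real)"
  shows "\<exists>F U. closedin T F \<and> openin T U \<and> F \<subseteq> A \<and> A \<subseteq> U \<and> measure M (U - F) < e"
proof -
  have open_M: "U \<in> sets M" if "openin T U" for U using that by (auto simp: T(3) intro: sigma_sets.Basic)
  have closed_M: "F \<in> sets M" if "closedin T F" for F
  proof -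
    have "space M - (space M - F) \<in> sets M"
      using that open_M[of "space M - F"] by (auto simp: closedin_def T(2))
    moreover have "space M - (space M - F) = F" using closedin_subset[OF that] by (auto simp: T(2))
    ultimately show ?thesis by simp
  qed
  have "\<forall>e>0. \<exists>F U. closedin T F \<and> openin T U \<and> F \<subseteq> A \<and> A \<subseteq> U \<and> measure M (U - F) < e"
    using A unfolding T(3)
  proof (induction rule: sigma_sets.induct)
    case (Basic U)
    then have U: "openin T U" by simp
    show ?case
    proof (intro allI impI)
      fix e :: real assume e: "0 < e"
      have "fsigma_in T U" using open_imp_fsigma_in[of T U] T(1) U by blast
      then obtain C where C: "\<And>n. closedin T (C n)" "\<And>n. C n \<subseteq> C (Suc n)" "\<Union> (range C) = U"
        unfolding fsigma_in_ascending by blast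
      have "(\<lambda>n. measure M (C n)) \<longlonglongrightarrow> measure M (\<Union>n. C n)"
        using C by (intro finite_Lim_measure_incseq) (auto intro!: incseq_SucI closed_M)
      then have "(\<lambda>n. measure M (C n)) \<longlonglongrightarrow> measure M U" using C(3) by simp
      then obtain n where n: "measure M U - e < measure M (C n)"
        using e order_tendstoD(1)[of _ "measure M U" sequentially "measure M U - e"]
        by (auto simp: eventually_sequentially)
      have "C n \<subseteq> U" using C(3) by auto
      then have "measure M (U - C n) < e"
        using n C(1) U by (subst finite_measure_Diff) (auto intro: open_M closed_M)
      then show "\<exists>F U'. closedin T F \<and> openin T U' \<and> F \<subseteq> U \<and> U \<subseteq> U' \<and> measure M (U' - F) < e"
        using C(1) U \<open>C n \<subseteq> U\<close> by blast
    qed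
  next
    case Empty
    show ?case by (auto intro!: exI[of _ "{}"])
  next
    case (Compl A)
    show ?case
    proof (intro allI impI)
      fix e :: real assume "0 < e"
      from Compl.IH[rule_format, OF this] obtain F U where
        "closedin T F \<and> openin T U \<and> F \<subseteq> A \<and> A \<subseteq> U \<and> measure M (U - F) < e"
        by (elim exE)
      then have FU: "closedin T F" "openin T U" "F \<subseteq> A" "A \<subseteq> U" "measure M (U - F) < e"
        by simp_all
      have "(space M - F) - (space M - U) = U - F"
        using openin_subset[OF FU(2)] by (auto simp: T(2))
      moreover have "closedin T (space M - U)" "openin T (space M - F)"
        using FU(1,2) by (auto simp: T(2)[symmetric])
      ultimately show "\<exists>F U. closedin T F \<and> openin T U \<and> F \<subseteq> space M - A \<and> space M - A \<subseteq> U \<and> measure M (U - F) < e"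
        using FU by (intro exI[of _ "space M - U"] exI[of _ "space M - F"]) auto
    qed
  next
    case (Union A)
    show ?case
    proof (intro allI impI)
      fix e :: real assume e: "0 < e"
      define \<epsilon> where "\<epsilon> i = e / 4 * (1/2) ^ i" for i :: nat
      have \<epsilon>: "0 < \<epsilon> i" for i using e by (simp add: \<epsilon>_def)
      have \<epsilon>s: "\<epsilon> sums (e / 2)"
        unfolding \<epsilon>_def[abs_def] using sums_mult[OF geometric_sums[of "1/2::real"], of "e / 4"] by simp
      have "\<forall>i. \<exists>F U. closedin T F \<and> openin T U \<and> F \<subseteq> A i \<and> A i \<subseteq> U \<and> measure M (U - F) < \<epsilon> i"
        using Union.IH[rule_format, OF \<epsilon>] by (rule allI)
      then obtain F U where FU: "\<And>i. closedin T (F i)" "\<And>i. openin T (U i)" "\<And>i. F i \<subseteq> A i" "\<And>i. A i \<subseteq> U i"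
         "\<And>i. measure M (U i - F i) < \<epsilon> i" by metis
      have [measurable]: "F i \<in> sets M" "U i \<in> sets M" for i using FU open_M closed_M by auto
      define Fn where "Fn n = (\<Union>i<n. F i)" for n
      have Fnc: "closedin T (Fn n)" for n unfolding Fn_def using FU(1) by (intro closedin_Union) auto
      have "(\<lambda>n. measure M (Fn n)) \<longlonglongrightarrow> measure M (\<Union>n. Fn n)"
      proof (rule finite_Lim_measure_incseq)
        show "range Fn \<subseteq> sets M" using closed_M[OF Fnc] by auto
        show "incseq Fn" unfolding incseq_def Fn_def by (meson UN_mono lessThan_subset_iff order_refl)
      qed
      moreover have UFn: "(\<Union>n. Fn n) = (\<Union>i. F i)" unfolding Fn_def by auto
      ultimately have "(\<lambda>n. measure M (Fn n)) \<longlonglongrightarrow> measure M (\<Union>i. F i)" by simp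
      then obtain n where n: "measure M (\<Union>i. F i) - e / 2 < measure M (Fn n)"
        using e order_tendstoD(1)[of _ "measure M (\<Union>i. F i)" sequentially "measure M (\<Union>i. F i) - e / 2"]
        by (auto simp: eventually_sequentially)
      have sub: "Fn n \<subseteq> (\<Union>i. F i)" unfolding Fn_def by auto
      have 1: "measure M ((\<Union>i. F i) - Fn n) < e / 2"
        using n sub Fnc[of n] by (subst finite_measure_Diff) (auto intro: closed_M)
      have "measure M (\<Union>i. U i - F i) \<le> (\<Sum>i. measure M (U i - F i))"
      proof (rule finite_measure_subadditive_countably)
        show "summable (\<lambda>i. measure M (U i - F i))"
          by (rule summable_comparison_test[OF _ sums_summable[OF \<epsilon>s]]) (use FU(5) in \<open>auto intro: less_imp_le\<close>)
      qed auto
      also have "\<dots> \<le> (\<Sum>i. \<epsilon> i)"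
        by (intro suminf_le sums_summable[OF \<epsilon>s] summable_comparison_test[OF _ sums_summable[OF \<epsilon>s]])
          (use FU(5) in \<open>auto intro: less_imp_le\<close>)
      also have "\<dots> = e / 2" using \<epsilon>s by (simp add: sums_iff)
      finally have 2: "measure M (\<Union>i. U i - F i) \<le> e / 2" .
      have "measure M ((\<Union>i. U i) - Fn n) \<le> measure M ((\<Union>i. U i - F i) \<union> ((\<Union>i. F i) - Fn n))"
        using closed_M[OF Fnc[of n]] by (intro finite_measure_mono) auto
      also have "\<dots> \<le> measure M (\<Union>i. U i - F i) + measure M ((\<Union>i. F i) - Fn n)"
        using closed_M[OF Fnc[of n]] by (intro measure_Un_le) auto
      finally have "measure M ((\<Union>i. U i) - Fn n) < e" using 1 2 by simp
      moreover have "Fn n \<subseteq> (\<Union>i. A i)" by (rule order_trans[OF sub UN_mono[OF order_refl FU(3)]])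
      moreover have "(\<Union>i. A i) \<subseteq> (\<Union>i. U i)" by (rule UN_mono[OF order_refl FU(4)])
      moreover have "openin T (\<Union>i. U i)" using FU(2) by auto
      ultimately show "\<exists>F U. closedin T F \<and> openin T U \<and> F \<subseteq> \<Union> (range A) \<and> \<Union> (range A) \<subseteq> U \<and> measure M (U - F) < e"
        using Fnc[of n] by (intro exI[of _ "Fn n"] exI[of _ "\<Union>i. U i"] conjI)
    qed
  qed
  then show ?thesis using e by simp
qed

text \<open>
  Ulam's argument: for each \<open>m\<close> finitely many basic sets of diameter at most \<open>1 / (m + 1)\<close> cover all but a small part
  of the space. The points covered for every \<open>m\<close> form a totally bounded set, whose closure is compact
  by completeness.
\<close>

lemma (in finite_measure) tight_completely_metrizable:
  assumes T: "completely_metrizable_space T" "second_countable T" "topspace T = space M"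
      "sets M = sigma_sets (space M) {U. openin T U}"
    and e: "0 < (e::real)"
  shows "\<exists>K. compactin T K \<and> measure M (space M - K) < e"
proof -
  obtain X d where "Metric_space X d" and compl: "Metric_space.mcomplete X d" and Td: "T = Metric_space.mtopology X d"
    using T(1) unfolding completely_metrizable_space_def by blast
  interpret Metric_space X d by fact
  have X: "X = space M" using T(3) by (simp add: Td)
  have open_M: "U \<in> sets M" if "openin T U" for U using that by (auto simp: T(4) intro: sigma_sets.Basic)
  from second_countable_base_sequence[OF T(2)] obtain V :: "nat \<Rightarrow> 'a set" where
    "(\<forall>i. openin T (V i)) \<and> (\<forall>U x. openin T U \<longrightarrow> x \<in> U \<longrightarrow> (\<exists>i. x \<in> V i \<and> V i \<subseteq> U))"
    by (rule exE)
  then have V: "\<And>i. openin T (V i)" "\<And>U x. openin T U \<Longrightarrow> x \<in> U \<Longrightarrow> \<exists>i. x \<in> V i \<and> V i \<subseteq> U"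
    by simp_all
  define small where "small m i \<longleftrightarrow> (\<forall>x\<in>V i. \<forall>y\<in>V i. d x y < 1 / real (Suc m))" for m i
  define U where "U m n = (\<Union>i\<in>{i. i < n \<and> small m i}. V i)" for m n
  have Uo: "openin T (U m n)" for m n unfolding U_def using V(1) by (intro openin_Union) auto
  note [measurable] = open_M[OF Uo]
  have cover: "(\<Union>n. U m n) = space M" for m
  proof
    show "(\<Union>n. U m n) \<subseteq> space M" using openin_subset[OF Uo] by (auto simp: T(3))
    show "space M \<subseteq> (\<Union>n. U m n)"
    proof
      fix x assume x: "x \<in> space M"
      define r where "r = 1 / (2 * real (Suc m))"
      have "openin T (mball x r)" by (simp add: Td openin_mball)
      moreover have "x \<in> mball x r" unfolding centre_in_mball_iff using x X by (auto simp: r_def)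
      ultimately obtain i where i: "x \<in> V i" "V i \<subseteq> mball x r" using V(2) by blast
      have "small m i"
        unfolding small_def
      proof (intro ballI)
        fix y z assume "y \<in> V i" "z \<in> V i"
        then have "y \<in> mball x r" "z \<in> mball x r" using i by auto
        then have "d x y < r" "d x z < r" "y \<in> X" "z \<in> X" "x \<in> X" by auto
        then have "d y z < r + r" using triangle[of y x z] by (simp add: commute)
        also have "r + r = 1 / real (Suc m)" by (simp add: r_def field_simps)
        finally show "d y z < 1 / real (Suc m)" .
      qed
      then have "x \<in> U m (Suc i)" using i by (auto simp: U_def)
      then show "x \<in> (\<Union>n. U m n)" by blast
    qed
  qed
  define \<epsilon> where "\<epsilon> i = e / 4 * (1/2) ^ i" for i :: nat
  have \<epsilon>: "0 < \<epsilon> i" for i using e by (simp add: \<epsilon>_def)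
  have \<epsilon>s: "\<epsilon> sums (e / 2)"
    unfolding \<epsilon>_def[abs_def] using sums_mult[OF geometric_sums[of "1/2::real"], of "e / 4"] by simp
  have "\<exists>n. measure M (space M - U m n) < \<epsilon> m" for m
  proof -
    have "(\<lambda>n. measure M (U m n)) \<longlonglongrightarrow> measure M (\<Union>n. U m n)"
    proof (rule finite_Lim_measure_incseq)
      show "range (U m) \<subseteq> sets M" using open_M[OF Uo] by auto
      show "incseq (U m)" unfolding incseq_def U_def by (intro allI impI UN_mono) auto
    qed
    then have "(\<lambda>n. measure M (U m n)) \<longlonglongrightarrow> measure M (space M)" by (simp add: cover)
    then obtain n where n: "measure M (space M) - \<epsilon> m < measure M (U m n)"
      using \<epsilon>[of m] order_tendstoD(1)[of _ "measure M (space M)" sequentially "measure M (space M) - \<epsilon> m"]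
      by (auto simp: eventually_sequentially)
    then have "measure M (space M - U m n) < \<epsilon> m" by (simp add: finite_measure_compl)
    then show ?thesis by blast
  qed
  then obtain n where n: "\<And>m. measure M (space M - U m (n m)) < \<epsilon> m" by metis
  define S where "S = (\<Inter>m. U m (n m))"
  have S_M: "S \<in> sets M" unfolding S_def by measurable
  have SX: "S \<subseteq> X" unfolding S_def X using cover by blast
  have "mtotally_bounded S"
    unfolding mtotally_bounded_def
  proof (intro allI impI)
    fix \<delta> :: real assume "0 < \<delta>"
    then obtain m where m: "1 / real (Suc m) < \<delta>" using nat_approx_posE by blast
    define J where "J = {i. i < n m \<and> small m i \<and> V i \<inter> S \<noteq> {}}"
    have "\<forall>i\<in>J. \<exists>s. s \<in> V i \<inter> S" by (auto simp: J_def)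
    then obtain s where s: "\<And>i. i \<in> J \<Longrightarrow> s i \<in> V i \<inter> S" by metis
    show "\<exists>K. finite K \<and> K \<subseteq> S \<and> S \<subseteq> (\<Union>x\<in>K. mball x \<delta>)"
    proof (intro exI[of _ "s ` J"] conjI)
      show "finite (s ` J)" by (simp add: J_def)
      show "s ` J \<subseteq> S" using s by auto
      show "S \<subseteq> (\<Union>x\<in>s ` J. mball x \<delta>)"
      proof
        fix x assume x: "x \<in> S"
        then have "x \<in> U m (n m)" by (auto simp: S_def)
        then obtain i where i: "i < n m" "small m i" "x \<in> V i" by (auto simp: U_def)
        then have iJ: "i \<in> J" using x by (auto simp: J_def)
        have "d (s i) x < 1 / real (Suc m)" using i s[OF iJ] by (auto simp: small_def)
        then have "x \<in> mball (s i) \<delta>" using m s[OF iJ] x SX by auto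
        then show "x \<in> (\<Union>x\<in>s ` J. mball x \<delta>)" using iJ by blast
      qed
    qed
  qed
  then have K: "compactin T (T closure_of S)"
    unfolding Td using mtotally_bounded_eq_compact_closure_of[OF compl] by blast
  have "closedin T (T closure_of S)" by simp
  then have "openin T (space M - T closure_of S)" unfolding closedin_def T(3) by blast
  have "measure M (space M - T closure_of S) \<le> measure M (\<Union>m. space M - U m (n m))"
  proof (rule finite_measure_mono)
    have "S \<subseteq> T closure_of S" using SX by (intro closure_of_subset) (simp add: Td)
    then show "space M - T closure_of S \<subseteq> (\<Union>m. space M - U m (n m))" by (auto simp: S_def)
  qed measurable
  also have "\<dots> \<le> (\<Sum>m. measure M (space M - U m (n m)))"
  proof (rule finite_measure_subadditive_countably)
    show "summable (\<lambda>m. measure M (space M - U m (n m)))"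
      by (rule summable_comparison_test[OF _ sums_summable[OF \<epsilon>s]]) (use n in \<open>auto intro: less_imp_le\<close>)
  qed auto
  also have "\<dots> \<le> (\<Sum>i. \<epsilon> i)"
    by (intro suminf_le sums_summable[OF \<epsilon>s] summable_comparison_test[OF _ sums_summable[OF \<epsilon>s]])
      (use n in \<open>auto intro: less_imp_le\<close>)
  also have "\<dots> = e / 2" using \<epsilon>s by (simp add: sums_iff)
  finally have "measure M (space M - T closure_of S) < e" using e by simp
  with K show ?thesis by blast
qed

text \<open>
  Each \<open>\<alpha> m\<close> has an open neighbourhood \<open>U m\<close> that exceeds it by little. Off the union of the excesses,
  \<open>\<alpha> m\<close> and \<open>U m\<close> coincide, and the complement of that union contains a large compact set.
\<close>

lemma (in finite_measure) compact_relatively_open_traces: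
  assumes T: "completely_metrizable_space T" "second_countable T" "topspace T = space M"
      "sets M = sigma_sets (space M) {U. openin T U}"
    and \<alpha>: "\<And>m::nat. \<alpha> m \<in> sets M" and X0: "X\<^sub>0 \<in> null_sets M" and e: "0 < (e::real)"
  shows "\<exists>K. compactin T K \<and> K \<in> sets M \<and> K \<inter> X\<^sub>0 = {} \<and> measure M (space M - K) < e \<and>
    (\<forall>m. \<exists>U. openin T U \<and> \<alpha> m \<inter> K = U \<inter> K)"
proof -
  have met: "metrizable_space T" using T(1) by (rule completely_metrizable_imp_metrizable_space)
  have open_M: "U \<in> sets M" if "openin T U" for U using that by (auto simp: T(4) intro: sigma_sets.Basic)
  have closed_M: "F \<in> sets M" if "closedin T F" for F
  proof -
    have "space M - (space M - F) \<in> sets M"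
      using that open_M[of "space M - F"] by (auto simp: closedin_def T(3))
    moreover have "space M - (space M - F) = F" using closedin_subset[OF that] by (auto simp: T(3))
    ultimately show ?thesis by simp
  qed
  define \<epsilon> where "\<epsilon> i = e / 8 * (1/2) ^ i" for i :: nat
  have \<epsilon>: "0 < \<epsilon> i" for i using e by (simp add: \<epsilon>_def)
  have \<epsilon>s: "\<epsilon> sums (e / 4)"
    unfolding \<epsilon>_def[abs_def] using sums_mult[OF geometric_sums[of "1/2::real"], of "e / 8"] by simp
  have "\<exists>U. openin T U \<and> \<alpha> m \<subseteq> U \<and> measure M (U - \<alpha> m) < \<epsilon> m" for m
  proof -
    obtain F U where FU: "closedin T F" "openin T U" "F \<subseteq> \<alpha> m" "\<alpha> m \<subseteq> U" "measure M (U - F) < \<epsilon> m"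
      using borel_regular_metrizable[OF met T(3,4) \<alpha> \<epsilon>] by metis
    have "measure M (U - \<alpha> m) \<le> measure M (U - F)"
      using FU open_M closed_M by (intro finite_measure_mono) auto
    then show ?thesis using FU by (intro exI[of _ U]) auto
  qed
  then obtain U where U: "\<And>m. openin T (U m)" "\<And>m. \<alpha> m \<subseteq> U m" "\<And>m. measure M (U m - \<alpha> m) < \<epsilon> m" by metis
  note [measurable] = \<alpha> open_M[OF U(1)]
  define W where "W = (\<Union>m. U m - \<alpha> m)"
  have [measurable]: "W \<in> sets M" unfolding W_def by measurable
  have [measurable]: "X\<^sub>0 \<in> sets M" using X0 by auto
  have "measure M W \<le> (\<Sum>m. measure M (U m - \<alpha> m))"
    unfolding W_def
  proof (rule finite_measure_subadditive_countably)
    show "summable (\<lambda>m. measure M (U m - \<alpha> m))"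
      by (rule summable_comparison_test[OF _ sums_summable[OF \<epsilon>s]]) (use U(3) in \<open>auto intro: less_imp_le\<close>)
  qed auto
  also have "\<dots> \<le> (\<Sum>i. \<epsilon> i)"
    by (intro suminf_le sums_summable[OF \<epsilon>s] summable_comparison_test[OF _ sums_summable[OF \<epsilon>s]])
      (use U(3) in \<open>auto intro: less_imp_le\<close>)
  also have "\<dots> = e / 4" using \<epsilon>s by (simp add: sums_iff)
  finally have W: "measure M W \<le> e / 4" .
  define B where "B = space M - X\<^sub>0 - W"
  have B_M[measurable]: "B \<in> sets M" unfolding B_def by measurable
  have e4: "0 < e / 4" using e by simp
  obtain F V where F: "closedin T F" "openin T V" "F \<subseteq> B" "B \<subseteq> V" "measure M (V - F) < e / 4"
    using borel_regular_metrizable[OF met T(3,4) B_M e4] by metis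
  obtain K0 where K0: "compactin T K0" "measure M (space M - K0) < e / 4"
    using tight_completely_metrizable[OF T e4] by blast
  have haus: "Hausdorff_space T" using met by (rule metrizable_imp_Hausdorff_space)
  have K0c: "closedin T K0" using haus K0(1) by (rule compactin_imp_closedin)
  note [measurable] = closed_M[OF F(1)] closed_M[OF K0c] open_M[OF F(2)]
  define K where "K = F \<inter> K0"
  have [measurable]: "K \<in> sets M" unfolding K_def by measurable
  have "measure M (space M - K) \<le> measure M ((X\<^sub>0 \<union> W) \<union> ((V - F) \<union> (space M - K0)))"
    using F by (intro finite_measure_mono) (auto simp: K_def B_def)
  also have "\<dots> \<le> (measure M X\<^sub>0 + measure M W) + (measure M (V - F) + measure M (space M - K0))"
    by (intro order_trans[OF measure_Un_le] add_mono) auto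
  also have "\<dots> < e" using W F(5) K0(2) e X0 by (simp add: measure_eq_0_null_sets)
  finally have meas: "measure M (space M - K) < e" .
  have "\<alpha> m \<inter> K = U m \<inter> K" for m
    using U(2)[of m] F(3) by (auto simp: K_def B_def W_def)
  moreover have "compactin T K" unfolding K_def using F(1) K0(1) by (intro closed_Int_compactin)
  moreover have "K \<inter> X\<^sub>0 = {}" using F(3) by (auto simp: K_def B_def)
  ultimately show ?thesis using meas U(1) \<open>K \<in> sets M\<close> by blast
qed

lemma sigma_finite_equivalent_finite:
  assumes "sigma_finite_measure M"
  obtains M' where "finite_measure M'" "sets M' = sets M" "space M' = space M" "null_sets M' = null_sets M"
proof -
  interpret sigma_finite_measure M by fact
  obtain h :: "'a \<Rightarrow> real" where hm[measurable]: "h \<in> borel_measurable M" and h0: "\<And>x. 0 < h x" and hI: "integrable M h"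
    using obtain_positive_integrable_function by metis
  define M' where "M' = density M (\<lambda>x. ennreal (h x))"
  have "finite_measure M'" unfolding M'_def by (rule finite_measure_density(1)[OF hI h0])
  moreover have "null_sets M' = null_sets M"
  proof -
    have "N \<in> null_sets M' \<longleftrightarrow> N \<in> null_sets M" for N
    proof -
      have "N \<in> null_sets M' \<longleftrightarrow> N \<in> sets M \<and> (AE x in M. x \<in> N \<longrightarrow> ennreal (h x) = 0)"
        unfolding M'_def by (rule null_sets_density_iff) simp
      also have "\<dots> \<longleftrightarrow> N \<in> sets M \<and> (AE x in M. x \<notin> N)"
      proof -
        have "ennreal (h x) \<noteq> 0" for x using h0[of x] by (simp add: ennreal_eq_0_iff not_le)
        then show ?thesis by simp
      qed
      also have "\<dots> \<longleftrightarrow> N \<in> null_sets M" using AE_iff_null_sets by blast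
      finally show ?thesis .
    qed
    then show ?thesis by blast
  qed
  ultimately show ?thesis using that[of M'] by (simp add: M'_def)
qed

lemma compact_exhaustion:
  assumes M: "sigma_finite_measure M"
    and T: "completely_metrizable_space T" "second_countable T" "topspace T = space M"
      "sets M = sigma_sets (space M) {U. openin T U}"
    and \<alpha>: "\<And>m::nat. \<alpha> m \<in> sets M" and X0: "X\<^sub>0 \<in> null_sets M"
  shows "\<exists>K :: nat \<Rightarrow> 'a set. (\<forall>j. compactin T (K j) \<and> K j \<in> sets M \<and> K j \<inter> X\<^sub>0 = {} \<and>
      (\<forall>m. \<exists>U. openin T U \<and> \<alpha> m \<inter> K j = U \<inter> K j)) \<and> space M - (\<Union>j. K j) \<in> null_sets M"
proof -
  obtain M' where M': "finite_measure M'" "sets M' = sets M" "space M' = space M" "null_sets M' = null_sets M"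
    using sigma_finite_equivalent_finite[OF M] by metis
  interpret M': finite_measure M' by fact
  have "\<forall>j::nat. \<exists>K. compactin T K \<and> K \<in> sets M \<and> K \<inter> X\<^sub>0 = {} \<and> measure M' (space M - K) < 1 / real (Suc j) \<and>
    (\<forall>m. \<exists>U. openin T U \<and> \<alpha> m \<inter> K = U \<inter> K)"
    using M'.compact_relatively_open_traces[of T \<alpha> X\<^sub>0] T \<alpha> X0 unfolding M'(2,3,4) by simp
  then obtain K where K: "\<And>j::nat. compactin T (K j)" "\<And>j. K j \<in> sets M" "\<And>j. K j \<inter> X\<^sub>0 = {}"
    "\<And>j. measure M' (space M - K j) < 1 / real (Suc j)" "\<And>j m. \<exists>U. openin T U \<and> \<alpha> m \<inter> K j = U \<inter> K j"
    by metis
  define R where "R = space M - (\<Union>j. K j)"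
  have R_M: "R \<in> sets M" unfolding R_def using K(2) by auto
  have "measure M' R \<le> 0"
  proof (rule LIMSEQ_le_const)
    show "(\<lambda>j. 1 / real (Suc j)) \<longlonglongrightarrow> 0" using LIMSEQ_inverse_real_of_nat by (simp add: inverse_eq_divide)
    have "measure M' R \<le> 1 / real (Suc j)" for j
    proof -
      have "measure M' R \<le> measure M' (space M - K j)"
        using K(2) by (intro M'.finite_measure_mono) (auto simp: R_def M')
      then show ?thesis using K(4)[of j] by simp
    qed
    then show "\<exists>N. \<forall>n\<ge>N. measure M' R \<le> 1 / real (Suc n)" by blast
  qed
  then have "R \<in> null_sets M'"
    using R_M by (intro null_setsI) (auto simp: M' M'.emeasure_eq_measure ennreal_eq_0_iff)
  then have "R \<in> null_sets M" by (simp add: M')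
  then show ?thesis using K unfolding R_def by (intro exI[of _ K]) auto
qed

lemma compact_rectangle_finite_cover:
  assumes K: "compactin T K" and L: "compactin T' L"
    and \<alpha>: "\<And>m::nat. \<exists>U. openin T U \<and> \<alpha> m \<inter> K = U \<inter> K" and \<beta>: "\<And>m. \<exists>U. openin T' U \<and> \<beta> m \<inter> L = U \<inter> L"
    and cov: "K \<times> L \<subseteq> (\<Union>m. \<alpha> m \<times> \<beta> m)"
  shows "\<exists>n. K \<times> L \<subseteq> (\<Union>m<n. \<alpha> m \<times> \<beta> m)"
proof -
  obtain U where U: "\<And>m. openin T (U m)" "\<And>m. \<alpha> m \<inter> K = U m \<inter> K" using \<alpha> by metis
  obtain V where V: "\<And>m. openin T' (V m)" "\<And>m. \<beta> m \<inter> L = V m \<inter> L" using \<beta> by metis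
  have comp: "compactin (prod_topology T T') (K \<times> L)" using K L by (simp add: compactin_Times)
  have op: "\<And>W. W \<in> range (\<lambda>m. U m \<times> V m) \<Longrightarrow> openin (prod_topology T T') W"
    using U(1) V(1) by (auto simp: openin_prod_Times_iff)
  have sub: "K \<times> L \<subseteq> \<Union>(range (\<lambda>m. U m \<times> V m))"
  proof
    fix z assume z: "z \<in> K \<times> L"
    then obtain m where "z \<in> \<alpha> m \<times> \<beta> m" using cov by blast
    then have "z \<in> U m \<times> V m" using z U(2)[of m] V(2)[of m] by (cases z) blast
    then show "z \<in> \<Union>(range (\<lambda>m. U m \<times> V m))" by blast
  qed
  obtain \<F> where F: "finite \<F>" "\<F> \<subseteq> range (\<lambda>m. U m \<times> V m)" "K \<times> L \<subseteq> \<Union>\<F>"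
    using compactinD[OF comp op sub] by metis
  obtain I where I: "finite I" "\<F> = (\<lambda>m. U m \<times> V m) ` I" using finite_subset_image[OF F(1,2)] by auto
  obtain n where n: "I \<subseteq> {..<n}" using finite_nat_iff_bounded I(1) by blast
  have "K \<times> L \<subseteq> (\<Union>m<n. \<alpha> m \<times> \<beta> m)"
  proof
    fix z assume z: "z \<in> K \<times> L"
    then obtain m where m: "m \<in> I" "z \<in> U m \<times> V m" using F(3) I(2) by auto
    then have "z \<in> \<alpha> m \<times> \<beta> m" using z U(2)[of m] V(2)[of m] by (cases z) blast
    then show "z \<in> (\<Union>m<n. \<alpha> m \<times> \<beta> m)" using m n by blast
  qed
  then show ?thesis by blast
qed

text \<open>
  On compact sets in which the sides of the rectangles are relatively open, the covering has a finite subcovering.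
  Compact sets of this kind that avoid the exceptional null sets exhaust both spaces; they are then made disjoint.
\<close>

lemma covering_family_finite_blocks:
  assumes X: "standard_sigma_finite X" and Y: "standard_sigma_finite Y" and cov: "covering_family X Y \<alpha> \<beta>"
  obtains D :: "nat \<Rightarrow> 'a set" and E :: "nat \<Rightarrow> 'b set" where
    "\<And>i. D i \<in> sets X" "disjoint_family D" "space X - (\<Union>i. D i) \<in> null_sets X"
    "\<And>j. E j \<in> sets Y" "disjoint_family E" "space Y - (\<Union>j. E j) \<in> null_sets Y"
    "\<And>i j. \<exists>n. D i \<times> E j \<subseteq> (\<Union>m<n. \<alpha> m \<times> \<beta> m)"
proof -
  have \<alpha>: "\<alpha> m \<in> sets X" and \<beta>: "\<beta> m \<in> sets Y" for m using cov by (auto simp: covering_family_def)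
  obtain X0 Y0 where null: "X0 \<in> null_sets X" "Y0 \<in> null_sets Y"
    and sd: "sym_diff (\<Union>m. \<alpha> m \<times> \<beta> m) (space X \<times> space Y) \<subseteq> (X0 \<times> space Y) \<union> (space X \<times> Y0)"
    using cov unfolding covering_family_def marginally_equivalent_def marginally_null_def by blast
  obtain T where T: "completely_metrizable_space T" "second_countable T" "topspace T = space X"
      "sets X = sigma_sets (space X) {U. openin T U}"
    using X unfolding standard_sigma_finite_def standard_borel_def by blast
  obtain T' where T': "completely_metrizable_space T'" "second_countable T'" "topspace T' = space Y"
      "sets Y = sigma_sets (space Y) {U. openin T' U}"
    using Y unfolding standard_sigma_finite_def standard_borel_def by blast
  have sX: "sigma_finite_measure X" and sY: "sigma_finite_measure Y"
    using X Y by (auto simp: standard_sigma_finite_def)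
  obtain K where "(\<forall>j::nat. compactin T (K j) \<and> K j \<in> sets X \<and> K j \<inter> X0 = {} \<and>
      (\<forall>m. \<exists>U. openin T U \<and> \<alpha> m \<inter> K j = U \<inter> K j)) \<and> space X - (\<Union>j. K j) \<in> null_sets X"
    using compact_exhaustion[OF sX T \<alpha> null(1)] by (rule exE)
  then have K: "\<And>j. compactin T (K j)" "\<And>j. K j \<in> sets X" "\<And>j. K j \<inter> X0 = {}"
    "\<And>j m. \<exists>U. openin T U \<and> \<alpha> m \<inter> K j = U \<inter> K j" "space X - (\<Union>j. K j) \<in> null_sets X"
    by auto
  obtain L where "(\<forall>j::nat. compactin T' (L j) \<and> L j \<in> sets Y \<and> L j \<inter> Y0 = {} \<and>
      (\<forall>m. \<exists>U. openin T' U \<and> \<beta> m \<inter> L j = U \<inter> L j)) \<and> space Y - (\<Union>j. L j) \<in> null_sets Y"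
    using compact_exhaustion[OF sY T' \<beta> null(2)] by (rule exE)
  then have L: "\<And>j. compactin T' (L j)" "\<And>j. L j \<in> sets Y" "\<And>j. L j \<inter> Y0 = {}"
    "\<And>j m. \<exists>U. openin T' U \<and> \<beta> m \<inter> L j = U \<inter> L j" "space Y - (\<Union>j. L j) \<in> null_sets Y"
    by auto
  have fin: "\<exists>n. K i \<times> L j \<subseteq> (\<Union>m<n. \<alpha> m \<times> \<beta> m)" for i j
  proof (rule compact_rectangle_finite_cover[OF K(1) L(1) K(4) L(4)])
    show "K i \<times> L j \<subseteq> (\<Union>m. \<alpha> m \<times> \<beta> m)"
    proof (rule subsetI, rule ccontr)
      fix z assume z: "z \<in> K i \<times> L j" and nz: "z \<notin> (\<Union>m. \<alpha> m \<times> \<beta> m)"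
      have "z \<in> space X \<times> space Y"
        using z sets.sets_into_space[OF K(2)[of i]] sets.sets_into_space[OF L(2)[of j]] by auto
      with nz have "z \<in> sym_diff (\<Union>m. \<alpha> m \<times> \<beta> m) (space X \<times> space Y)" by simp
      with sd have "z \<in> (X0 \<times> space Y) \<union> (space X \<times> Y0)" by (rule subsetD)
      then show False using z K(3)[of i] L(3)[of j] by auto
    qed
  qed
  show ?thesis
  proof (rule that[of "disjointed K" "disjointed L"])
    show "disjointed K i \<in> sets X" for i using sets.range_disjointed_sets[of K X] K(2) by auto
    show "disjointed L i \<in> sets Y" for i using sets.range_disjointed_sets[of L Y] L(2) by auto
    show "\<exists>n. disjointed K i \<times> disjointed L j \<subseteq> (\<Union>m<n. \<alpha> m \<times> \<beta> m)" for i j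
      using fin[of i j] disjointed_subset[of K i] disjointed_subset[of L j] by blast
  qed (use K(5) L(5) in \<open>simp_all add: disjoint_family_disjointed UN_disjointed_eq\<close>)
qed

section \<open>Gluing factorizations over rectangles\<close>

text \<open>
  The bounds hold at every point, which is no restriction because the functions may be set to \<open>0\<close> on a null set.
\<close>

definition bounded_factorization :: "'a measure \<Rightarrow> 'b measure \<Rightarrow> ('a \<times> 'b \<Rightarrow> complex) \<Rightarrow> bool" where
  "bounded_factorization M N f \<longleftrightarrow> (\<exists>C (a :: nat \<Rightarrow> 'a \<Rightarrow> complex) (b :: nat \<Rightarrow> 'b \<Rightarrow> complex).
     (\<forall>k. a k \<in> borel_measurable M) \<and> (\<forall>k. b k \<in> borel_measurable N) \<and>
     (\<forall>x K. (\<Sum>k<K. (cmod (a k x))\<^sup>2) \<le> C) \<and> (\<forall>y K. (\<Sum>k<K. (cmod (b k y))\<^sup>2) \<le> C) \<and>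
     (AE z in M \<Otimes>\<^sub>M N. (\<lambda>k. a k (fst z) * b k (snd z)) sums f z))"

lemma bounded_factorizationI:
  fixes a :: "nat \<Rightarrow> 'a \<Rightarrow> complex" and b :: "nat \<Rightarrow> 'b \<Rightarrow> complex"
  assumes "\<And>k. a k \<in> borel_measurable M" "\<And>k. b k \<in> borel_measurable N"
    and "\<And>x K. (\<Sum>k<K. (cmod (a k x))\<^sup>2) \<le> C" "\<And>y K. (\<Sum>k<K. (cmod (b k y))\<^sup>2) \<le> C"
    and "AE z in M \<Otimes>\<^sub>M N. (\<lambda>k. a k (fst z) * b k (snd z)) sums f z"
  shows "bounded_factorization M N f"
  unfolding bounded_factorization_def using assms by blast

lemma bounded_factorizationE:
  assumes "bounded_factorization M N f"
  obtains C and a :: "nat \<Rightarrow> 'a \<Rightarrow> complex" and b :: "nat \<Rightarrow> 'b \<Rightarrow> complex" where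
    "\<And>k. a k \<in> borel_measurable M" "\<And>k. b k \<in> borel_measurable N"
    "\<And>x K. (\<Sum>k<K. (cmod (a k x))\<^sup>2) \<le> C" "\<And>y K. (\<Sum>k<K. (cmod (b k y))\<^sup>2) \<le> C"
    "AE z in M \<Otimes>\<^sub>M N. (\<lambda>k. a k (fst z) * b k (snd z)) sums f z" "0 \<le> C"
proof -
  obtain C a b where *: "(\<forall>k. a k \<in> borel_measurable M) \<and> (\<forall>k. b k \<in> borel_measurable N) \<and>
     (\<forall>x K. (\<Sum>k<K. (cmod (a k x))\<^sup>2) \<le> C) \<and> (\<forall>y K. (\<Sum>k<K. (cmod (b k y))\<^sup>2) \<le> C) \<and>
     (AE z in M \<Otimes>\<^sub>M N. (\<lambda>k. a k (fst z) * b k (snd z)) sums f z)"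
    using assms unfolding bounded_factorization_def by (elim exE)
  from * have "(\<Sum>k<0. (cmod (a k undefined))\<^sup>2) \<le> C" by blast
  then show ?thesis using * that[of a b C] by simp
qed

lemma complex_sums_interleave:
  fixes f g :: "nat \<Rightarrow> complex"
  assumes "f sums x" "g sums y"
  shows "(\<lambda>n. if even n then f (n div 2) else g ((n - 1) div 2)) sums (x + y)"
  using assms sums_if[of "\<lambda>n. Re (g n)" "Re y" "\<lambda>n. Re (f n)" "Re x"] sums_if[of "\<lambda>n. Im (g n)" "Im y" "\<lambda>n. Im (f n)" "Im x"]
  by (simp add: sums_complex_iff if_distrib[of Re] if_distrib[of Im] add.commute cong: if_cong)

lemma interleave_square_bound:
  fixes f g :: "nat \<Rightarrow> complex"
  assumes f: "\<And>K. (\<Sum>k<K. (cmod (f k))\<^sup>2) \<le> C" and g: "\<And>K. (\<Sum>k<K. (cmod (g k))\<^sup>2) \<le> D"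
  shows "(\<Sum>k<K. (cmod (if even k then f (k div 2) else g ((k - 1) div 2)))\<^sup>2) \<le> C + D"
proof -
  have "(\<Sum>k<K. (cmod (if even k then f (k div 2) else g ((k - 1) div 2)))\<^sup>2)
      \<le> (\<Sum>k<2 * K. (cmod (if even k then f (k div 2) else g ((k - 1) div 2)))\<^sup>2)"
    by (intro sum_mono2) auto
  also have "\<dots> = (\<Sum>k<2 * K. if even k then (cmod (f (k div 2)))\<^sup>2 else (cmod (g ((k - 1) div 2)))\<^sup>2)"
    by (intro sum.cong) auto
  also have "\<dots> = (\<Sum>k<K. (cmod (f k))\<^sup>2) + (\<Sum>k<K. (cmod (g k))\<^sup>2)"
    by (subst sum_split_even_odd) simp
  also have "\<dots> \<le> C + D" by (intro add_mono f g)
  finally show ?thesis .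
qed

lemma bounded_factorization_add:
  assumes f: "bounded_factorization M N f" and g: "bounded_factorization M N g"
  shows "bounded_factorization M N (\<lambda>z. f z + g z)"
proof -
  from f obtain C a b where f: "\<And>k. a k \<in> borel_measurable M" "\<And>k. b k \<in> borel_measurable N"
    "\<And>x K. (\<Sum>k<K. (cmod (a k x))\<^sup>2) \<le> C" "\<And>y K. (\<Sum>k<K. (cmod (b k y))\<^sup>2) \<le> C"
    "AE z in M \<Otimes>\<^sub>M N. (\<lambda>k. a k (fst z) * b k (snd z)) sums f z"
    by (rule bounded_factorizationE) blast
  from g obtain D c d where g: "\<And>k. c k \<in> borel_measurable M" "\<And>k. d k \<in> borel_measurable N"
    "\<And>x K. (\<Sum>k<K. (cmod (c k x))\<^sup>2) \<le> D" "\<And>y K. (\<Sum>k<K. (cmod (d k y))\<^sup>2) \<le> D"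
    "AE z in M \<Otimes>\<^sub>M N. (\<lambda>k. c k (fst z) * d k (snd z)) sums g z"
    by (rule bounded_factorizationE) blast
  show ?thesis
  proof (rule bounded_factorizationI[where a="\<lambda>k x. if even k then a (k div 2) x else c ((k - 1) div 2) x"
        and b="\<lambda>k y. if even k then b (k div 2) y else d ((k - 1) div 2) y" and C="C + D"])
    show "(\<lambda>x. if even k then a (k div 2) x else c ((k - 1) div 2) x) \<in> borel_measurable M" for k
      using f(1) g(1) by (cases "even k") simp_all
    show "(\<lambda>x. if even k then b (k div 2) x else d ((k - 1) div 2) x) \<in> borel_measurable N" for k
      using f(2) g(2) by (cases "even k") simp_all
    show "(\<Sum>k<K. (cmod (if even k then a (k div 2) x else c ((k - 1) div 2) x))\<^sup>2) \<le> C + D" for x K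
      by (rule interleave_square_bound[where f="\<lambda>k. a k x" and g="\<lambda>k. c k x"]) (rule f g)+
    show "(\<Sum>k<K. (cmod (if even k then b (k div 2) x else d ((k - 1) div 2) x))\<^sup>2) \<le> C + D" for x K
      by (rule interleave_square_bound[where f="\<lambda>k. b k x" and g="\<lambda>k. d k x"]) (rule f g)+
    show "AE z in M \<Otimes>\<^sub>M N. (\<lambda>k. (if even k then a (k div 2) (fst z) else c ((k - 1) div 2) (fst z)) *
        (if even k then b (k div 2) (snd z) else d ((k - 1) div 2) (snd z))) sums (f z + g z)"
      using f(5) g(5)
    proof eventually_elim
      case (elim z)
      have "(\<lambda>k. (if even k then a (k div 2) (fst z) else c ((k - 1) div 2) (fst z)) *
        (if even k then b (k div 2) (snd z) else d ((k - 1) div 2) (snd z))) =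
        (\<lambda>k. if even k then a (k div 2) (fst z) * b (k div 2) (snd z)
          else c ((k - 1) div 2) (fst z) * d ((k - 1) div 2) (snd z))" by auto
      then show ?case using complex_sums_interleave[OF elim] by simp
    qed
  qed
qed

lemma bounded_factorization_mult_tensor:
  assumes f: "bounded_factorization M N f"
    and p: "p \<in> borel_measurable M" "\<And>x. cmod (p x) \<le> 1" and q: "q \<in> borel_measurable N" "\<And>y. cmod (q y) \<le> 1"
  shows "bounded_factorization M N (\<lambda>z. p (fst z) * q (snd z) * f z)"
proof -
  from f obtain C a b where f: "\<And>k. a k \<in> borel_measurable M" "\<And>k. b k \<in> borel_measurable N"
    "\<And>x K. (\<Sum>k<K. (cmod (a k x))\<^sup>2) \<le> C" "\<And>y K. (\<Sum>k<K. (cmod (b k y))\<^sup>2) \<le> C"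
    "AE z in M \<Otimes>\<^sub>M N. (\<lambda>k. a k (fst z) * b k (snd z)) sums f z"
    by (rule bounded_factorizationE) blast
  have le: "(\<Sum>k<K. (cmod (c * h k))\<^sup>2) \<le> (\<Sum>k<K. (cmod (h k))\<^sup>2)" if "cmod c \<le> 1" for c and h :: "nat \<Rightarrow> complex" and K
    using that by (intro sum_mono) (simp add: norm_mult power_mult_distrib mult_left_le_one_le power_le_one)
  show ?thesis
  proof (rule bounded_factorizationI[where a="\<lambda>k x. p x * a k x" and b="\<lambda>k y. q y * b k y" and C=C])
    show "(\<lambda>x. p x * a k x) \<in> borel_measurable M" "(\<lambda>y. q y * b k y) \<in> borel_measurable N" for k
      using f(1,2) p(1) q(1) by simp_all
    show "(\<Sum>k<K. (cmod (p x * a k x))\<^sup>2) \<le> C" for x K by (rule order_trans[OF le[OF p(2)] f(3)])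
    show "(\<Sum>k<K. (cmod (q y * b k y))\<^sup>2) \<le> C" for y K by (rule order_trans[OF le[OF q(2)] f(4)])
    show "AE z in M \<Otimes>\<^sub>M N. (\<lambda>k. p (fst z) * a k (fst z) * (q (snd z) * b k (snd z))) sums (p (fst z) * q (snd z) * f z)"
      using f(5)
    proof eventually_elim
      case (elim z)
      from sums_mult[OF this, of "p (fst z) * q (snd z)"] show ?case by (simp add: mult_ac)
    qed
  qed
qed

lemma bounded_factorization_rectangle:
  assumes f: "bounded_factorization M N f" and A: "A \<in> sets M" and B: "B \<in> sets N"
  shows "bounded_factorization M N (\<lambda>z. indicator (A \<times> B) z * f z)"
    and "bounded_factorization M N (\<lambda>z. - (indicator (A \<times> B) z * f z))"
proof -
  have 1: "(\<lambda>z. indicator (A \<times> B) z * f z) = (\<lambda>z. indicator A (fst z) * indicator B (snd z) * f z)"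
    by (auto simp: fun_eq_iff indicator_def)
  show "bounded_factorization M N (\<lambda>z. indicator (A \<times> B) z * f z)"
    unfolding 1 by (rule bounded_factorization_mult_tensor[OF f]) (use A B in \<open>auto simp: indicator_def\<close>)
  have 2: "(\<lambda>z. - (indicator (A \<times> B) z * f z)) = (\<lambda>z. (- indicator A (fst z)) * indicator B (snd z) * f z)"
    by (auto simp: fun_eq_iff indicator_def)
  show "bounded_factorization M N (\<lambda>z. - (indicator (A \<times> B) z * f z))"
    unfolding 2 by (rule bounded_factorization_mult_tensor[OF f]) (use A B in \<open>auto simp: indicator_def\<close>)
qed

text \<open>
  By induction, since the indicator of \<open>U \<union> R\<close> is the sum of the indicators of \<open>U\<close> and \<open>R\<close> minus their product.
\<close>

lemma bounded_factorization_finite_union: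
  fixes \<alpha> :: "nat \<Rightarrow> 'a set" and \<beta> :: "nat \<Rightarrow> 'b set" and \<phi> :: "'a \<times> 'b \<Rightarrow> complex"
  assumes \<alpha>: "\<And>m. \<alpha> m \<in> sets M" and \<beta>: "\<And>m. \<beta> m \<in> sets N"
    and f: "\<And>m. bounded_factorization M N (\<lambda>z. indicator (\<alpha> m \<times> \<beta> m) z * \<phi> z)"
  shows "bounded_factorization M N (\<lambda>z. indicator (\<Union>m<n. \<alpha> m \<times> \<beta> m) z * \<phi> z)"
proof -
  define U where "U n = (\<Union>m<n. \<alpha> m \<times> \<beta> m)" for n
  define R where "R n = \<alpha> n \<times> \<beta> n" for n
  have US: "U (Suc n) = U n \<union> R n" for n by (auto simp: U_def R_def less_Suc_eq)
  have zero: "bounded_factorization M N (\<lambda>z. 0)"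
    by (rule bounded_factorizationI[where a="\<lambda>_ _. 0" and b="\<lambda>_ _. 0" and C=0]) auto
  have rect: "bounded_factorization M N (\<lambda>z. indicator (R n) z * g z)"
      "bounded_factorization M N (\<lambda>z. - (indicator (R n) z * g z))"
    if "bounded_factorization M N g" for g n
    unfolding R_def by (rule bounded_factorization_rectangle[OF that \<alpha> \<beta>])+
  have sub: "bounded_factorization M N (\<lambda>z. indicator (U n) z * g z)" if g: "bounded_factorization M N g" for g n
  proof (induction n)
    case 0
    then show ?case using zero by (simp add: U_def)
  next
    case (Suc n)
    have "(\<lambda>z. indicator (U (Suc n)) z * g z) = (\<lambda>z. (indicator (U n) z * g z + indicator (R n) z * g z) + - (indicator (R n) z * (indicator (U n) z * g z)))"
      unfolding US by (auto simp: fun_eq_iff indicator_def)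
    then show ?case
      using bounded_factorization_add[OF bounded_factorization_add[OF Suc.IH rect(1)[OF g]] rect(2)[OF Suc.IH]] by simp
  qed
  have "bounded_factorization M N (\<lambda>z. indicator (U n) z * \<phi> z)"
  proof (induction n)
    case 0
    then show ?case using zero by (simp add: U_def)
  next
    case (Suc n)
    have f': "bounded_factorization M N (\<lambda>z. indicator (R n) z * \<phi> z)" using f[of n] by (simp add: R_def)
    have "(\<lambda>z. indicator (U (Suc n)) z * \<phi> z) = (\<lambda>z. (indicator (U n) z * \<phi> z + indicator (R n) z * \<phi> z) + - (indicator (R n) z * (indicator (U n) z * (indicator (R n) z * \<phi> z))))"
      unfolding US by (auto simp: fun_eq_iff indicator_def)
    then show ?case
      using bounded_factorization_add[OF bounded_factorization_add[OF Suc.IH f'] rect(2)[OF sub[OF f']]] by simp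
  qed
  then show ?thesis by (simp add: U_def)
qed

lemma strict_mono_prod_encode_last: "strict_mono (\<lambda>k. prod_encode (i, prod_encode (j, k)))"
proof -
  have 1: "prod_encode (m, n) < prod_encode (m, Suc n)" for m n
    by (simp add: prod_encode_def)
  have mono: "strict_mono (\<lambda>n. prod_encode (m, n))" for m
    unfolding strict_mono_Suc_iff using 1 by blast
  show ?thesis using mono[of i] mono[of j] by (auto simp: strict_mono_def)
qed

text \<open>
  The first \<open>N\<close> triples in the enumeration have entries below \<open>N\<close>, so they lie in a cube.
\<close>

lemma decoded_sum_le:
  fixes F :: "nat \<Rightarrow> nat \<Rightarrow> nat \<Rightarrow> real"
  assumes F: "\<And>i j k. 0 \<le> F i j k"
  shows "(\<Sum>n<N. case prod_decode n of (i, p) \<Rightarrow> case prod_decode p of (j, k) \<Rightarrow> F i j k)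
    \<le> (\<Sum>i<N. \<Sum>j<N. \<Sum>k<N. F i j k)"
proof -
  define e where "e n = (case prod_decode n of (i, p) \<Rightarrow> (i, prod_decode p))" for n
  have e_inv: "prod_encode (fst (e n), prod_encode (snd (e n))) = n" for n
    by (simp add: e_def split: prod.splits) (metis prod_decode_inverse)
  have inj: "inj_on e {..<N}" by (rule inj_on_inverseI[of _ "\<lambda>t. prod_encode (fst t, prod_encode (snd t))"]) (rule e_inv)
  have range: "e ` {..<N} \<subseteq> {..<N} \<times> {..<N} \<times> {..<N}"
  proof
    fix t assume "t \<in> e ` {..<N}"
    then obtain n where n: "n < N" "t = e n" by auto
    obtain i j k where t: "t = (i, j, k)" by (cases t)
    have en: "e n = (i, j, k)" using n(2) t by simp
    have np: "n = prod_encode (i, prod_encode (j, k))" using e_inv[of n] unfolding en by simp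
    have "i \<le> n" "prod_encode (j, k) \<le> n" "j \<le> prod_encode (j, k)" "k \<le> prod_encode (j, k)"
      unfolding np by (simp_all add: le_prod_encode_1 le_prod_encode_2)
    then show "t \<in> {..<N} \<times> {..<N} \<times> {..<N}" unfolding t using n(1) by simp
  qed
  have "(\<Sum>n<N. case prod_decode n of (i, p) \<Rightarrow> case prod_decode p of (j, k) \<Rightarrow> F i j k) =
      (\<Sum>n<N. (case e n of (i, j, k) \<Rightarrow> F i j k))"
    by (intro sum.cong refl) (auto simp: e_def split: prod.splits)
  also have "\<dots> = (\<Sum>(i, j, k)\<in>e ` {..<N}. F i j k)" by (subst sum.reindex[OF inj]) simp
  also have "\<dots> \<le> (\<Sum>(i, j, k)\<in>{..<N} \<times> {..<N} \<times> {..<N}. F i j k)"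
    using range F by (intro sum_mono2) auto
  also have "\<dots> = (\<Sum>i<N. \<Sum>j<N. \<Sum>k<N. F i j k)" by (simp add: sum.cartesian_product)
  finally show ?thesis .
qed

lemma summable_if_eventually_geometric:
  fixes f c :: "nat \<Rightarrow> real"
  assumes f: "\<And>n. 0 \<le> f n" and le: "\<And>N. (\<Sum>n<N. f n) \<le> (\<Sum>j<N. c j)"
    and c: "\<And>j. i0 \<le> j \<Longrightarrow> c j \<le> (1/2) ^ j" and c0: "\<And>j. 0 \<le> c j"
  shows "summable f"
proof (rule summableI_nonneg_bounded[where x="(\<Sum>j<i0. c j) + 2", OF f])
  fix N
  have "(\<Sum>n<N. f n) \<le> (\<Sum>j<N. c j)" by (rule le)
  also have "\<dots> \<le> (\<Sum>j<N. (if j < i0 then c j else 0) + (1/2) ^ j)"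
    using c by (intro sum_mono) auto
  also have "\<dots> = (\<Sum>j<N. if j < i0 then c j else 0) + (\<Sum>j<N. (1/2) ^ j)" by (rule sum.distrib)
  also have "(\<Sum>j<N. if j < i0 then c j else 0) \<le> (\<Sum>j<i0. c j)"
  proof -
    have "(\<Sum>j<N. if j < i0 then c j else 0) = (\<Sum>j\<in>{..<N} \<inter> {..<i0}. c j)"
      by (simp add: sum.inter_restrict)
    also have "\<dots> \<le> (\<Sum>j<i0. c j)" using c0 by (intro sum_mono2) auto
    finally show ?thesis .
  qed
  also have "(\<Sum>j<N. (1/2::real) ^ j) \<le> 2"
    using sum_le_suminf[OF summable_geometric, of "1/2::real" "{..<N}"] suminf_geometric[of "1/2::real"] by simp
  finally show "(\<Sum>n<N. f n) \<le> (\<Sum>j<i0. c j) + 2" by simp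
qed

text \<open>
  The terms of all blocks are enumerated through triples of a row \<open>i\<close>, a column \<open>j\<close> and an index \<open>k\<close>. On the block of
  \<open>i\<close> and \<open>j\<close> the squares of the first functions are multiplied and those of the second ones divided by
  \<open>s i j\<close>. For \<open>i \<le> j\<close> this factor makes the first square sum at most \<open>(1/2) ^ j\<close>, and for \<open>j < i\<close> it makes the second one at
  most \<open>(1/2) ^ i\<close>. A point of \<open>D i\<close> meets the blocks of row \<open>i\<close> only, and all but finitely many of them have \<open>i \<le> j\<close>;
  columns are symmetric. At each point of the product a single block contributes, so the sum is \<open>\<phi>\<close>.
\<close>

lemma glue_block_factorizations:
  fixes D :: "nat \<Rightarrow> 'a set" and E :: "nat \<Rightarrow> 'b set" and \<phi> :: "'a \<times> 'b \<Rightarrow> complex"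
  assumes D: "\<And>i. D i \<in> sets M" "disjoint_family D" and E: "\<And>j. E j \<in> sets N" "disjoint_family E"
    and fac: "\<And>i j. bounded_factorization M N (\<lambda>z. indicator (D i \<times> E j) z * \<phi> z)"
  obtains a :: "nat \<Rightarrow> 'a \<Rightarrow> complex" and b :: "nat \<Rightarrow> 'b \<Rightarrow> complex" where
    "\<And>n. a n \<in> borel_measurable M" "\<And>n. b n \<in> borel_measurable N"
    "\<And>x. summable (\<lambda>n. (cmod (a n x))\<^sup>2)" "\<And>y. summable (\<lambda>n. (cmod (b n y))\<^sup>2)"
    "AE z in M \<Otimes>\<^sub>M N. z \<in> (\<Union>i. D i) \<times> (\<Union>j. E j) \<longrightarrow> (\<lambda>n. a n (fst z) * b n (snd z)) sums \<phi> z"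
proof -
  define good where "good i j C a b \<longleftrightarrow> 0 \<le> C \<and> (\<forall>k. a k \<in> borel_measurable M) \<and> (\<forall>k. b k \<in> borel_measurable N) \<and>
     (\<forall>x K. (\<Sum>k<K. (cmod (a k x))\<^sup>2) \<le> C) \<and> (\<forall>y K. (\<Sum>k<K. (cmod (b k y))\<^sup>2) \<le> C) \<and>
     (AE z in M \<Otimes>\<^sub>M N. (\<lambda>k. a k (fst z) * b k (snd z)) sums (indicator (D i \<times> E j) z * \<phi> z))"
    for i j and C :: real and a :: "nat \<Rightarrow> 'a \<Rightarrow> complex" and b :: "nat \<Rightarrow> 'b \<Rightarrow> complex"
  have "\<exists>C a b. good i j C a b" for i j
    using fac[of i j] unfolding good_def by (rule bounded_factorizationE) blast
  then obtain C a b where good: "\<And>i j. good i j (C i j) (a i j) (b i j)" by metis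
  have C: "0 \<le> C i j" and am: "a i j k \<in> borel_measurable M" and bm: "b i j k \<in> borel_measurable N"
    and ab: "(\<Sum>k<K. (cmod (a i j k x))\<^sup>2) \<le> C i j" and bb: "(\<Sum>k<K. (cmod (b i j k y))\<^sup>2) \<le> C i j"
    and sums: "AE z in M \<Otimes>\<^sub>M N. (\<lambda>k. a i j k (fst z) * b i j k (snd z)) sums (indicator (D i \<times> E j) z * \<phi> z)"
    for i j k x y K
    using good[of i j] unfolding good_def by blast+
  define s where "s i j = (if i \<le> j then (1/2) ^ j / (C i j + 1) else (C i j + 1) * 2 ^ i)" for i j
  have C1: "0 < C i j + 1" for i j using C[of i j] by simp
  have s: "0 < s i j" for i j using C1[of i j] by (simp add: s_def)
  define aa where "aa i j k x = indicator (D i) x * (of_real (sqrt (s i j)) * a i j k x)" for i j k x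
  define bb' where "bb' i j k y = indicator (E j) y * (of_real (1 / sqrt (s i j)) * b i j k y)" for i j k y
  define a' where "a' n x = (case prod_decode n of (i, p) \<Rightarrow> case prod_decode p of (j, k) \<Rightarrow> aa i j k x)" for n x
  define b' where "b' n y = (case prod_decode n of (i, p) \<Rightarrow> case prod_decode p of (j, k) \<Rightarrow> bb' i j k y)" for n y
  have sqa: "(cmod (aa i j k x))\<^sup>2 = indicator (D i) x * (s i j * (cmod (a i j k x))\<^sup>2)" for i j k x
    using s[of i j] by (simp add: aa_def norm_mult power_mult_distrib indicator_def)
  have sqb: "(cmod (bb' i j k y))\<^sup>2 = indicator (E j) y * ((cmod (b i j k y))\<^sup>2 / s i j)" for i j k y
    using s[of i j] by (simp add: bb'_def norm_mult norm_divide power_mult_distrib power_divide indicator_def)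
  have single: "(\<Sum>i<N. g i) \<le> g i0" if "\<And>i. i \<noteq> i0 \<Longrightarrow> g i = 0" "0 \<le> g i0" for g :: "nat \<Rightarrow> real" and i0 N
  proof -
    have "(\<Sum>i<N. g i) = (\<Sum>i\<in>{..<N} \<inter> {i0}. g i)" using that by (intro sum.mono_neutral_right) auto
    also have "\<dots> \<le> (\<Sum>i\<in>{i0}. g i)" using that by (intro sum_mono2) auto
    finally show ?thesis by simp
  qed
  show ?thesis
  proof (rule that[of a' b'])
    have "aa i j k \<in> borel_measurable M" for i j k
      unfolding aa_def[abs_def] using am[of i j k] D(1)[of i] by simp
    then show "a' n \<in> borel_measurable M" for n
      unfolding a'_def[abs_def] by (simp split: prod.splits)
    have "bb' i j k \<in> borel_measurable N" for i j k
      unfolding bb'_def[abs_def] using bm[of i j k] E(1)[of j] by simp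
    then show "b' n \<in> borel_measurable N" for n
      unfolding b'_def[abs_def] by (simp split: prod.splits)
    show "summable (\<lambda>n. (cmod (a' n x))\<^sup>2)" for x
    proof (cases "\<exists>i. x \<in> D i")
      case False
      then have "a' n x = 0" for n by (simp add: a'_def aa_def split: prod.splits)
      then show ?thesis by simp
    next
      case True
      then obtain i0 where i0: "x \<in> D i0" by blast
      have other: "x \<notin> D i" if "i \<noteq> i0" for i using D(2) i0 that by (auto simp: disjoint_family_on_def)
      show ?thesis
      proof (rule summable_if_eventually_geometric[where c="\<lambda>j. s i0 j * (C i0 j + 1)" and ?i0.0=i0])
        show "0 \<le> (cmod (a' n x))\<^sup>2" for n by simp
        show "s i0 j * (C i0 j + 1) \<le> (1/2) ^ j" if "i0 \<le> j" for j
          using C1[of i0 j] that by (simp add: s_def)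
        show "0 \<le> s i0 j * (C i0 j + 1)" for j using s[of i0 j] C1[of i0 j] by simp
        fix N
        have "(\<Sum>n<N. (cmod (a' n x))\<^sup>2) = (\<Sum>n<N. case prod_decode n of (i, p) \<Rightarrow> case prod_decode p of (j, k) \<Rightarrow> (cmod (aa i j k x))\<^sup>2)"
          by (intro sum.cong refl) (simp add: a'_def split: prod.splits)
        also have "\<dots> \<le> (\<Sum>i<N. \<Sum>j<N. \<Sum>k<N. (cmod (aa i j k x))\<^sup>2)" by (rule decoded_sum_le) simp
        also have "\<dots> \<le> (\<Sum>j<N. \<Sum>k<N. (cmod (aa i0 j k x))\<^sup>2)"
          by (rule single) (auto simp: aa_def other intro!: sum_nonneg)
        also have "\<dots> \<le> (\<Sum>j<N. s i0 j * (C i0 j + 1))"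
        proof (rule sum_mono)
          fix j
          have "(\<Sum>k<N. (cmod (aa i0 j k x))\<^sup>2) = s i0 j * (\<Sum>k<N. (cmod (a i0 j k x))\<^sup>2)"
            by (simp add: sqa i0 sum_distrib_left)
          also have "\<dots> \<le> s i0 j * (C i0 j + 1)"
            using s[of i0 j] ab[where i=i0 and j=j and x=x and K=N] by (intro mult_left_mono) auto
          finally show "(\<Sum>k<N. (cmod (aa i0 j k x))\<^sup>2) \<le> s i0 j * (C i0 j + 1)" .
        qed
        finally show "(\<Sum>n<N. (cmod (a' n x))\<^sup>2) \<le> (\<Sum>j<N. s i0 j * (C i0 j + 1))" .
      qed
    qed
    show "summable (\<lambda>n. (cmod (b' n y))\<^sup>2)" for y
    proof (cases "\<exists>j. y \<in> E j")
      case False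
      then have "b' n y = 0" for n by (simp add: b'_def bb'_def split: prod.splits)
      then show ?thesis by simp
    next
      case True
      then obtain j0 where j0: "y \<in> E j0" by blast
      have other: "y \<notin> E j" if "j \<noteq> j0" for j using E(2) j0 that by (auto simp: disjoint_family_on_def)
      show ?thesis
      proof (rule summable_if_eventually_geometric[where c="\<lambda>i. (C i j0 + 1) / s i j0" and ?i0.0="Suc j0"])
        show "0 \<le> (cmod (b' n y))\<^sup>2" for n by simp
        show "(C i j0 + 1) / s i j0 \<le> (1/2) ^ i" if "Suc j0 \<le> i" for i
          using C1[of i j0] that by (simp add: s_def power_one_over field_simps)
        show "0 \<le> (C i j0 + 1) / s i j0" for i using s[of i j0] C1[of i j0] by simp
        fix N
        have "(\<Sum>n<N. (cmod (b' n y))\<^sup>2) = (\<Sum>n<N. case prod_decode n of (i, p) \<Rightarrow> case prod_decode p of (j, k) \<Rightarrow> (cmod (bb' i j k y))\<^sup>2)"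
          by (intro sum.cong refl) (simp add: b'_def split: prod.splits)
        also have "\<dots> \<le> (\<Sum>i<N. \<Sum>j<N. \<Sum>k<N. (cmod (bb' i j k y))\<^sup>2)" by (rule decoded_sum_le) simp
        also have "\<dots> \<le> (\<Sum>i<N. (C i j0 + 1) / s i j0)"
        proof (rule sum_mono)
          fix i
          have "(\<Sum>j<N. \<Sum>k<N. (cmod (bb' i j k y))\<^sup>2) \<le> (\<Sum>k<N. (cmod (bb' i j0 k y))\<^sup>2)"
            by (rule single) (auto simp: bb'_def other intro!: sum_nonneg)
          also have "\<dots> = (\<Sum>k<N. (cmod (b i j0 k y))\<^sup>2) / s i j0"
            by (simp add: sqb j0 sum_divide_distrib)
          also have "\<dots> \<le> (C i j0 + 1) / s i j0"
            using s[of i j0] bb[where i=i and j=j0 and y=y and K=N] by (intro divide_right_mono) auto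
          finally show "(\<Sum>j<N. \<Sum>k<N. (cmod (bb' i j k y))\<^sup>2) \<le> (C i j0 + 1) / s i j0" .
        qed
        finally show "(\<Sum>n<N. (cmod (b' n y))\<^sup>2) \<le> (\<Sum>i<N. (C i j0 + 1) / s i j0)" .
      qed
    qed
    have "AE z in M \<Otimes>\<^sub>M N. \<forall>i j. (\<lambda>k. a i j k (fst z) * b i j k (snd z)) sums (indicator (D i \<times> E j) z * \<phi> z)"
      using sums by (simp add: AE_all_countable)
    then show "AE z in M \<Otimes>\<^sub>M N. z \<in> (\<Union>i. D i) \<times> (\<Union>j. E j) \<longrightarrow> (\<lambda>n. a' n (fst z) * b' n (snd z)) sums \<phi> z"
    proof eventually_elim
      case (elim z)
      show ?case
      proof
        assume "z \<in> (\<Union>i. D i) \<times> (\<Union>j. E j)"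
        then obtain i j where ij: "fst z \<in> D i" "snd z \<in> E j" by auto
        have zin: "z \<in> D i \<times> E j" using ij by (simp add: mem_Times_iff)
        have oD: "fst z \<notin> D i'" if "i' \<noteq> i" for i' using D(2) ij that by (auto simp: disjoint_family_on_def)
        have oE: "snd z \<notin> E j'" if "j' \<noteq> j" for j' using E(2) ij that by (auto simp: disjoint_family_on_def)
        define g where "g k = prod_encode (i, prod_encode (j, k))" for k
        have "(\<lambda>k. a' (g k) (fst z) * b' (g k) (snd z)) sums \<phi> z"
        proof -
          have "a' (g k) (fst z) * b' (g k) (snd z) = a i j k (fst z) * b i j k (snd z)" for k
          proof -
            have "complex_of_real (sqrt (s i j)) * of_real (1 / sqrt (s i j)) = 1"
              using s[of i j] unfolding of_real_mult[symmetric] by simp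
            moreover have "a' (g k) (fst z) * b' (g k) (snd z) =
               (complex_of_real (sqrt (s i j)) * of_real (1 / sqrt (s i j))) * (a i j k (fst z) * b i j k (snd z))"
              using ij by (simp add: a'_def b'_def g_def aa_def bb'_def)
            ultimately show ?thesis by simp
          qed
          then show ?thesis using elim[rule_format, of i j] zin by simp
        qed
        moreover have "a' n (fst z) * b' n (snd z) = 0" if n: "n \<notin> range g" for n
        proof -
          obtain i' p where ip: "prod_decode n = (i', p)" by (cases "prod_decode n")
          obtain j' k where jk: "prod_decode p = (j', k)" by (cases "prod_decode p")
          have "n = prod_encode (i', prod_encode (j', k))" using ip jk by (metis prod_decode_inverse)
          with n have "i' \<noteq> i \<or> j' \<noteq> j" by (auto simp: g_def)
          then show ?thesis using oD oE by (auto simp: a'_def b'_def ip jk aa_def bb'_def)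
        qed
        ultimately show "(\<lambda>n. a' n (fst z) * b' n (snd z)) sums \<phi> z"
          using sums_mono_reindex[of g "\<lambda>n. a' n (fst z) * b' n (snd z)" "\<phi> z"] strict_mono_prod_encode_last[of i j]
          unfolding g_def by blast
      qed
    qed
  qed
qed

text \<open>
  Factorizations on the rectangles of the covering family, extended by \<open>0\<close>, restrict to the blocks and are glued there.
\<close>

lemma local_schur_multiplier_imp_V:
  assumes X: "standard_sigma_finite X" and Y: "standard_sigma_finite Y"
    and loc: "local_schur_multiplier X Y \<phi>"
  shows "\<phi> \<in> V_functions X Y"
proof -
  have sX: "sigma_finite_measure X" and sY: "sigma_finite_measure Y" and bX: "standard_borel X" and bY: "standard_borel Y"
    using X Y by (auto simp: standard_sigma_finite_def)
  interpret X: sigma_finite_measure X by fact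
  interpret Y: sigma_finite_measure Y by fact
  have \<phi>: "\<phi> \<in> borel_measurable (X \<Otimes>\<^sub>M Y)" using loc by (simp add: local_schur_multiplier_def)
  obtain \<alpha> \<beta> where cov: "covering_family X Y \<alpha> \<beta>"
    and schur: "\<And>m. schur_multiplier (restrict_space X (\<alpha> m)) (restrict_space Y (\<beta> m)) \<phi>"
    using loc unfolding local_schur_multiplier_def by blast
  have \<alpha>: "\<alpha> m \<in> sets X" and \<beta>: "\<beta> m \<in> sets Y" for m using cov by (auto simp: covering_family_def)
  obtain G :: "nat \<Rightarrow> 'a set" where G: "\<And>i. G i \<in> sets X" "sets X = sigma_sets (space X) (range G)"
    using standard_borel_generating_sequence[OF bX] by metis
  obtain H :: "nat \<Rightarrow> 'b set" where H: "\<And>i. H i \<in> sets Y" "sets Y = sigma_sets (space Y) (range H)"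
    using standard_borel_generating_sequence[OF bY] by metis
  have block: "bounded_factorization X Y (\<lambda>z. indicator (\<alpha> m \<times> \<beta> m) z * \<phi> z)" for m
  proof -
    have sA: "sigma_finite_measure (restrict_space X (\<alpha> m))" and sB: "sigma_finite_measure (restrict_space Y (\<beta> m))"
      using sigma_finite_measure_restrict_space[OF sX \<alpha>] sigma_finite_measure_restrict_space[OF sY \<beta>] by blast+
    obtain C a b where ab: "\<And>k. a k \<in> borel_measurable (restrict_space X (\<alpha> m))" "\<And>k. b k \<in> borel_measurable (restrict_space Y (\<beta> m))"
      "\<And>x K. (\<Sum>k<K. (cmod (a k x))\<^sup>2) \<le> C" "\<And>y K. (\<Sum>k<K. (cmod (b k y))\<^sup>2) \<le> C"
      "AE z in restrict_space X (\<alpha> m) \<Otimes>\<^sub>M restrict_space Y (\<beta> m). (\<lambda>k. a k (fst z) * b k (snd z)) sums \<phi> z" "0 \<le> C"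
      by (rule schur_multiplier_factorization[OF sA sB restrict_generating_sequence[OF G \<alpha>] restrict_generating_sequence[OF H \<beta>] schur])
        blast
    show ?thesis
    proof (rule bounded_factorizationI[where a="\<lambda>k x. indicator (\<alpha> m) x *\<^sub>R a k x" and b="\<lambda>k y. indicator (\<beta> m) y *\<^sub>R b k y" and C=C])
      show "(\<lambda>x. indicator (\<alpha> m) x *\<^sub>R a k x) \<in> borel_measurable X" for k
        using ab(1)[of k] \<alpha>[of m] by (simp add: borel_measurable_restrict_space_iff)
      show "(\<lambda>x. indicator (\<beta> m) x *\<^sub>R b k x) \<in> borel_measurable Y" for k
        using ab(2)[of k] \<beta>[of m] by (simp add: borel_measurable_restrict_space_iff)
      show "(\<Sum>k<K. (cmod (indicator (\<alpha> m) x *\<^sub>R a k x))\<^sup>2) \<le> C" for x K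
        using ab(3)[of x K] ab(6) by (cases "x \<in> \<alpha> m") simp_all
      show "(\<Sum>k<K. (cmod (indicator (\<beta> m) y *\<^sub>R b k y))\<^sup>2) \<le> C" for y K
        using ab(4)[of y K] ab(6) by (cases "y \<in> \<beta> m") simp_all
      have "AE z in X \<Otimes>\<^sub>M Y. z \<in> \<alpha> m \<times> \<beta> m \<longrightarrow> (\<lambda>k. a k (fst z) * b k (snd z)) sums \<phi> z"
        using ab(5) \<alpha>[of m] \<beta>[of m] unfolding pair_restrict_space[OF sX sY \<alpha> \<beta>]
        by (subst (asm) AE_restrict_space_iff) auto
      then show "AE z in X \<Otimes>\<^sub>M Y. (\<lambda>k. (indicator (\<alpha> m) (fst z) *\<^sub>R a k (fst z)) * (indicator (\<beta> m) (snd z) *\<^sub>R b k (snd z)))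
          sums (indicator (\<alpha> m \<times> \<beta> m) z * \<phi> z)"
      proof eventually_elim
        case (elim z)
        show ?case
        proof (cases "z \<in> \<alpha> m \<times> \<beta> m")
          case True
          then show ?thesis using elim by (auto simp: mem_Times_iff)
        next
          case False
          then have "fst z \<notin> \<alpha> m \<or> snd z \<notin> \<beta> m" by (auto simp: mem_Times_iff)
          then have "(\<lambda>k. (indicator (\<alpha> m) (fst z) *\<^sub>R a k (fst z)) * (indicator (\<beta> m) (snd z) *\<^sub>R b k (snd z))) = (\<lambda>k. 0)"
            by (auto simp: fun_eq_iff)
          then show ?thesis using False by simp
        qed
      qed
    qed
  qed
  obtain D :: "nat \<Rightarrow> 'a set" and E :: "nat \<Rightarrow> 'b set" where D: "\<And>i. D i \<in> sets X" "disjoint_family D" "space X - (\<Union>i. D i) \<in> null_sets X"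
    and E: "\<And>j. E j \<in> sets Y" "disjoint_family E" "space Y - (\<Union>j. E j) \<in> null_sets Y"
    and DE: "\<And>i j. \<exists>n. D i \<times> E j \<subseteq> (\<Union>m<n. \<alpha> m \<times> \<beta> m)"
    by (rule covering_family_finite_blocks[OF X Y cov]) blast
  have fac: "bounded_factorization X Y (\<lambda>z. indicator (D i \<times> E j) z * \<phi> z)" for i j
  proof -
    obtain n where n: "D i \<times> E j \<subseteq> (\<Union>m<n. \<alpha> m \<times> \<beta> m)" using DE by blast
    have "(\<lambda>z. indicator (D i \<times> E j) z * \<phi> z) =
        (\<lambda>z. indicator (D i \<times> E j) z * (indicator (\<Union>m<n. \<alpha> m \<times> \<beta> m) z * \<phi> z))"
      using n by (auto simp: fun_eq_iff indicator_def)
    moreover have "bounded_factorization X Y (\<lambda>z. indicator (\<Union>m<n. \<alpha> m \<times> \<beta> m) z * \<phi> z)"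
      by (rule bounded_factorization_finite_union[OF \<alpha> \<beta> block])
    ultimately show ?thesis
      using bounded_factorization_rectangle(1)[OF _ D(1)[of i] E(1)[of j]] by simp
  qed
  obtain a b where ab: "\<And>n. a n \<in> borel_measurable X" "\<And>n. b n \<in> borel_measurable Y"
    "\<And>x. summable (\<lambda>n. (cmod (a n x))\<^sup>2)" "\<And>y. summable (\<lambda>n. (cmod (b n y))\<^sup>2)"
    and sums: "AE z in X \<Otimes>\<^sub>M Y. z \<in> (\<Union>i. D i) \<times> (\<Union>j. E j) \<longrightarrow> (\<lambda>n. a n (fst z) * b n (snd z)) sums \<phi> z"
    by (rule glue_block_factorizations[OF D(1,2) E(1,2) fac]) blast
  have N1: "(space X - (\<Union>i. D i)) \<times> space Y \<in> null_sets (X \<Otimes>\<^sub>M Y)"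
  proof -
    have "A \<times> space Y \<in> null_sets (X \<Otimes>\<^sub>M Y)" if "A \<in> null_sets X" for A
      using null_setsD1[OF that] null_setsD2[OF that] by (intro null_setsI) (simp_all add: Y.emeasure_pair_measure_Times)
    then show ?thesis using D(3) by blast
  qed
  have N2: "space X \<times> (space Y - (\<Union>j. E j)) \<in> null_sets (X \<Otimes>\<^sub>M Y)"
  proof -
    have "space X \<times> A \<in> null_sets (X \<Otimes>\<^sub>M Y)" if "A \<in> null_sets Y" for A
      using null_setsD1[OF that] null_setsD2[OF that] by (intro null_setsI) (simp_all add: Y.emeasure_pair_measure_Times)
    then show ?thesis using E(3) by blast
  qed
  have "AE z in X \<Otimes>\<^sub>M Y. (\<lambda>n. a n (fst z) * b n (snd z)) sums \<phi> z"
    using sums AE_not_in[OF N1] AE_not_in[OF N2] AE_space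
  proof eventually_elim
    case (elim z)
    then have "z \<in> (\<Union>i. D i) \<times> (\<Union>j. E j)"
      by (simp add: space_pair_measure mem_Times_iff)
    then show ?case by (rule elim(1)[rule_format])
  qed
  then have "AE (x, y) in X \<Otimes>\<^sub>M Y. (\<lambda>i. a i x * b i y) sums \<phi> (x, y)"
    by (simp add: case_prod_beta')
  then show ?thesis
    unfolding V_functions_def using \<phi> ab by blast
qed

text \<open>
  The covering rectangles are products of the sets on which the square sums are at most \<open>m + 1\<close>. These sets increase,
  so the products with equal index cover the product of the two unions.
\<close>

lemma V_imp_local_schur_multiplier:
  assumes sX: "sigma_finite_measure X" and sY: "sigma_finite_measure Y" and V: "\<phi> \<in> V_functions X Y"
  shows "local_schur_multiplier X Y \<phi>"
proof -
  obtain a :: "nat \<Rightarrow> 'a \<Rightarrow> complex" and b :: "nat \<Rightarrow> 'b \<Rightarrow> complex" where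
    am: "\<And>i. a i \<in> borel_measurable X" and bm: "\<And>i. b i \<in> borel_measurable Y"
    and ax: "AE x in X. summable (\<lambda>i. (cmod (a i x))\<^sup>2)" and b_sum: "AE y in Y. summable (\<lambda>i. (cmod (b i y))\<^sup>2)"
    and sums: "AE (x, y) in X \<Otimes>\<^sub>M Y. (\<lambda>i. a i x * b i y) sums \<phi> (x, y)"
    and \<phi>: "\<phi> \<in> borel_measurable (X \<Otimes>\<^sub>M Y)"
    using V unfolding V_functions_def by blast
  note [measurable] = am bm
  define \<alpha> where "\<alpha> m = {x \<in> space X. \<forall>K. (\<Sum>k<K. (cmod (a k x))\<^sup>2) \<le> real (Suc m)}" for m
  define \<beta> where "\<beta> m = {y \<in> space Y. \<forall>K. (\<Sum>k<K. (cmod (b k y))\<^sup>2) \<le> real (Suc m)}" for m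
  have \<alpha>[measurable]: "\<alpha> m \<in> sets X" for m unfolding \<alpha>_def by measurable
  have \<beta>[measurable]: "\<beta> m \<in> sets Y" for m unfolding \<beta>_def by measurable
  have ex: "\<exists>m. \<forall>K. (\<Sum>k<K. (cmod (f k))\<^sup>2) \<le> real (Suc m)" if "summable (\<lambda>k. (cmod (f k))\<^sup>2)" for f :: "nat \<Rightarrow> complex"
  proof -
    obtain m where m: "(\<Sum>k. (cmod (f k))\<^sup>2) \<le> real m" using real_arch_simple by blast
    have "(\<Sum>k<K. (cmod (f k))\<^sup>2) \<le> real (Suc m)" for K
      using sum_le_suminf[OF that, of "{..<K}"] m by simp
    then show ?thesis by blast
  qed
  have "AE x in X. x \<notin> space X - (\<Union>m. \<alpha> m)"
    using ax by eventually_elim (use ex in \<open>auto simp: \<alpha>_def\<close>)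
  then have X0: "space X - (\<Union>m. \<alpha> m) \<in> null_sets X" by (subst AE_iff_null_sets) auto
  have "AE y in Y. y \<notin> space Y - (\<Union>m. \<beta> m)"
    using b_sum by eventually_elim (use ex in \<open>auto simp: \<beta>_def\<close>)
  then have Y0: "space Y - (\<Union>m. \<beta> m) \<in> null_sets Y" by (subst AE_iff_null_sets) auto
  have mono: "\<alpha> m \<subseteq> \<alpha> n" "\<beta> m \<subseteq> \<beta> n" if "m \<le> n" for m n
    using that unfolding \<alpha>_def \<beta>_def by (auto intro: order_trans)
  have cov: "covering_family X Y \<alpha> \<beta>"
    unfolding covering_family_def marginally_equivalent_def marginally_null_def
  proof (intro conjI allI \<alpha> \<beta> bexI[OF _ X0] bexI[OF _ Y0] subsetI)
    fix z assume z: "z \<in> sym_diff (\<Union>m. \<alpha> m \<times> \<beta> m) (space X \<times> space Y)"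
    have "(\<Union>m. \<alpha> m \<times> \<beta> m) \<subseteq> space X \<times> space Y" by (auto simp: \<alpha>_def \<beta>_def)
    with z have z': "z \<in> space X \<times> space Y" "z \<notin> (\<Union>m. \<alpha> m \<times> \<beta> m)" by auto
    have "fst z \<notin> (\<Union>m. \<alpha> m) \<or> snd z \<notin> (\<Union>m. \<beta> m)"
    proof (rule ccontr)
      assume "\<not> ?thesis"
      then obtain m n where "fst z \<in> \<alpha> m" "snd z \<in> \<beta> n" by auto
      then have "fst z \<in> \<alpha> (max m n)" "snd z \<in> \<beta> (max m n)"
        using mono(1)[of m "max m n"] mono(2)[of n "max m n"] by auto
      then show False using z'(2) by (auto simp: mem_Times_iff)
    qed
    then show "z \<in> (space X - (\<Union>m. \<alpha> m)) \<times> space Y \<union> space X \<times> (space Y - (\<Union>m. \<beta> m))"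
      using z'(1) by (auto simp: mem_Times_iff)
  qed
  have "schur_multiplier (restrict_space X (\<alpha> m)) (restrict_space Y (\<beta> m)) \<phi>" for m
  proof (rule schur_multiplier_of_factorization[where C="real (Suc m)" and a=a and b=b])
    show "sigma_finite_measure (restrict_space X (\<alpha> m))" "sigma_finite_measure (restrict_space Y (\<beta> m))"
      using sigma_finite_measure_restrict_space[OF sX \<alpha>] sigma_finite_measure_restrict_space[OF sY \<beta>] by blast+
    show "\<phi> \<in> borel_measurable (restrict_space X (\<alpha> m) \<Otimes>\<^sub>M restrict_space Y (\<beta> m))"
      unfolding pair_restrict_space[OF sX sY \<alpha> \<beta>] by (rule measurable_restrict_space1[OF \<phi>])
    show "a k \<in> borel_measurable (restrict_space X (\<alpha> m))" "b k \<in> borel_measurable (restrict_space Y (\<beta> m))" for k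
      by (intro measurable_restrict_space1 am bm)+
    show "(\<Sum>k<K. (cmod (a k x))\<^sup>2) \<le> real (Suc m)" if "x \<in> space (restrict_space X (\<alpha> m))" for x K
      using that \<alpha>[of m] by (simp add: \<alpha>_def)
    show "(\<Sum>k<K. (cmod (b k x))\<^sup>2) \<le> real (Suc m)" if "x \<in> space (restrict_space Y (\<beta> m))" for x K
      using that \<beta>[of m] by (simp add: \<beta>_def)
    show "AE z in restrict_space X (\<alpha> m) \<Otimes>\<^sub>M restrict_space Y (\<beta> m). (\<lambda>k. a k (fst z) * b k (snd z)) sums \<phi> z"
      unfolding pair_restrict_space[OF sX sY \<alpha> \<beta>] using sums \<alpha>[of m] \<beta>[of m]
      by (subst AE_restrict_space_iff) (auto simp: case_prod_beta')
  qed simp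
  then show ?thesis unfolding local_schur_multiplier_def using \<phi> cov by blast
qed

theorem theorem3p6:
  fixes X :: "'a measure" and Y :: "'b measure" and \<phi> :: "'a \<times> 'b \<Rightarrow> complex"
  assumes "standard_sigma_finite X" and "standard_sigma_finite Y"
    and "\<phi> \<in> borel_measurable (X \<Otimes>\<^sub>M Y)"
  shows "local_schur_multiplier X Y \<phi> \<longleftrightarrow> \<phi> \<in> V_functions X Y"
  using local_schur_multiplier_imp_V[OF assms(1,2)] V_imp_local_schur_multiplier assms(1,2)
  unfolding standard_sigma_finite_def by blast

end
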